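(* Suppose $n\ge 2$ is an integer, and let $q,\alpha,s$ be real numbers such that $$-\alpha-s+\frac{n+2}{q}=\frac n2,\qquad 2\le q<\infty,\qquad \frac nq-\frac{n-1}{2}<\alpha<\frac nq.$$ Then there exists a constant $C>0$ depending on $n,q,\alpha$ such that the estimate $$\||x|^{-\alpha}|D_x|^sU(t)\varphi\|_{L^q(\mathbf{R}\times\mathbf{R}^n)}\le C\|\varphi\|_{L^2(\mathbf{R}^n)}$$ holds for all radially symmetric data $\varphi\in L^2(\mathbf{R}^n)$.
   Context: $U(t)=e^{it\Delta}$ is the free Schrödinger group on $\mathbf{R}^n$. $|D_x|^s v=\mathcal{F}^{-1}|\xi|^s\mathcal{F}v$, where $\mathcal{F}$ is the Fourier transform in $x$. The $L^q(\mathbf{R}\times\mathbf{R}^n)$ norm is taken over $(t,x)\in\mathbf{R}\times\mathbf{R}^n$. *)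

theory Defs
  imports "HOL-Analysis.Analysis"
begin

section \<open>Lebesgue spaces\<close>

text \<open>
  Elements of a Lebesgue space are Borel representatives.  \<open>Lp_norm\<close> is meaningful only on
  \<open>Lp_space\<close>, since the Bochner integral of a non-integrable function is 0.
\<close>

definition Lp_space :: "real \<Rightarrow> ('a::euclidean_space \<Rightarrow> complex) set" where
  "Lp_space p = {f \<in> borel_measurable borel. integrable lborel (\<lambda>x. norm (f x) powr p)}"

definition Lp_norm :: "real \<Rightarrow> ('a::euclidean_space \<Rightarrow> complex) \<Rightarrow> real" where
  "Lp_norm p f = (\<integral>x. norm (f x) powr p \<partial>lborel) powr (1 / p)"

text \<open>Radial symmetry is a property of the a.e. class, not of the representative.\<close>

definition radially_symmetric :: "(real^'n \<Rightarrow> complex) \<Rightarrow> bool" where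
  "radially_symmetric \<phi> \<longleftrightarrow>
     (\<exists>f::real \<Rightarrow> complex. f \<in> borel_measurable borel \<and> (AE x in lborel. \<phi> x = f (norm x)))"

section \<open>Fourier transform\<close>

text \<open>
  The unitary normalisation with kernel \<open>exp (- i x \<bullet> \<xi>)\<close>, so that the Laplacian has
  symbol \<open>- \<bar>\<xi>\<bar>\<^sup>2\<close>.
\<close>

definition fourier :: "(real^'n \<Rightarrow> complex) \<Rightarrow> real^'n \<Rightarrow> complex" where
  "fourier f \<xi> = complex_of_real ((2 * pi) powr (- real CARD('n) / 2)) *
     (\<integral>x. exp (- \<i> * complex_of_real (x \<bullet> \<xi>)) * f x \<partial>lborel)"

definition inverse_fourier :: "(real^'n \<Rightarrow> complex) \<Rightarrow> real^'n \<Rightarrow> complex" where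
  "inverse_fourier f x = fourier f (- x)"

text \<open>
  On square-integrable functions the transform is the mean-square limit of the transforms of the
  truncations to balls.  The limit is unique up to null sets; the choice operator picks a
  representative.
\<close>

definition fourier_L2 :: "(real^'n \<Rightarrow> complex) \<Rightarrow> real^'n \<Rightarrow> complex" where
  "fourier_L2 f = (SOME g. g \<in> Lp_space 2 \<and>
     ((\<lambda>R::real. \<integral>\<^sup>+\<xi>. ennreal ((norm (fourier (\<lambda>x. indicator (cball 0 R) x * f x) \<xi> - g \<xi>))\<^sup>2)
        \<partial>lborel) \<longlongrightarrow> 0) at_top)"

definition inverse_fourier_L2 :: "(real^'n \<Rightarrow> complex) \<Rightarrow> real^'n \<Rightarrow> complex" where
  "inverse_fourier_L2 f x = fourier_L2 f (- x)"

section \<open>Tempered distributions\<close>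

text \<open>Iterated partial derivatives along a list of coordinate directions.\<close>

fun partial_derivs :: "'n list \<Rightarrow> (real^'n \<Rightarrow> complex) \<Rightarrow> real^'n \<Rightarrow> complex" where
  "partial_derivs [] f = f"
| "partial_derivs (i # is) f =
     (\<lambda>x. frechet_derivative (partial_derivs is f) (at x) (axis i 1))"

definition schwartz :: "(real^'n \<Rightarrow> complex) set" where
  "schwartz = {\<psi>. \<forall>is. partial_derivs is \<psi> differentiable_on UNIV \<and>
     (\<forall>k::nat. bounded (range (\<lambda>x. (1 + norm x) ^ k * norm (partial_derivs is \<psi> x))))}"

text \<open>
  Tempered distributions are rendered as functionals that are only ever evaluated at Schwartz
  functions.  \<open>represents u T\<close> says that the time-dependent distribution \<open>T\<close> on \<open>\<real>\<^sup>n\<close> is the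
  function \<open>u\<close> of \<open>(t, x)\<close>; such a \<open>u\<close> is unique up to space-time null sets.
\<close>

definition represents ::
  "(real \<times> (real^'n) \<Rightarrow> complex) \<Rightarrow> (real \<Rightarrow> (real^'n \<Rightarrow> complex) \<Rightarrow> complex) \<Rightarrow> bool" where
  "represents u T \<longleftrightarrow> u \<in> borel_measurable borel \<and>
     (AE t in lborel. \<forall>\<psi>\<in>schwartz. integrable lborel (\<lambda>x. u (t, x) * \<psi> x) \<and>
        T t \<psi> = (\<integral>x. u (t, x) * \<psi> x \<partial>lborel))"

section \<open>The operators\<close>

definition schroedinger :: "real \<Rightarrow> (real^'n \<Rightarrow> complex) \<Rightarrow> real^'n \<Rightarrow> complex" where
  "schroedinger t \<phi> =
     inverse_fourier_L2 (\<lambda>\<xi>. exp (- \<i> * complex_of_real (t * (norm \<xi>)\<^sup>2)) * fourier_L2 \<phi> \<xi>)"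

text \<open>
  For square-integrable \<open>v\<close>, the function \<open>\<bar>\<xi>\<bar>\<^sup>s \<F>v\<close> need not be square-integrable, so its inverse
  Fourier transform is taken in the sense of tempered distributions,
  \<open>\<langle>\<F>\<^sup>-\<^sup>1 g, \<psi>\<rangle> = \<langle>g, \<F>\<^sup>-\<^sup>1 \<psi>\<rangle>\<close>.  The integral converges absolutely whenever \<open>s > - n / 2\<close>.
\<close>

definition abs_D :: "real \<Rightarrow> (real^'n \<Rightarrow> complex) \<Rightarrow> (real^'n \<Rightarrow> complex) \<Rightarrow> complex" where
  "abs_D s v \<psi> =
     (\<integral>\<xi>. complex_of_real (norm \<xi> powr s) * fourier_L2 v \<xi> * inverse_fourier \<psi> \<xi> \<partial>lborel)"

end

theory Submission
  imports Defs "HOL-Probability.Probability"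
begin

text \<open>
  The transform of radial data is radial, \<open>\<F>\<phi> \<xi> = g \<bar>\<xi>\<bar>\<close>, so that on the sphere \<open>\<bar>x\<bar> = r\<close> the solution is the
  one-dimensional oscillatory integral
  \<open>u (t, x) = c \<integral> exp (- i t \<rho>\<^sup>2) \<rho> powr (s + n - 1) g \<rho> J (\<rho> r) d\<rho>\<close> over \<open>\<rho> > 0\<close>, where \<open>J r\<close> is the
  mean over the unit sphere of the plane wave of frequency \<open>r\<close>.  This is where radial symmetry enters:
  \<open>J\<close> is a Bessel function up to a power of \<open>r\<close>, and its differential equation gives
  \<open>\<bar>J r\<bar> \<le> C min 1 (r powr (- (n - 1) / 2))\<close> (\<open>sphere_mean_decay\<close>).
  
  Cut the frequencies into the dyadic bands \<open>L \<le> \<rho> < 2 L\<close>, and fix \<open>x\<close>.  One piece \<open>u\<^sub>L\<close> is bounded in time by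
  the Cauchy-Schwarz inequality, and its square integral in time is controlled by a Bessel inequality for
  the phase \<open>\<rho>\<^sup>2\<close>, whose values are \<open>2 L\<close>-separated on the band (\<open>bessel_phase\<close>).  Both together bound the
  integral of \<open>\<bar>u\<^sub>L\<bar>\<close> to the power \<open>q\<close> over time (\<open>band_time_bound\<close>).  By the scaling relation between \<open>\<alpha>\<close>, \<open>s\<close> and \<open>q\<close> the
  bound is \<open>K (L powr (n - \<alpha> q)) (M (L \<bar>x\<bar>) powr q) (a\<^sub>L powr (q / 2))\<close>, where \<open>M\<close> is the majorant of \<open>J\<close> and \<open>a\<^sub>L\<close> is the
  mass of the data in the band.  Integrated against \<open>\<bar>x\<bar> powr (- \<alpha> q)\<close> it no longer depends on \<open>L\<close> except through
  \<open>a\<^sub>L\<close>; the upper bound for \<open>\<alpha>\<close> makes the integral converge at the origin, and the lower bound makes it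
  converge at infinity.
  
  Both bounds are strict, so there is room for an additional weight: the integral still converges after
  multiplying \<open>u\<^sub>L\<close> by \<open>w\<^sub>L = max (L \<bar>x\<bar>) (1 / (L \<bar>x\<bar>)) powr \<epsilon>\<close>.  Since the sum of \<open>1 / w\<^sub>L\<close> over the dyadic scales is
  bounded uniformly in \<open>x\<close>, the sum of the \<open>\<bar>u\<^sub>L\<bar>\<close> is at most a constant times the supremum of the \<open>w\<^sub>L \<bar>u\<^sub>L\<bar>\<close>, hence its power \<open>q\<close> is at
  most a constant times the sum of the powers \<open>q\<close> of the \<open>w\<^sub>L \<bar>u\<^sub>L\<bar>\<close>.  With \<open>q \<ge> 2\<close> the sum of the
  \<open>a\<^sub>L powr (q / 2)\<close> is at most \<open>(\<Sum> a\<^sub>L) powr (q / 2)\<close>, and the estimate follows (\<open>wave_majorant\<close>).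
  
  It remains to identify the sum of the pieces with \<open>\<bar>D\<bar>\<^sup>s U(t) \<phi>\<close>.  The mean-square Fourier transform is
  given by a choice of limit, so its existence, boundedness and inversion (\<open>fourier_L2_inversion\<close>) are
  established here; all three rest on Gaussian regularisation.  The majorant of the sum of the \<open>\<bar>u\<^sub>L\<bar>\<close> then allows
  the pairing with a Schwartz function to be computed band by band (\<open>wave_pairing\<close>).
\<close>

section \<open>Gaussians and a Bessel inequality for oscillatory integrals\<close>

lemma borel_measurable_cis [measurable]: "cis \<in> borel_measurable borel"
  by (intro borel_measurable_continuous_onI continuous_intros)

lemma ennreal_half_plus_half: "x / 2 + x / 2 = (x::ennreal)"
proof (cases x)
  case (real r)
  then have "x / 2 = ennreal (r / 2)"
    by (metis divide_ennreal ennreal_numeral zero_le_numeral zero_less_numeral)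
  with real show ?thesis by (simp flip: ennreal_plus)
qed (simp add: ennreal_top_divide)

lemma nn_integral_lborel_affine:
  fixes t :: "'a::euclidean_space"
  assumes [measurable]: "f \<in> borel_measurable borel" and c: "c \<noteq> 0"
  shows "(\<integral>\<^sup>+x. f x \<partial>lborel) = ennreal (\<bar>c\<bar> ^ DIM('a)) * (\<integral>\<^sup>+x. f (t + c *\<^sub>R x) \<partial>lborel)"
  by (subst lborel_affine[OF c, of t])
     (simp add: nn_integral_density nn_integral_distr nn_integral_cmult)

lemma nn_integral_lborel_reflect:
  fixes t :: "'a::euclidean_space"
  assumes "f \<in> borel_measurable borel"
  shows "(\<integral>\<^sup>+x. f (t - x) \<partial>lborel) = (\<integral>\<^sup>+x. f x \<partial>lborel)"
  using nn_integral_lborel_affine[OF assms, of "-1" t] by simp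

lemma lborel_distr_reflect:
  fixes t :: "'a::euclidean_space"
  shows "distr lborel borel (\<lambda>x. t - x) = lborel"
  by (subst lborel_affine[of "-1" t]) (auto simp: density_1)

lemma integral_lborel_reflect:
  fixes f :: "'a::euclidean_space \<Rightarrow> 'b::{banach, second_countable_topology}"
  assumes [measurable]: "f \<in> borel_measurable borel"
  shows "(\<integral>x. f (t - x) \<partial>lborel) = (\<integral>x. f x \<partial>lborel)"
    and "integrable lborel (\<lambda>x. f (t - x)) \<longleftrightarrow> integrable lborel f"
  using integral_distr[of "\<lambda>x. t - x" lborel borel f] 
     integrable_distr_eq[of "\<lambda>x. t - x" lborel borel f]
  by (auto simp: lborel_distr_reflect)

lemma lborel_integral_prod:
  fixes f :: "'a::euclidean_space \<Rightarrow> real \<Rightarrow> complex"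
  assumes f: "\<And>b. b \<in> Basis \<Longrightarrow> integrable lborel (f b)"
  shows "integrable lborel (\<lambda>x::'a. \<Prod>b\<in>Basis. f b (x \<bullet> b))"
    and "(\<integral>x. (\<Prod>b\<in>Basis. f b (x \<bullet> b)) \<partial>(lborel :: 'a measure)) = (\<Prod>b\<in>Basis. \<integral>x. f b x \<partial>lborel)"
proof -
  interpret product_sigma_finite "\<lambda>b::'a. lborel :: real measure"
    by standard
  have [measurable]: "\<And>b. b \<in> Basis \<Longrightarrow> f b \<in> borel_measurable borel"
    using f by (metis borel_measurable_integrable measurable_lborel2)
  have inner: "(\<Sum>b\<in>Basis. g b *\<^sub>R b) \<bullet> c = g c" if "c \<in> Basis" for g and c :: 'a
    using that by (simp add: inner_sum_left inner_Basis if_distrib cong: if_cong)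
  have m1: "(\<lambda>g. \<Sum>b\<in>Basis. g b *\<^sub>R b) \<in> (\<Pi>\<^sub>M b\<in>(Basis::'a set). lborel) \<rightarrow>\<^sub>M (borel::'a measure)"
    by measurable
  have m2: "(\<lambda>x::'a. \<Prod>b\<in>Basis. f b (x \<bullet> b)) \<in> borel_measurable borel"
    by measurable
  have eq: "(\<Prod>b\<in>Basis. f b ((\<Sum>b\<in>Basis. g b *\<^sub>R b) \<bullet> b)) = (\<Prod>b\<in>(Basis::'a set). f b (g b))" for g
    by (intro prod.cong refl) (simp add: inner)
  show "integrable lborel (\<lambda>x::'a. \<Prod>b\<in>Basis. f b (x \<bullet> b))"
    by (subst lborel_eq, subst integrable_distr_eq[OF m1 m2])
       (simp add: eq product_integrable_prod f)
  show "(\<integral>x. (\<Prod>b\<in>Basis. f b (x \<bullet> b)) \<partial>(lborel :: 'a measure)) = (\<Prod>b\<in>Basis. \<integral>x. f b x \<partial>lborel)"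
    by (subst lborel_eq, subst integral_distr[OF m1 m2])
       (simp add: eq product_integral_prod f)
qed

text \<open>
  A rescaling of the characteristic function of the standard normal distribution.
\<close>
lemma gaussian_fourier_real:
  fixes y e :: real
  assumes e: "e > 0"
  shows "integrable lborel (\<lambda>t. complex_of_real (exp (- (e / 2) * t\<^sup>2)) * cis (t * y))"
    and "(\<integral>t. complex_of_real (exp (- (e / 2) * t\<^sup>2)) * cis (t * y) \<partial>lborel)
           = complex_of_real (sqrt (2 * pi / e) * exp (- y\<^sup>2 / (2 * e)))"
proof -
  interpret real_distribution std_normal_distribution by (rule real_dist_normal_dist)
  define c where "c = sqrt e"
  have c: "c > 0" "c\<^sup>2 = e" using e by (auto simp: c_def)
  have i0: "integrable std_normal_distribution (\<lambda>x. cis (y / c * x))"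
    by (rule integrable_const_bound[where B=1]) auto
  have *: "integrable lborel (\<lambda>x. std_normal_density x *\<^sub>R cis (y / c * x))"
    using i0 by (subst (asm) integrable_density) (auto simp: normal_density_nonneg)
  have "(\<integral>x. std_normal_density x *\<^sub>R cis (y / c * x) \<partial>lborel) 
      = (\<integral>x. cis (y / c * x) \<partial>std_normal_distribution)"
    by (subst integral_density) (auto simp: normal_density_nonneg)
  also have "\<dots> = char std_normal_distribution (y / c)"
    by (simp add: char_def cis_conv_exp mult_ac)
  also have "\<dots> = exp (- (y\<^sup>2 / (2 * e)))"
    by (simp add: char_std_normal_distribution power_divide c)
  finally have **: "(\<integral>x. std_normal_density x *\<^sub>R cis (y / c * x) \<partial>lborel) = exp (- (y\<^sup>2 / (2 * e)))" .
  have eq: "complex_of_real (sqrt (2 * pi)) * (std_normal_density (c * t) *\<^sub>R cis (y / c * (c * t)))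
     = complex_of_real (exp (- (e / 2) * t\<^sup>2)) * cis (t * y)" for t
    using c by (simp add: std_normal_density_def power_mult_distrib mult_ac scaleR_conv_of_real)
  have h: "has_bochner_integral lborel (\<lambda>x. std_normal_density x *\<^sub>R cis (y / c * x)) (complex_of_real (exp (- (y\<^sup>2 / (2 * e)))))"
    using * ** by (simp add: has_bochner_integral_iff)
  have h2: "has_bochner_integral lborel (\<lambda>t. std_normal_density (c * t) *\<^sub>R cis (y / c * (c * t)))
      (complex_of_real (exp (- (y\<^sup>2 / (2 * e)))) /\<^sub>R \<bar>c\<bar>)"
    using lborel_has_bochner_integral_real_affine_iff[THEN iffD1, OF _ h, of c 0] c(1) unfolding add_0 by blast
  have h3: "has_bochner_integral lborel (\<lambda>t. (complex_of_real (exp (- (e / 2) * t\<^sup>2)) * cis (t * y))) 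
      (complex_of_real (sqrt (2 * pi)) * (complex_of_real (exp (- (y\<^sup>2 / (2 * e)))) /\<^sub>R \<bar>c\<bar>))"
    using has_bochner_integral_mult_right[OF h2, of "complex_of_real (sqrt (2 * pi))"] unfolding eq by simp
  have "complex_of_real (sqrt (2 * pi)) * (complex_of_real (exp (- (y\<^sup>2 / (2 * e)))) /\<^sub>R \<bar>c\<bar>) 
      = complex_of_real (sqrt (2 * pi / e) * exp (- y\<^sup>2 / (2 * e)))"
    using c e by (simp add: scaleR_conv_of_real real_sqrt_divide c_def field_simps)
  with h3 show "integrable lborel (\<lambda>t. complex_of_real (exp (- (e / 2) * t\<^sup>2)) * cis (t * y))"
    and "(\<integral>t. complex_of_real (exp (- (e / 2) * t\<^sup>2)) * cis (t * y) \<partial>lborel)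
           = complex_of_real (sqrt (2 * pi / e) * exp (- y\<^sup>2 / (2 * e)))"
    by (simp_all add: has_bochner_integral_iff)
qed

lemma cis_sum: "finite A \<Longrightarrow> cis (sum f A) = (\<Prod>a\<in>A. cis (f a))"
  by (induction A rule: finite_induct) (auto simp: cis_mult[symmetric])

text \<open>
  The Fourier transform, with kernel \<open>cis (t \<bullet> y)\<close> and no normalising factor, of the Gaussian
  \<open>exp (- e \<bar>t\<bar>\<^sup>2 / 2)\<close>; its mass \<open>(2 \<pi>)\<^sup>N\<close> does not depend on \<open>e\<close>, and it concentrates at 0 as \<open>e\<close> tends to 0.
\<close>
definition gauss_kernel :: "real \<Rightarrow> 'a::euclidean_space \<Rightarrow> real" where
  "gauss_kernel e y = sqrt (2 * pi / e) ^ DIM('a) * exp (- (norm y)\<^sup>2 / (2 * e))"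

lemma norm_power2_Basis: "(norm (x::'a::euclidean_space))\<^sup>2 = (\<Sum>b\<in>Basis. (x \<bullet> b)\<^sup>2)"
  by (subst power2_norm_eq_inner, subst euclidean_inner) (simp add: power2_eq_square)

lemma gaussian_fourier:
  fixes y :: "'a::euclidean_space"
  assumes e: "e > 0"
  shows "integrable lborel (\<lambda>t. complex_of_real (exp (- (e / 2) * (norm t)\<^sup>2)) * cis (t \<bullet> y))"
    and "(\<integral>t. complex_of_real (exp (- (e / 2) * (norm t)\<^sup>2)) * cis (t \<bullet> y) \<partial>lborel)
           = complex_of_real (gauss_kernel e y)"
proof -
  define f where "f = (\<lambda>(b::'a) t. complex_of_real (exp (- (e / 2) * t\<^sup>2)) * cis (t * (y \<bullet> b)))"
  have f: "integrable lborel (f b)" for b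
    unfolding f_def using gaussian_fourier_real(1)[OF e, of "y \<bullet> b"] by simp
  have eq: "(\<lambda>t. complex_of_real (exp (- (e / 2) * (norm t)\<^sup>2)) * cis (t \<bullet> y)) = (\<lambda>t. \<Prod>b\<in>Basis. f b (t \<bullet> b))"
  proof
    fix t :: 'a
    have "exp (- (e / 2) * (norm t)\<^sup>2) = (\<Prod>b\<in>Basis. exp (- (e / 2) * (t \<bullet> b)\<^sup>2))"
      by (subst exp_sum[symmetric]) (simp_all add: norm_power2_Basis sum_distrib_left)
    moreover have "cis (t \<bullet> y) = (\<Prod>b\<in>Basis. cis ((t \<bullet> b) * (y \<bullet> b)))"
      by (subst euclidean_inner) (simp add: cis_sum)
    ultimately show "complex_of_real (exp (- (e / 2) * (norm t)\<^sup>2)) * cis (t \<bullet> y) = (\<Prod>b\<in>Basis. f b (t \<bullet> b))"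
      by (simp add: f_def prod.distrib)
  qed
  show "integrable lborel (\<lambda>t. complex_of_real (exp (- (e / 2) * (norm t)\<^sup>2)) * cis (t \<bullet> y))"
    unfolding eq by (rule lborel_integral_prod) (rule f)
  have "(\<integral>t. complex_of_real (exp (- (e / 2) * (norm t)\<^sup>2)) * cis (t \<bullet> y) \<partial>lborel)
     = (\<Prod>b\<in>Basis. \<integral>t. f b t \<partial>lborel)"
    unfolding eq by (rule lborel_integral_prod) (rule f)
  also have "\<dots> = (\<Prod>b\<in>Basis. complex_of_real (sqrt (2 * pi / e) * exp (- (y \<bullet> b)\<^sup>2 / (2 * e))))"
    unfolding f_def by (intro prod.cong refl gaussian_fourier_real(2) e)
  also have "\<dots> = complex_of_real (\<Prod>b\<in>Basis. sqrt (2 * pi / e) * exp (- (y \<bullet> b)\<^sup>2 / (2 * e)))"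
    by simp
  also have "(\<Prod>b\<in>Basis. sqrt (2 * pi / e) * exp (- (y \<bullet> b)\<^sup>2 / (2 * e))) = gauss_kernel e y"
    by (simp add: gauss_kernel_def prod.distrib norm_power2_Basis flip: exp_sum) (simp add: sum_divide_distrib sum_negf)
  finally show "(\<integral>t. complex_of_real (exp (- (e / 2) * (norm t)\<^sup>2)) * cis (t \<bullet> y) \<partial>lborel)
           = complex_of_real (gauss_kernel e y)" .
qed

lemma gauss_kernel_nonneg [simp]: "0 \<le> gauss_kernel e y" if "e > 0"
  using that by (simp add: gauss_kernel_def)

lemma borel_measurable_gauss_kernel [measurable]: "gauss_kernel e \<in> borel_measurable borel"
  unfolding gauss_kernel_def[abs_def] by measurable

lemma nn_integral_gauss_kernel:
  assumes e: "e > 0" 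
  shows "(\<integral>\<^sup>+y. ennreal (gauss_kernel e (y::'a::euclidean_space)) \<partial>lborel) = ennreal ((2 * pi) ^ DIM('a))"
proof -
  have e': "1 / e > 0" using e by simp
  have i: "integrable lborel (\<lambda>t::'a. complex_of_real (exp (- ((1/e) / 2) * (norm t)\<^sup>2)))"
    using gaussian_fourier(1)[OF e', of "0::'a"] by simp
  have v: "(\<integral>t. complex_of_real (exp (- ((1/e) / 2) * (norm t)\<^sup>2)) \<partial>(lborel::'a measure)) = complex_of_real (sqrt (2 * pi * e) ^ DIM('a))"
    using gaussian_fourier(2)[OF e', of "0::'a"] by (simp add: gauss_kernel_def)
  have i': "integrable lborel (\<lambda>t::'a. exp (- ((1/e) / 2) * (norm t)\<^sup>2))"
    using integrable_Re[OF i] by simp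
  have v': "(\<integral>t. exp (- ((1/e) / 2) * (norm t)\<^sup>2) \<partial>(lborel::'a measure)) = sqrt (2 * pi * e) ^ DIM('a)"
    using v by (metis integral_complex_of_real of_real_eq_iff)
  have "(\<integral>\<^sup>+y. ennreal (gauss_kernel e (y::'a)) \<partial>lborel) = 
     ennreal (\<integral>y. gauss_kernel e (y::'a) \<partial>lborel)"
    using i' e by (intro nn_integral_eq_integral) (auto simp: gauss_kernel_def mult_ac)
  also have "(\<integral>y. gauss_kernel e (y::'a) \<partial>lborel) = sqrt (2 * pi / e) ^ DIM('a) * (sqrt (2 * pi * e) ^ DIM('a))"
    using v' by (simp add: gauss_kernel_def mult_ac)
  also have "\<dots> = (2 * pi) ^ DIM('a)"
  proof -
    have "2 * pi / e * (2 * pi * e) = (2 * pi)\<^sup>2" using e by (simp add: power2_eq_square)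
    then have "sqrt (2 * pi / e) * sqrt (2 * pi * e) = 2 * pi"
      by (subst real_sqrt_mult[symmetric]) (simp only: real_sqrt_abs, simp)
    then show ?thesis by (simp only: power_mult_distrib[symmetric])
  qed
  finally show ?thesis .
qed

lemma nn_integral_gauss_kernel_scaled:
  fixes y :: "'a::euclidean_space"
  assumes e: "e > 0" and k: "k > 0"
  shows "(\<integral>\<^sup>+x. ennreal (gauss_kernel e (k *\<^sub>R (y - x))) \<partial>lborel) = ennreal ((2 * pi / k) ^ DIM('a))"
proof -
  let ?I = "\<integral>\<^sup>+x. ennreal (gauss_kernel e (k *\<^sub>R (y - x))) \<partial>lborel"
  have "ennreal ((2 * pi) ^ DIM('a)) = ennreal (k ^ DIM('a)) * ?I"
    using nn_integral_lborel_affine[of "\<lambda>x::'a. ennreal (gauss_kernel e x)" "-k" "k *\<^sub>R y"] k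
    by (simp add: nn_integral_gauss_kernel[OF e] scaleR_diff_right)
  then have "ennreal (1 / k ^ DIM('a)) * ennreal ((2 * pi) ^ DIM('a)) = ennreal (1 / k ^ DIM('a)) * (ennreal (k ^ DIM('a)) * ?I)"
    by simp
  also have "\<dots> = ?I"
    using k by (simp add: mult.assoc[symmetric] flip: ennreal_mult)
  finally show ?thesis
    using k by (simp add: power_divide flip: ennreal_mult)
qed

lemma (in pair_sigma_finite) integral_tensor:
  fixes f :: "'a \<Rightarrow> complex" and g :: "'b \<Rightarrow> complex"
  assumes f: "integrable M1 f" and g: "integrable M2 g"
  shows "integrable (M1 \<Otimes>\<^sub>M M2) (\<lambda>(x, y). f x * g y)"
    and "integral\<^sup>L (M1 \<Otimes>\<^sub>M M2) (\<lambda>(x, y). f x * g y) = integral\<^sup>L M1 f * integral\<^sup>L M2 g"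
proof -
  have [measurable]: "f \<in> borel_measurable M1" "g \<in> borel_measurable M2" using f g by auto
  show i: "integrable (M1 \<Otimes>\<^sub>M M2) (\<lambda>(x, y). f x * g y)"
    by (rule Fubini_integrable) (use f g in \<open>auto simp: norm_mult\<close>)
  show "integral\<^sup>L (M1 \<Otimes>\<^sub>M M2) (\<lambda>(x, y). f x * g y) = integral\<^sup>L M1 f * integral\<^sup>L M2 g"
    using integral_fst[OF i] by simp
qed

lemma integrable_cis_mult:
  assumes "integrable M f" and [measurable]: "\<theta> \<in> borel_measurable M"
  shows "integrable M (\<lambda>x. cis (\<theta> x) * f x)"
proof (rule Bochner_Integration.integrable_bound[OF assms(1)])
  have [measurable]: "f \<in> borel_measurable M" using assms by auto
  show "(\<lambda>x. cis (\<theta> x) * f x) \<in> borel_measurable M" by measurable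
qed (auto simp: norm_mult)

lemma borel_measurable_cnj [measurable]: "cnj \<in> borel_measurable borel"
  by (intro borel_measurable_continuous_onI continuous_intros)

text \<open>
  The left side is a double integral of \<open>H x * cnj (H y)\<close> against the kernel at \<open>\<theta> y - \<theta> x\<close>.  The kernel is
  positive and decreasing in the norm, so separation allows it to be evaluated at \<open>k (y - x)\<close> instead; its
  integral in either variable is then \<open>(2 \<pi> / k)\<^sup>N\<close>, and \<open>\<bar>H x\<bar> \<bar>H y\<bar>\<close> is split into the two squares.
\<close>
lemma bessel_phase_regularised:
  fixes \<theta> :: "'a::euclidean_space \<Rightarrow> 'a" and H :: "'a \<Rightarrow> complex"
  assumes k: "k > 0" and [measurable]: "\<theta> \<in> borel_measurable borel"
    and sep: "\<And>x y. H x \<noteq> 0 \<Longrightarrow> H y \<noteq> 0 \<Longrightarrow> k * norm (x - y) \<le> norm (\<theta> x - \<theta> y)"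
    and H: "integrable lborel H" and e: "e > 0"
  shows "(\<integral>\<^sup>+t. ennreal (exp (- (e / 2) * (norm t)\<^sup>2) * (norm (\<integral>x. cis (- (t \<bullet> \<theta> x)) * H x \<partial>lborel))\<^sup>2) \<partial>lborel)
     \<le> ennreal ((2 * pi / k) ^ DIM('a)) * (\<integral>\<^sup>+x. ennreal ((norm (H x))\<^sup>2) \<partial>lborel)"
proof -
  have [measurable]: "H \<in> borel_measurable borel" using H by auto
  define Fh where "Fh t = (\<integral>x. cis (- (t \<bullet> \<theta> x)) * H x \<partial>lborel)" for t
  have Hc: "integrable lborel (\<lambda>x. cnj (H x))" using H by simp
  define T where "T = (\<lambda>t (x, y). complex_of_real (exp (- (e / 2) * (norm t)\<^sup>2)) * cis (t \<bullet> (\<theta> y - \<theta> x)) * (H x * cnj (H y)))"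
  have Tm [measurable]: "(\<lambda>(t, z). T t z) \<in> borel_measurable (lborel \<Otimes>\<^sub>M (lborel \<Otimes>\<^sub>M lborel))"
    unfolding T_def by measurable
  interpret P: pair_sigma_finite "lborel::'a measure" "lborel \<Otimes>\<^sub>M lborel :: ('a \<times> 'a) measure" ..
  have gic: "integrable lborel (\<lambda>t::'a. complex_of_real (exp (- (e / 2) * (norm t)\<^sup>2)))"
    using gaussian_fourier(1)[OF e, of "0::'a"] by simp
  have tens: "integrable (lborel \<Otimes>\<^sub>M lborel) (\<lambda>(x, y). H x * cnj (H y))"
    by (rule lborel_pair.integral_tensor[OF H Hc])
  have Ti: "integrable (lborel \<Otimes>\<^sub>M (lborel \<Otimes>\<^sub>M lborel)) (\<lambda>(t, z). T t z)"
    by (rule Bochner_Integration.integrable_bound[OF P.integral_tensor(1)[OF gic tens]])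
       (auto simp: T_def norm_mult)
  have F1: "(\<integral>z. T t z \<partial>(lborel \<Otimes>\<^sub>M lborel)) = complex_of_real (exp (- (e / 2) * (norm t)\<^sup>2) * (norm (Fh t))\<^sup>2)" for t
  proof -
    let ?c = "complex_of_real (exp (- (e / 2) * (norm t)\<^sup>2))"
    have a: "integrable lborel (\<lambda>x. cis (- (t \<bullet> \<theta> x)) * H x)" "integrable lborel (\<lambda>x. cnj (cis (- (t \<bullet> \<theta> x)) * H x))"
      using integrable_cis_mult[OF H, of "\<lambda>x. - (t \<bullet> \<theta> x)"] by (auto simp del: complex_cnj_mult)
    have "T t = (\<lambda>z. ?c * (case z of (x, y) \<Rightarrow> (cis (- (t \<bullet> \<theta> x)) * H x) * cnj (cis (- (t \<bullet> \<theta> y)) * H y)))"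
    proof -
      have "cis (t \<bullet> (\<theta> y - \<theta> x)) = cis (- (t \<bullet> \<theta> x)) * cnj (cis (- (t \<bullet> \<theta> y)))" for x y
        by (simp add: cis_cnj cis_mult inner_diff_right)
      then show ?thesis by (auto simp: T_def fun_eq_iff)
    qed
    then have "(\<integral>z. T t z \<partial>(lborel \<Otimes>\<^sub>M lborel)) = ?c * (Fh t * cnj (Fh t))"
      using lborel_pair.integral_tensor(2)[OF a] by (simp add: Fh_def del: complex_cnj_mult)
    also have "\<dots> = complex_of_real (exp (- (e / 2) * (norm t)\<^sup>2) * (norm (Fh t))\<^sup>2)"
      by (simp only: complex_norm_square[symmetric] of_real_mult)
    finally show ?thesis .
  qed
  have F2: "(\<integral>t. T t z \<partial>lborel) = complex_of_real (gauss_kernel e (\<theta> (snd z) - \<theta> (fst z))) * (H (fst z) * cnj (H (snd z)))" for z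
    using gaussian_fourier(2)[OF e, of "\<theta> (snd z) - \<theta> (fst z)"]
    by (cases z) (simp add: T_def)
  have i1: "integrable lborel (\<lambda>t. complex_of_real (exp (- (e / 2) * (norm t)\<^sup>2) * (norm (Fh t))\<^sup>2))"
    using P.integrable_fst[OF Ti] unfolding F1 .
  have i2: "integrable (lborel \<Otimes>\<^sub>M lborel) (\<lambda>z. complex_of_real (gauss_kernel e (\<theta> (snd z) - \<theta> (fst z))) * (H (fst z) * cnj (H (snd z))))"
    using P.integrable_snd[OF Ti] unfolding F2 .
  have i1': "integrable lborel (\<lambda>t. exp (- (e / 2) * (norm t)\<^sup>2) * (norm (Fh t))\<^sup>2)"
    using integrable_Re[OF i1] by (simp only: Re_complex_of_real)
  have half: "ennreal a / 2 = ennreal (a / 2)" if "a \<ge> 0" for a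
    using that by (metis divide_ennreal ennreal_numeral zero_le_numeral zero_less_numeral)
  let ?Q = "\<integral>\<^sup>+x. ennreal ((norm (H x))\<^sup>2) \<partial>lborel"
  let ?C = "ennreal ((2 * pi / k) ^ DIM('a))"
  let ?K = "\<lambda>x y :: 'a. ennreal (gauss_kernel e (k *\<^sub>R (y - x)))"
  have "(\<integral>\<^sup>+t. ennreal (exp (- (e / 2) * (norm t)\<^sup>2) * (norm (Fh t))\<^sup>2) \<partial>lborel)
     = ennreal (\<integral>t. exp (- (e / 2) * (norm t)\<^sup>2) * (norm (Fh t))\<^sup>2 \<partial>lborel)"
    by (rule nn_integral_eq_integral[OF i1']) auto
  also have "\<dots> = ennreal (norm (\<integral>t. complex_of_real (exp (- (e / 2) * (norm t)\<^sup>2) * (norm (Fh t))\<^sup>2) \<partial>lborel))"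
    by (subst integral_complex_of_real) (simp add: integral_nonneg_AE)
  also have "(\<integral>t. complex_of_real (exp (- (e / 2) * (norm t)\<^sup>2) * (norm (Fh t))\<^sup>2) \<partial>lborel) =
     (\<integral>z. complex_of_real (gauss_kernel e (\<theta> (snd z) - \<theta> (fst z))) * (H (fst z) * cnj (H (snd z))) \<partial>(lborel \<Otimes>\<^sub>M lborel))"
    using P.Fubini_integral[OF Ti] unfolding F1 F2 by simp
  also have "ennreal (norm \<dots>) \<le> (\<integral>\<^sup>+z. ennreal (norm (complex_of_real (gauss_kernel e (\<theta> (snd z) - \<theta> (fst z))) * (H (fst z) * cnj (H (snd z))))) \<partial>(lborel \<Otimes>\<^sub>M lborel))"
    by (rule integral_norm_bound_ennreal[OF i2])
  also have "\<dots> \<le> (\<integral>\<^sup>+(x, y). ennreal ((norm (H x))\<^sup>2) / 2 * ?K x y + ennreal ((norm (H y))\<^sup>2) / 2 * ?K x y \<partial>(lborel \<Otimes>\<^sub>M lborel))"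
  proof (rule nn_integral_mono, clarsimp)
    fix x y
    show "ennreal (norm (complex_of_real (gauss_kernel e (\<theta> y - \<theta> x)) * (H x * cnj (H y)))) 
       \<le> ennreal ((norm (H x))\<^sup>2) / 2 * ?K x y + ennreal ((norm (H y))\<^sup>2) / 2 * ?K x y"
    proof (cases "H x \<noteq> 0 \<and> H y \<noteq> 0")
      case True
      have "(norm (k *\<^sub>R (y - x)))\<^sup>2 \<le> (norm (\<theta> y - \<theta> x))\<^sup>2"
        using sep[of y x] True k by (intro power_mono) auto
      then have *: "gauss_kernel e (\<theta> y - \<theta> x) \<le> gauss_kernel e (k *\<^sub>R (y - x))"
        using e unfolding gauss_kernel_def by (intro mult_left_mono) (auto simp: divide_right_mono)
      have "norm (H x) * norm (H y) \<le> (norm (H x))\<^sup>2 / 2 + (norm (H y))\<^sup>2 / 2"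
        using sum_squares_bound[of "norm (H x)" "norm (H y)"] by simp
      from mult_mono[OF * this] e
      have "norm (complex_of_real (gauss_kernel e (\<theta> y - \<theta> x)) * (H x * cnj (H y))) \<le> gauss_kernel e (k *\<^sub>R (y - x)) * ((norm (H x))\<^sup>2 / 2 + (norm (H y))\<^sup>2 / 2)"
        by (simp add: norm_mult)
      also have "\<dots> = (norm (H x))\<^sup>2 / 2 * gauss_kernel e (k *\<^sub>R (y - x)) + (norm (H y))\<^sup>2 / 2 * gauss_kernel e (k *\<^sub>R (y - x))"
        by (simp add: algebra_simps)
      finally have "ennreal (norm (complex_of_real (gauss_kernel e (\<theta> y - \<theta> x)) * (H x * cnj (H y)))) \<le> ennreal \<dots>"
        by (rule ennreal_leI)
      also have "\<dots> = ennreal ((norm (H x))\<^sup>2 / 2) * ?K x y + ennreal ((norm (H y))\<^sup>2 / 2) * ?K x y"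
        using e by (subst ennreal_plus) (auto simp: ennreal_mult[symmetric])
      finally show ?thesis by (simp only: half zero_le_power2)
    qed auto
  qed
  also have "\<dots> = (\<integral>\<^sup>+(x, y). ennreal ((norm (H x))\<^sup>2) / 2 * ?K x y \<partial>(lborel \<Otimes>\<^sub>M lborel)) + (\<integral>\<^sup>+(x, y). ennreal ((norm (H y))\<^sup>2) / 2 * ?K x y \<partial>(lborel \<Otimes>\<^sub>M lborel))"
    by (subst nn_integral_add[symmetric]) (auto simp: split_def)
  also have "(\<integral>\<^sup>+(x, y). ennreal ((norm (H x))\<^sup>2) / 2 * ?K x y \<partial>(lborel \<Otimes>\<^sub>M lborel)) = (\<integral>\<^sup>+x. (\<integral>\<^sup>+y. ennreal ((norm (H x))\<^sup>2) / 2 * ?K x y \<partial>lborel) \<partial>lborel)"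
    by (subst lborel.nn_integral_fst[symmetric]) auto
  also have "\<dots> = (\<integral>\<^sup>+x. ennreal ((norm (H x))\<^sup>2) / 2 * ?C \<partial>lborel)"
  proof (intro nn_integral_cong)
    fix x :: 'a
    have "(\<integral>\<^sup>+y. ?K x y \<partial>lborel) = (\<integral>\<^sup>+y. ?K y x \<partial>lborel)"
      by (intro nn_integral_cong) (simp add: gauss_kernel_def norm_minus_commute)
    then show "(\<integral>\<^sup>+y. ennreal ((norm (H x))\<^sup>2) / 2 * ?K x y \<partial>lborel) = ennreal ((norm (H x))\<^sup>2) / 2 * ?C"
      by (simp add: nn_integral_cmult nn_integral_gauss_kernel_scaled[OF e k])
  qed
  also have "\<dots> = ?Q / 2 * ?C"
    by (simp add: nn_integral_multc nn_integral_divide)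
  also have "(\<integral>\<^sup>+(x, y). ennreal ((norm (H y))\<^sup>2) / 2 * ?K x y \<partial>(lborel \<Otimes>\<^sub>M lborel)) = (\<integral>\<^sup>+y. (\<integral>\<^sup>+x. ennreal ((norm (H y))\<^sup>2) / 2 * ?K x y \<partial>lborel) \<partial>lborel)"
    by (subst lborel_pair.nn_integral_snd[symmetric]) auto
  also have "\<dots> = (\<integral>\<^sup>+x. ennreal ((norm (H x))\<^sup>2) / 2 * ?C \<partial>lborel)"
    by (simp add: nn_integral_cmult nn_integral_gauss_kernel_scaled[OF e k])
  also have "\<dots> = ?Q / 2 * ?C"
    by (simp add: nn_integral_multc nn_integral_divide)
  also have "?Q / 2 * ?C + ?Q / 2 * ?C = ?C * ?Q"
    by (simp only: distrib_right[symmetric] ennreal_half_plus_half) (rule mult.commute)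
  finally show ?thesis unfolding Fh_def .
qed

text \<open>
  With \<open>\<theta> = id\<close> this is Bessel's inequality for the Fourier transform.  On the line, with \<open>\<theta> \<rho> = \<rho>\<^sup>2\<close>, it gives
  the square integral in time of a frequency band of a Schroedinger wave.
\<close>
lemma bessel_phase:
  fixes \<theta> :: "'a::euclidean_space \<Rightarrow> 'a" and H :: "'a \<Rightarrow> complex"
  assumes k: "k > 0" and [measurable]: "\<theta> \<in> borel_measurable borel"
    and sep: "\<And>x y. H x \<noteq> 0 \<Longrightarrow> H y \<noteq> 0 \<Longrightarrow> k * norm (x - y) \<le> norm (\<theta> x - \<theta> y)"
    and H: "integrable lborel H"
  shows "(\<integral>\<^sup>+t. ennreal ((norm (\<integral>x. cis (- (t \<bullet> \<theta> x)) * H x \<partial>lborel))\<^sup>2) \<partial>lborel)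
     \<le> ennreal ((2 * pi / k) ^ DIM('a)) * (\<integral>\<^sup>+x. ennreal ((norm (H x))\<^sup>2) \<partial>lborel)"
proof -
  have [measurable]: "H \<in> borel_measurable borel" using H by auto
  define Fh where "Fh t = (\<integral>x. cis (- (t \<bullet> \<theta> x)) * H x \<partial>lborel)" for t
  have [measurable]: "Fh \<in> borel_measurable borel"
    unfolding Fh_def by measurable
  let ?g = "\<lambda>i t. ennreal (exp (- (1 / real (Suc i) / 2) * (norm t)\<^sup>2) * (norm (Fh t))\<^sup>2)"
  have lim: "(\<lambda>i. ?g i t) \<longlonglongrightarrow> ennreal ((norm (Fh t))\<^sup>2)" for t
  proof -
    have "(\<lambda>i. exp (- (1 / real (Suc i) / 2) * (norm t)\<^sup>2) * (norm (Fh t))\<^sup>2) \<longlonglongrightarrow> exp (- (0 / 2) * (norm t)\<^sup>2) * (norm (Fh t))\<^sup>2"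
      by (intro tendsto_intros LIMSEQ_Suc[OF lim_1_over_n]) simp
    then show ?thesis by (intro tendsto_ennrealI) simp
  qed
  have "(\<integral>\<^sup>+t. ennreal ((norm (Fh t))\<^sup>2) \<partial>lborel) = (\<integral>\<^sup>+t. liminf (\<lambda>i. ?g i t) \<partial>lborel)"
    by (intro nn_integral_cong lim_imp_Liminf[symmetric, OF trivial_limit_sequentially lim])
  also have "\<dots> \<le> liminf (\<lambda>i. \<integral>\<^sup>+t. ?g i t \<partial>lborel)"
    by (rule nn_integral_liminf) auto
  also have "\<dots> \<le> liminf (\<lambda>i. ennreal ((2 * pi / k) ^ DIM('a)) * (\<integral>\<^sup>+x. ennreal ((norm (H x))\<^sup>2) \<partial>lborel))"
    unfolding Fh_def
    by (intro Liminf_mono always_eventually allI bessel_phase_regularised[OF assms]) auto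
  also have "\<dots> = ennreal ((2 * pi / k) ^ DIM('a)) * (\<integral>\<^sup>+x. ennreal ((norm (H x))\<^sup>2) \<partial>lborel)"
    by (simp add: Liminf_const)
  finally show ?thesis unfolding Fh_def .
qed

section \<open>Square-integrable functions\<close>

text \<open>
  The squared norm, with values in the extended reals so that convergence arguments carry no
  integrability side conditions.
\<close>
definition energy :: "('a::euclidean_space \<Rightarrow> complex) \<Rightarrow> ennreal" where
  "energy f = (\<integral>\<^sup>+x. ennreal ((norm (f x))\<^sup>2) \<partial>lborel)"

definition L2 :: "('a::euclidean_space \<Rightarrow> complex) set" where
  "L2 = {f \<in> borel_measurable borel. energy f < \<infinity>}"

lemma L2_D [measurable_dest]: "f \<in> L2 \<Longrightarrow> f \<in> borel_measurable borel"
  and L2_energy: "f \<in> L2 \<Longrightarrow> energy f < \<infinity>"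
  by (auto simp: L2_def)

lemma powr_2_norm: "norm x powr 2 = (norm x)\<^sup>2"
  by (cases "x = 0") (auto)

lemma Lp_space_2_eq: "Lp_space 2 = (L2 :: ('a::euclidean_space \<Rightarrow> complex) set)"
proof -
  have "f \<in> borel_measurable borel \<Longrightarrow> integrable lborel (\<lambda>x. norm (f x) powr 2) \<longleftrightarrow> energy f < \<infinity>" 
    for f :: "'a \<Rightarrow> complex"
    unfolding integrable_iff_bounded energy_def powr_2_norm by simp
  then show ?thesis unfolding Lp_space_def L2_def by blast
qed

lemma energy_Lp_norm: "f \<in> L2 \<Longrightarrow> energy f = ennreal ((Lp_norm 2 f)\<^sup>2)"
proof -
  assume f: "f \<in> L2"
  then have [measurable]: "f \<in> borel_measurable borel" by (rule L2_D)
  from f have "integrable lborel (\<lambda>x. (norm (f x))\<^sup>2)"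
    unfolding L2_def integrable_iff_bounded energy_def by simp
  then have "energy f = ennreal (\<integral>x. (norm (f x))\<^sup>2 \<partial>lborel)"
    unfolding energy_def by (rule nn_integral_eq_integral) auto
  also have "(\<integral>x. (norm (f x))\<^sup>2 \<partial>lborel) = (Lp_norm 2 f)\<^sup>2"
    by (simp add: Lp_norm_def powr_2_norm powr_half_sqrt integral_nonneg_AE)
  finally show ?thesis .
qed

lemma energy_cong_AE: "(AE x in lborel. f x = g x) \<Longrightarrow> energy f = energy g"
  unfolding energy_def by (intro nn_integral_cong_AE) auto

lemma norm_add_square_le: "(norm (a + b :: complex))\<^sup>2 \<le> 2 * (norm a)\<^sup>2 + 2 * (norm b)\<^sup>2"
proof -
  have "(norm (a + b))\<^sup>2 \<le> (norm a + norm b)\<^sup>2"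
    by (intro power_mono norm_triangle_ineq norm_ge_zero)
  also have "\<dots> \<le> 2 * (norm a)\<^sup>2 + 2 * (norm b)\<^sup>2"
    using sum_squares_bound[of "norm a" "norm b"] by (simp add: power2_sum)
  finally show ?thesis .
qed

lemma energy_add_le:
  assumes [measurable]: "f \<in> borel_measurable borel" "g \<in> borel_measurable borel"
  shows "energy (\<lambda>x. f x + g x) \<le> 2 * energy f + 2 * energy g"
proof -
  have "energy (\<lambda>x. f x + g x) \<le> (\<integral>\<^sup>+x. 2 * ennreal ((norm (f x))\<^sup>2) + 2 * ennreal ((norm (g x))\<^sup>2) \<partial>lborel)"
    unfolding energy_def
  proof (rule nn_integral_mono)
    fix x
    have "ennreal ((norm (f x + g x))\<^sup>2) \<le> ennreal (2 * (norm (f x))\<^sup>2 + 2 * (norm (g x))\<^sup>2)"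
      by (intro ennreal_leI norm_add_square_le)
    then show "ennreal ((norm (f x + g x))\<^sup>2) \<le> 2 * ennreal ((norm (f x))\<^sup>2) + 2 * ennreal ((norm (g x))\<^sup>2)"
      by (simp add: ennreal_mult)
  qed
  also have "\<dots> = 2 * energy f + 2 * energy g"
    unfolding energy_def by (subst nn_integral_add) (auto simp: nn_integral_cmult)
  finally show ?thesis .
qed

lemma energy_uminus [simp]: "energy (\<lambda>x. - f x) = energy f"
  by (simp add: energy_def)

lemma energy_minus_commute: "energy (\<lambda>x. f x - g x) = energy (\<lambda>x. g x - f x)"
  by (simp add: energy_def norm_minus_commute)

lemma energy_cmult: 
  assumes [measurable]: "f \<in> borel_measurable borel"
  shows "energy (\<lambda>x. c * f x) = ennreal ((norm c)\<^sup>2) * energy f"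
  unfolding energy_def by (simp add: norm_mult power_mult_distrib ennreal_mult nn_integral_cmult)

lemma energy_mono: "(\<And>x. norm (f x) \<le> norm (g x)) \<Longrightarrow> energy f \<le> energy g"
  unfolding energy_def by (intro nn_integral_mono ennreal_leI power_mono) auto

lemma energy_diff_le:
  assumes [measurable]: "f \<in> borel_measurable borel" "g \<in> borel_measurable borel"
  shows "energy (\<lambda>x. f x - g x) \<le> 2 * energy f + 2 * energy g"
  using energy_add_le[of f "\<lambda>x. - g x"] by simp

lemma energy_diff_trans:
  assumes [measurable]: "f \<in> borel_measurable borel" "g \<in> borel_measurable borel" "h \<in> borel_measurable borel"
  shows "energy (\<lambda>x. f x - h x) \<le> 2 * energy (\<lambda>x. f x - g x) + 2 * energy (\<lambda>x. g x - h x)"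
  using energy_add_le[of "\<lambda>x. f x - g x" "\<lambda>x. g x - h x"] by simp

lemma energy_0_AE:
  assumes [measurable]: "f \<in> borel_measurable borel" and "energy f = 0"
  shows "AE x in lborel. f x = 0"
  using assms(2) unfolding energy_def by (subst (asm) nn_integral_0_iff_AE) auto

lemma L2_diff: "f \<in> L2 \<Longrightarrow> g \<in> L2 \<Longrightarrow> (\<lambda>x. f x - g x) \<in> L2"
proof -
  assume f: "f \<in> L2" and g: "g \<in> L2"
  then have [measurable]: "f \<in> borel_measurable borel" "g \<in> borel_measurable borel" by (auto dest: L2_D)
  have "energy (\<lambda>x. f x - g x) \<le> 2 * energy f + 2 * energy g" by (rule energy_diff_le) auto
  also have "\<dots> < \<infinity>" using f g by (simp add: L2_def ennreal_mult_less_top)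
  finally show ?thesis by (simp add: L2_def)
qed

lemma L2_bound: "g \<in> L2 \<Longrightarrow> f \<in> borel_measurable borel \<Longrightarrow> (\<And>x. norm (f x) \<le> norm (g x)) \<Longrightarrow> f \<in> L2"
  using energy_mono[of f g] by (auto simp: L2_def)

lemma energy_reflect:
  assumes [measurable]: "f \<in> borel_measurable borel"
  shows "energy (\<lambda>x. f (- x)) = energy f"
  using nn_integral_lborel_reflect[of "\<lambda>x. ennreal ((norm (f x))\<^sup>2)" 0] by (simp add: energy_def)

lemma L2_reflect: "f \<in> L2 \<Longrightarrow> (\<lambda>x. f (- x)) \<in> L2"
  by (auto simp: L2_def energy_reflect)

lemma energy_Fatou:
  assumes [measurable]: "\<And>k. f k \<in> borel_measurable borel"
    and lim: "AE x in lborel. (\<lambda>k. f k x) \<longlonglongrightarrow> g x"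
  shows "energy g \<le> liminf (\<lambda>k. energy (f k))"
proof -
  have "energy g = (\<integral>\<^sup>+x. liminf (\<lambda>k. ennreal ((norm (f k x))\<^sup>2)) \<partial>lborel)"
    unfolding energy_def
  proof (rule nn_integral_cong_AE)
    from lim show "AE x in lborel. ennreal ((norm (g x))\<^sup>2) = liminf (\<lambda>k. ennreal ((norm (f k x))\<^sup>2))"
    proof eventually_elim
      case (elim x)
      have "(\<lambda>k. ennreal ((norm (f k x))\<^sup>2)) \<longlonglongrightarrow> ennreal ((norm (g x))\<^sup>2)"
        by (intro tendsto_ennrealI tendsto_intros elim)
      then show ?case by (rule lim_imp_Liminf[symmetric, OF trivial_limit_sequentially])
    qed
  qed
  also have "\<dots> \<le> liminf (\<lambda>k. energy (f k))"
    unfolding energy_def by (rule nn_integral_liminf) simp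
  finally show ?thesis .
qed

lemma convergent_of_weighted_square_sum:
  fixes F :: "nat \<Rightarrow> complex"
  assumes S: "(\<Sum>k. ennreal (2 ^ k * (norm (F (Suc k) - F k))\<^sup>2)) < \<infinity>"
  shows "convergent F"
proof -
  obtain s where s: "s \<ge> 0" "(\<Sum>k. ennreal (2 ^ k * (norm (F (Suc k) - F k))\<^sup>2)) = ennreal s"
    using S unfolding infinity_ennreal_def less_top_ennreal by blast
  have bd: "norm (F (Suc k) - F k) \<le> sqrt s * (1 / sqrt 2) ^ k" for k
  proof -
    have "ennreal (2 ^ k * (norm (F (Suc k) - F k))\<^sup>2) \<le> ennreal s"
      using sum_le_suminf[OF summableI, of "{k}" "\<lambda>k. ennreal (2 ^ k * (norm (F (Suc k) - F k))\<^sup>2)"] s by simp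
    then have "2 ^ k * (norm (F (Suc k) - F k))\<^sup>2 \<le> s"
      using s(1) by (simp add: ennreal_le_iff)
    then have "(norm (F (Suc k) - F k))\<^sup>2 \<le> s / 2 ^ k" by (simp add: field_simps)
    then have "norm (F (Suc k) - F k) \<le> sqrt (s / 2 ^ k)" by (rule real_le_rsqrt)
    then show ?thesis by (simp add: real_sqrt_divide real_sqrt_power power_divide)
  qed
  have "summable (\<lambda>k. sqrt s * (1 / sqrt 2) ^ k)"
    by (intro summable_mult summable_geometric) simp
  then have "summable (\<lambda>k. F (Suc k) - F k)"
    by (rule summable_comparison_test'[where N=0]) (rule bd)
  then have "(\<lambda>n. \<Sum>k<n. F (Suc k) - F k) \<longlonglongrightarrow> (\<Sum>k. F (Suc k) - F k)"
    by (rule summable_LIMSEQ)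
  then have "(\<lambda>n. (F n - F 0) + F 0) \<longlonglongrightarrow> (\<Sum>k. F (Suc k) - F k) + F 0"
    by (intro tendsto_add tendsto_const) (simp add: sum_lessThan_telescope)
  then show ?thesis by (auto simp: convergent_def)
qed

text \<open>
  Riesz-Fischer: with increments of size \<open>(1 / 4)\<^sup>k\<close> the weighted sum of the squared increments has a finite
  integral, so the sequence converges almost everywhere, and Fatou's lemma turns this into convergence in mean.
\<close>
lemma energy_complete:
  fixes F :: "nat \<Rightarrow> 'a::euclidean_space \<Rightarrow> complex"
  assumes m [measurable]: "\<And>k. F k \<in> borel_measurable borel"
    and bd: "\<And>k m. k \<le> m \<Longrightarrow> energy (\<lambda>x. F m x - F k x) \<le> ennreal ((1 / 4) ^ k)"
  defines "g \<equiv> \<lambda>x. lim (\<lambda>k. F k x)"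
  shows "g \<in> borel_measurable borel" 
    and "AE x in lborel. (\<lambda>k. F k x) \<longlonglongrightarrow> g x"
    and "energy (\<lambda>x. F k x - g x) \<le> ennreal ((1 / 4) ^ k)"
proof -
  show gm [measurable]: "g \<in> borel_measurable borel" unfolding g_def by measurable
  have "(\<integral>\<^sup>+x. (\<Sum>k. ennreal (2 ^ k * (norm (F (Suc k) x - F k x))\<^sup>2)) \<partial>lborel)
     = (\<Sum>k. \<integral>\<^sup>+x. ennreal (2 ^ k * (norm (F (Suc k) x - F k x))\<^sup>2) \<partial>lborel)"
    by (rule nn_integral_suminf) measurable
  also have "\<dots> = (\<Sum>k. ennreal (2 ^ k) * energy (\<lambda>x. F (Suc k) x - F k x))"
    unfolding energy_def by (simp add: ennreal_mult nn_integral_cmult)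
  also have "\<dots> \<le> (\<Sum>k. ennreal (2 ^ k) * ennreal ((1 / 4) ^ k))"
    by (intro suminf_le mult_left_mono bd summableI) auto
  also have "\<dots> = (\<Sum>k. ennreal ((1 / 2) ^ k))"
  proof -
    have "ennreal (2 ^ k) * ennreal ((1 / 4) ^ k) = ennreal ((1 / 2) ^ k)" for k
      by (subst ennreal_mult[symmetric], simp, simp, subst power_mult_distrib[symmetric]) simp
    then show ?thesis by simp
  qed
  also have "\<dots> = ennreal (\<Sum>k. (1 / 2) ^ k)"
    by (rule suminf_ennreal2) (auto intro: summable_geometric)
  also have "\<dots> < \<infinity>" by simp
  finally have "AE x in lborel. (\<Sum>k. ennreal (2 ^ k * (norm (F (Suc k) x - F k x))\<^sup>2)) \<noteq> \<infinity>"
    by (intro nn_integral_PInf_AE) auto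
  then show lim: "AE x in lborel. (\<lambda>k. F k x) \<longlonglongrightarrow> g x"
  proof eventually_elim
    case (elim x)
    then have "convergent (\<lambda>k. F k x)"
      by (intro convergent_of_weighted_square_sum) (simp add: top.not_eq_extremum)
    then show ?case by (simp add: g_def convergent_LIMSEQ_iff)
  qed
  have "energy (\<lambda>x. F k x - g x) \<le> liminf (\<lambda>m. energy (\<lambda>x. F k x - F m x))"
    using lim by (intro energy_Fatou) (auto intro!: tendsto_intros)
  also have "\<dots> \<le> limsup (\<lambda>m. energy (\<lambda>x. F k x - F m x))"
    by (intro Liminf_le_Limsup) simp
  also have "\<dots> \<le> limsup (\<lambda>m. ennreal ((1 / 4) ^ k))"
    by (intro Limsup_mono eventually_sequentiallyI[of k])
       (subst energy_minus_commute, rule bd)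
  also have "\<dots> = ennreal ((1 / 4) ^ k)"
    by (simp add: Limsup_const)
  finally show "energy (\<lambda>x. F k x - g x) \<le> ennreal ((1 / 4) ^ k)" .
qed

lemma energy_limit_unique:
  assumes [measurable]: "g \<in> borel_measurable borel" "h \<in> borel_measurable borel" 
    "\<And>R. F R \<in> borel_measurable borel"
    and "((\<lambda>R. energy (\<lambda>x. F R x - g x)) \<longlongrightarrow> 0) A" "((\<lambda>R. energy (\<lambda>x. F R x - h x)) \<longlongrightarrow> 0) A" "A \<noteq> bot"
  shows "AE x in lborel. g x = h x"
proof -
  have "((\<lambda>R. 2 * energy (\<lambda>x. F R x - g x) + 2 * energy (\<lambda>x. F R x - h x)) \<longlongrightarrow> 2 * 0 + 2 * 0) A"
    by (intro tendsto_add ennreal_tendsto_cmult assms) auto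
  moreover have "energy (\<lambda>x. g x - h x) \<le> 2 * energy (\<lambda>x. F R x - g x) + 2 * energy (\<lambda>x. F R x - h x)" for R
    using energy_diff_trans[of g "F R" h] by (simp add: energy_minus_commute[of g])
  ultimately have "energy (\<lambda>x. g x - h x) \<le> 2 * 0 + 2 * 0"
    by (intro tendsto_lowerbound[OF _ _ assms(6)]) auto
  then have "AE x in lborel. g x - h x = 0"
    by (intro energy_0_AE) auto
  then show ?thesis by simp
qed

section \<open>The Fourier transform of square-integrable functions\<close>

lemma ennreal_tendsto_0_le:
  fixes f g :: "'b \<Rightarrow> ennreal"
  assumes "\<And>R. f R \<le> g R" "(g \<longlongrightarrow> 0) A"
  shows "(f \<longlongrightarrow> 0) A"
  by (rule tendsto_sandwich[where f = "\<lambda>_. 0" and h = g]) (use assms in auto)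

lemma fourier_eq:
  "fourier f \<xi> = complex_of_real ((2 * pi) powr (- real CARD('n) / 2)) * (\<integral>x. cis (- (\<xi> \<bullet> x)) * f x \<partial>lborel)"
  for f :: "real^'n \<Rightarrow> complex"
  by (simp add: fourier_def cis_conv_exp inner_commute)

lemma fourier_const_sq: "((2 * pi) powr (- real CARD('n) / 2))\<^sup>2 * (2 * pi) ^ CARD('n) = 1"
proof -
  have "((2 * pi) powr (- real CARD('n) / 2))\<^sup>2 = (2 * pi) powr (- real CARD('n))"
    by (simp add: power2_eq_square powr_add[symmetric])
  then have "((2 * pi) powr (- real CARD('n) / 2))\<^sup>2 * (2 * pi) ^ CARD('n) = (2 * pi) powr (- real CARD('n)) * (2 * pi) powr (real CARD('n))"
    by (simp add: powr_realpow)
  also have "\<dots> = 1" by (subst powr_add[symmetric]) simp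
  finally show ?thesis .
qed

lemma fourier_measurable [measurable (raw)]:
  fixes f :: "real^'n \<Rightarrow> complex"
  assumes [measurable]: "f \<in> borel_measurable borel" 
  shows "fourier f \<in> borel_measurable borel"
  unfolding fourier_eq[abs_def] by measurable

lemma energy_fourier_le:
  fixes f :: "real^'n \<Rightarrow> complex"
  assumes f: "integrable lborel f"
  shows "energy (fourier f) \<le> energy f"
proof -
  let ?c = "(2 * pi) powr (- real CARD('n) / 2)"
  have [measurable]: "f \<in> borel_measurable borel" using f by auto
  have "energy (\<lambda>\<xi>. \<integral>x. cis (- (\<xi> \<bullet> x)) * f x \<partial>lborel) \<le> ennreal ((2 * pi / 1) ^ DIM(real^'n)) * energy f"
    unfolding energy_def by (rule bessel_phase[OF _ _ _ f, where \<theta> = "\<lambda>x. x"]) auto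
  then have "ennreal (?c\<^sup>2) * energy (\<lambda>\<xi>. \<integral>x. cis (- (\<xi> \<bullet> x)) * f x \<partial>lborel) \<le> ennreal (?c\<^sup>2) * (ennreal ((2 * pi) ^ CARD('n)) * energy f)"
    by (intro mult_left_mono) auto
  also have "\<dots> = ennreal (?c\<^sup>2 * (2 * pi) ^ CARD('n)) * energy f"
    by (simp add: ennreal_mult mult.assoc)
  also have "\<dots> = energy f" unfolding fourier_const_sq by simp
  finally show ?thesis
    unfolding fourier_eq[abs_def] by (subst energy_cmult) (auto simp: norm_of_real)
qed

lemma fourier_diff:
  fixes f g :: "real^'n \<Rightarrow> complex"
  assumes "integrable lborel f" "integrable lborel g"
  shows "fourier (\<lambda>x. f x - g x) \<xi> = fourier f \<xi> - fourier g \<xi>"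
  unfolding fourier_eq using integrable_cis_mult[of lborel _ "\<lambda>x. - (\<xi> \<bullet> x)"] assms
  by (simp add: right_diff_distrib)

text \<open>
  The truncations in the definition of the mean-square transform.
\<close>
definition trunc :: "real \<Rightarrow> ('a::euclidean_space \<Rightarrow> complex) \<Rightarrow> 'a \<Rightarrow> complex" where
  "trunc R f x = indicator (cball 0 R) x * f x"

lemma trunc_measurable [measurable (raw)]:
  fixes f :: "'a::euclidean_space \<Rightarrow> complex"
  assumes [measurable]: "f \<in> borel_measurable borel" 
  shows "trunc R f \<in> borel_measurable borel"
proof -
  have [measurable]: "cball (0::'a) R \<in> sets borel" by (intro borel_closed closed_cball)
  show ?thesis unfolding trunc_def[abs_def] by measurable
qed

lemma norm_trunc_le: "norm (trunc R f x) \<le> norm (f x)"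
  by (auto simp: trunc_def split: split_indicator)

lemma trunc_L2: "f \<in> L2 \<Longrightarrow> trunc R f \<in> L2"
  by (rule L2_bound) (auto simp: norm_trunc_le dest: L2_D)

lemma L2_square_integrable: "f \<in> L2 \<Longrightarrow> integrable lborel (\<lambda>x. (norm (f x))\<^sup>2)"
proof -
  assume f: "f \<in> L2"
  then have [measurable]: "f \<in> borel_measurable borel" by (rule L2_D)
  from f show ?thesis
    unfolding L2_def integrable_iff_bounded energy_def by simp
qed

lemma trunc_integrable:
  fixes f :: "'a::euclidean_space \<Rightarrow> complex"
  assumes f: "f \<in> L2"
  shows "integrable lborel (trunc R f)"
proof -
  have [measurable]: "f \<in> borel_measurable borel" using f by (rule L2_D)
  have "integrable lborel (indicator (cball (0::'a) R) :: 'a \<Rightarrow> real)"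
    using emeasure_lborel_cball_finite[of "0::'a" R] by (intro integrable_real_indicator) auto
  then have "integrable lborel (\<lambda>x. indicator (cball (0::'a) R) x + (norm (f x))\<^sup>2)"
    using L2_square_integrable[OF f] by (rule Bochner_Integration.integrable_add)
  then show ?thesis
  proof (rule Bochner_Integration.integrable_bound)
    have "a \<le> 1 + a\<^sup>2" if "a \<ge> 0" for a :: real
      using sum_squares_bound[of a 1] that by simp
    then show "AE x in lborel. norm (trunc R f x) \<le> norm (indicator (cball 0 R) x + (norm (f x))\<^sup>2)"
      by (auto simp: trunc_def split: split_indicator)
  qed simp
qed

lemma trunc_tail:
  fixes f :: "'a::euclidean_space \<Rightarrow> complex"
  assumes f: "f \<in> L2"
  shows "((\<lambda>R. energy (\<lambda>x. trunc R f x - f x)) \<longlongrightarrow> 0) at_top"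
proof (rule tendsto_at_topI_sequentially)
  fix X :: "nat \<Rightarrow> real" assume X: "filterlim X at_top sequentially"
  have [measurable]: "f \<in> borel_measurable borel" using f by (rule L2_D)
  have "(\<lambda>n. \<integral>\<^sup>+x. ennreal ((norm (trunc (X n) f x - f x))\<^sup>2) \<partial>lborel) \<longlonglongrightarrow> (\<integral>\<^sup>+x. 0 \<partial>(lborel::'a measure))"
  proof (rule nn_integral_dominated_convergence)
    show "(\<integral>\<^sup>+x. ennreal ((norm (f x))\<^sup>2) \<partial>lborel) < \<infinity>" using f by (simp add: L2_def energy_def)
    show "AE x in lborel. ennreal ((norm (trunc (X n) f x - f x))\<^sup>2) \<le> ennreal ((norm (f x))\<^sup>2)" for n
      by (auto simp: trunc_def split: split_indicator)
    show "AE x in lborel. (\<lambda>n. ennreal ((norm (trunc (X n) f x - f x))\<^sup>2)) \<longlonglongrightarrow> 0"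
    proof (rule AE_I2)
      fix x :: 'a
      have "eventually (\<lambda>n. X n \<ge> norm x) sequentially"
        using X by (simp add: filterlim_at_top)
      then have "eventually (\<lambda>n. ennreal ((norm (trunc (X n) f x - f x))\<^sup>2) = 0) sequentially"
        by eventually_elim (simp add: trunc_def)
      then show "(\<lambda>n. ennreal ((norm (trunc (X n) f x - f x))\<^sup>2)) \<longlonglongrightarrow> 0"
        by (rule tendsto_eventually)
    qed
  qed auto
  then show "(\<lambda>n. energy (\<lambda>x. trunc (X n) f x - f x)) \<longlonglongrightarrow> 0"
    unfolding energy_def by simp
qed

lemma energy_trunc_diff_le:
  assumes "R \<le> R'"
  shows "energy (\<lambda>x. trunc R' f x - trunc R f x) \<le> energy (\<lambda>x. trunc R f x - f x)"
  by (rule energy_mono) (use assms in \<open>auto simp: trunc_def split: split_indicator\<close>)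

text \<open>
  By Bessel's inequality the transforms of the truncations form a Cauchy family.
\<close>
lemma fourier_L2_exists:
  fixes f :: "real^'n \<Rightarrow> complex"
  assumes f: "f \<in> L2"
  shows "\<exists>g. g \<in> L2 \<and> ((\<lambda>R. energy (\<lambda>\<xi>. fourier (trunc R f) \<xi> - g \<xi>)) \<longlongrightarrow> 0) at_top"
proof -
  have [measurable]: "f \<in> borel_measurable borel" using f by (rule L2_D)
  let ?tail = "\<lambda>R. energy (\<lambda>x. trunc R f x - f x)"
  have "\<exists>R. \<forall>R'\<ge>R. ?tail R' < ennreal ((1/4)^k)" for k :: nat
    using order_tendstoD(2)[OF trunc_tail[OF f], of "ennreal ((1/4)^k)"]
    by (simp add: eventually_at_top_linorder)
  then obtain r where r: "\<And>k R'. R' \<ge> r k \<Longrightarrow> ?tail R' < ennreal ((1/4)^k)" by metis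
  \<comment> \<open>Partial sums make the chosen radii increasing, as \<open>energy_complete\<close> needs.\<close>
  define \<rho> where "\<rho> k = (\<Sum>i\<le>k. \<bar>r i\<bar>)" for k
  have \<rho>_ge: "r k \<le> \<rho> k" for k
  proof -
    have "\<bar>r k\<bar> \<le> \<rho> k" unfolding \<rho>_def by (rule member_le_sum) auto
    then show ?thesis by linarith
  qed
  have \<rho>_mono: "\<rho> k \<le> \<rho> m" if "k \<le> m" for k m
    unfolding \<rho>_def using that by (intro sum_mono2) auto
  have ti: "integrable lborel (trunc R f)" for R by (rule trunc_integrable[OF f])
  have d: "energy (\<lambda>\<xi>. fourier (trunc R' f) \<xi> - fourier (trunc R f) \<xi>) \<le> ?tail R" if "R \<le> R'" for R R'
  proof -
    have "energy (\<lambda>\<xi>. fourier (trunc R' f) \<xi> - fourier (trunc R f) \<xi>) = energy (fourier (\<lambda>x. trunc R' f x - trunc R f x))"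
      by (intro arg_cong[where f = energy] ext fourier_diff[symmetric] ti)
    also have "\<dots> \<le> energy (\<lambda>x. trunc R' f x - trunc R f x)"
      by (intro energy_fourier_le Bochner_Integration.integrable_diff ti)
    also have "\<dots> \<le> ?tail R" by (rule energy_trunc_diff_le[OF that])
    finally show ?thesis .
  qed
  define F where "F k = fourier (trunc (\<rho> k) f)" for k
  have Fm: "F k \<in> borel_measurable borel" for k unfolding F_def by measurable
  have Fb: "energy (\<lambda>\<xi>. F m \<xi> - F k \<xi>) \<le> ennreal ((1 / 4) ^ k)" if "k \<le> m" for k m
    unfolding F_def using d[OF \<rho>_mono[OF that]] r[OF \<rho>_ge[of k]] by (auto intro: order_trans less_imp_le)
  obtain g where g [measurable]: "g \<in> borel_measurable borel" and gF: "\<And>k. energy (\<lambda>x. F k x - g x) \<le> ennreal ((1 / 4) ^ k)"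
    using energy_complete[OF Fm Fb] by blast
  have bd: "energy (\<lambda>\<xi>. fourier (trunc R f) \<xi> - g \<xi>) \<le> ennreal (4 * (1/4) ^ k)" if "R \<ge> \<rho> k" for R k
  proof -
    have "energy (\<lambda>\<xi>. fourier (trunc R f) \<xi> - g \<xi>) \<le> 2 * energy (\<lambda>\<xi>. fourier (trunc R f) \<xi> - F k \<xi>) + 2 * energy (\<lambda>x. F k x - g x)"
      using Fm by (intro energy_diff_trans) auto
    also have "\<dots> \<le> 2 * ennreal ((1 / 4) ^ k) + 2 * ennreal ((1 / 4) ^ k)"
      using d[OF that] r[OF \<rho>_ge[of k]] gF unfolding F_def
      by (intro add_mono mult_left_mono) (auto intro: order_trans less_imp_le)
    also have "\<dots> = ennreal (4 * (1/4) ^ k)"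
      by (simp add: ennreal_mult flip: distrib_right)
    finally show ?thesis .
  qed
  have "((\<lambda>R. energy (\<lambda>\<xi>. fourier (trunc R f) \<xi> - g \<xi>)) \<longlongrightarrow> 0) at_top"
  proof (rule order_tendstoI)
    fix a :: ennreal assume "0 < a"
    have "(\<lambda>k. ennreal (4 * (1/4) ^ k)) \<longlonglongrightarrow> ennreal (4 * 0)"
      by (intro tendsto_ennrealI tendsto_intros) auto
    then have "eventually (\<lambda>k. ennreal (4 * (1/4) ^ k) < a) sequentially"
      using \<open>0 < a\<close> by (intro order_tendstoD) auto
    then obtain k where "ennreal (4 * (1/4) ^ k) < a"
      by (auto simp: eventually_sequentially)
    then show "eventually (\<lambda>R. energy (\<lambda>\<xi>. fourier (trunc R f) \<xi> - g \<xi>) < a) at_top"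
      using bd[of k] unfolding eventually_at_top_linorder by (meson le_less_trans)
  qed auto
  moreover have "g \<in> L2"
  proof -
    have "energy (F 0) \<le> energy f"
      unfolding F_def using energy_fourier_le[OF ti] energy_mono[OF norm_trunc_le] by (rule order_trans)
    then have "F 0 \<in> L2" using Fm f by (auto simp: L2_def)
    moreover have "(\<lambda>x. F 0 x - g x) \<in> L2"
      using gF[of 0] Fm by (auto simp: L2_def intro: le_less_trans)
    ultimately have "(\<lambda>x. F 0 x - (F 0 x - g x)) \<in> L2" by (rule L2_diff)
    then show ?thesis by simp
  qed
  ultimately show ?thesis by blast
qed

lemma fourier_L2_spec:
  fixes f :: "real^'n \<Rightarrow> complex"
  assumes f: "f \<in> L2"
  shows fourier_L2_L2: "fourier_L2 f \<in> L2"
    and fourier_L2_tendsto: "((\<lambda>R. energy (\<lambda>\<xi>. fourier (trunc R f) \<xi> - fourier_L2 f \<xi>)) \<longlongrightarrow> 0) at_top"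
proof -
  have eq: "fourier_L2 f = (SOME g. g \<in> L2 \<and> ((\<lambda>R. energy (\<lambda>\<xi>. fourier (trunc R f) \<xi> - g \<xi>)) \<longlongrightarrow> 0) at_top)"
    unfolding fourier_L2_def Lp_space_2_eq energy_def trunc_def[abs_def] ..
  show "fourier_L2 f \<in> L2" "((\<lambda>R. energy (\<lambda>\<xi>. fourier (trunc R f) \<xi> - fourier_L2 f \<xi>)) \<longlongrightarrow> 0) at_top"
    using someI_ex[OF fourier_L2_exists[OF f]] unfolding eq by blast+
qed

lemma fourier_L2_unique:
  fixes f :: "real^'n \<Rightarrow> complex"
  assumes f: "f \<in> L2" and [measurable]: "g \<in> borel_measurable borel" 
    and lim: "((\<lambda>R. energy (\<lambda>\<xi>. fourier (trunc R f) \<xi> - g \<xi>)) \<longlongrightarrow> 0) at_top"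
  shows "AE x in lborel. fourier_L2 f x = g x"
proof -
  have [measurable]: "f \<in> borel_measurable borel" "fourier_L2 f \<in> borel_measurable borel"
    using f fourier_L2_L2[OF f] by (auto dest: L2_D)
  show ?thesis
    by (rule energy_limit_unique[OF _ _ _ fourier_L2_tendsto[OF f] lim]) auto
qed

text \<open>
  The factor 2 comes from the quadratic triangle inequality \<open>energy_diff_trans\<close>.
\<close>
lemma energy_fourier_L2_le:
  fixes f :: "real^'n \<Rightarrow> complex"
  assumes f: "f \<in> L2"
  shows "energy (fourier_L2 f) \<le> 2 * energy f"
proof -
  have [measurable]: "f \<in> borel_measurable borel" "fourier_L2 f \<in> borel_measurable borel"
    using f fourier_L2_L2[OF f] by (auto dest: L2_D)
  have "energy (fourier_L2 f) \<le> 2 * energy (\<lambda>\<xi>. fourier (trunc R f) \<xi> - fourier_L2 f \<xi>) + 2 * energy f" for R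
  proof -
    have "energy (fourier_L2 f) \<le> 2 * energy (\<lambda>\<xi>. fourier_L2 f \<xi> - fourier (trunc R f) \<xi>) + 2 * energy (fourier (trunc R f))"
      using energy_diff_trans[of "fourier_L2 f" "fourier (trunc R f)" "\<lambda>_. 0"] by simp
    also have "energy (fourier (trunc R f)) \<le> energy f"
      using energy_fourier_le[OF trunc_integrable[OF f]] energy_mono[OF norm_trunc_le] by (rule order_trans)
    finally show ?thesis
      by (subst energy_minus_commute) (simp add: add_left_mono mult_left_mono)
  qed
  moreover have "((\<lambda>R. 2 * energy (\<lambda>\<xi>. fourier (trunc R f) \<xi> - fourier_L2 f \<xi>) + 2 * energy f) \<longlongrightarrow> 2 * 0 + 2 * energy f) at_top"
    by (intro tendsto_add tendsto_const ennreal_tendsto_cmult fourier_L2_tendsto f) auto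
  ultimately have "energy (fourier_L2 f) \<le> 2 * 0 + 2 * energy f"
    by (intro tendsto_lowerbound[where F = "at_top :: real filter"]) auto
  then show ?thesis by simp
qed

lemma fourier_L2_diff:
  fixes f g :: "real^'n \<Rightarrow> complex"
  assumes f: "f \<in> L2" and g: "g \<in> L2"
  shows "AE x in lborel. fourier_L2 (\<lambda>x. f x - g x) x = fourier_L2 f x - fourier_L2 g x"
proof (rule fourier_L2_unique[OF L2_diff[OF f g]])
  note [measurable] = L2_D[OF f] L2_D[OF g] L2_D[OF fourier_L2_L2[OF f]] L2_D[OF fourier_L2_L2[OF g]]
  show "(\<lambda>x. fourier_L2 f x - fourier_L2 g x) \<in> borel_measurable borel" by measurable
  have le: "energy (\<lambda>\<xi>. fourier (trunc R (\<lambda>x. f x - g x)) \<xi> - (fourier_L2 f \<xi> - fourier_L2 g \<xi>))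
      \<le> 2 * energy (\<lambda>\<xi>. fourier (trunc R f) \<xi> - fourier_L2 f \<xi>) + 2 * energy (\<lambda>\<xi>. fourier (trunc R g) \<xi> - fourier_L2 g \<xi>)" for R
  proof -
    have "trunc R (\<lambda>x. f x - g x) = (\<lambda>x. trunc R f x - trunc R g x)"
      by (auto simp: trunc_def fun_eq_iff algebra_simps)
    then have "(\<lambda>\<xi>. fourier (trunc R (\<lambda>x. f x - g x)) \<xi> - (fourier_L2 f \<xi> - fourier_L2 g \<xi>)) = 
        (\<lambda>\<xi>. (fourier (trunc R f) \<xi> - fourier_L2 f \<xi>) - (fourier (trunc R g) \<xi> - fourier_L2 g \<xi>))"
      by (simp only:) (simp add: fourier_diff[OF trunc_integrable[OF f] trunc_integrable[OF g]] fun_eq_iff)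
    then show ?thesis
      using energy_diff_le[of "\<lambda>\<xi>. fourier (trunc R f) \<xi> - fourier_L2 f \<xi>" "\<lambda>\<xi>. fourier (trunc R g) \<xi> - fourier_L2 g \<xi>"]
      by simp
  qed
  have "((\<lambda>R. 2 * energy (\<lambda>\<xi>. fourier (trunc R f) \<xi> - fourier_L2 f \<xi>) + 2 * energy (\<lambda>\<xi>. fourier (trunc R g) \<xi> - fourier_L2 g \<xi>)) \<longlongrightarrow> 2 * 0 + 2 * 0) at_top"
    by (intro tendsto_add ennreal_tendsto_cmult fourier_L2_tendsto f g) auto
  then show "((\<lambda>R. energy (\<lambda>\<xi>. fourier (trunc R (\<lambda>x. f x - g x)) \<xi> - (fourier_L2 f \<xi> - fourier_L2 g \<xi>))) \<longlongrightarrow> 0) at_top"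
    by (intro ennreal_tendsto_0_le[OF le]) simp
qed

lemma fourier_L2_eq_fourier:
  fixes f :: "real^'n \<Rightarrow> complex"
  assumes f: "f \<in> L2" and i: "integrable lborel f"
  shows "AE x in lborel. fourier_L2 f x = fourier f x"
proof (rule fourier_L2_unique[OF f])
  have [measurable]: "f \<in> borel_measurable borel" using f by (rule L2_D)
  show "fourier f \<in> borel_measurable borel" by measurable
  have "energy (\<lambda>\<xi>. fourier (trunc R f) \<xi> - fourier f \<xi>) \<le> energy (\<lambda>x. trunc R f x - f x)" for R
  proof -
    have "(\<lambda>\<xi>. fourier (trunc R f) \<xi> - fourier f \<xi>) = fourier (\<lambda>x. trunc R f x - f x)"
      by (intro ext fourier_diff[symmetric] trunc_integrable[OF f] i)
    then show ?thesis
      using energy_fourier_le[of "\<lambda>x. trunc R f x - f x"] trunc_integrable[OF f] i by simp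
  qed
  with trunc_tail[OF f] show "((\<lambda>R. energy (\<lambda>\<xi>. fourier (trunc R f) \<xi> - fourier f \<xi>)) \<longlongrightarrow> 0) at_top"
    by (rule ennreal_tendsto_0_le[rotated])
qed

text \<open>
  An equality of functions, not only almost everywhere: the representative is chosen from a condition
  that involves \<open>f\<close> only through integrals.
\<close>
lemma fourier_L2_cong_AE:
  fixes f g :: "real^'n \<Rightarrow> complex"
  assumes [measurable]: "f \<in> borel_measurable borel" "g \<in> borel_measurable borel" 
    and eq: "AE x in lborel. f x = g x"
  shows "fourier_L2 f = fourier_L2 g"
proof -
  have [measurable]: "cball (0::real^'n) R \<in> sets borel" for R by (intro borel_closed closed_cball)
  have "fourier (\<lambda>x. indicator (cball 0 R) x * f x) = fourier (\<lambda>x. indicator (cball 0 R) x * g x)" for R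
    unfolding fourier_eq[abs_def] using eq
    by (intro ext arg_cong2[where f = "(*)"] refl integral_cong_AE) auto
  then show ?thesis unfolding fourier_L2_def by simp
qed

section \<open>Multiplication formula and Fourier inversion\<close>

lemma norm_mult_le_squares: "norm (a * b :: complex) \<le> (norm a)\<^sup>2 + (norm b)\<^sup>2"
  using sum_squares_bound[of "norm a" "norm b"] mult_nonneg_nonneg[OF norm_ge_zero[of a] norm_ge_zero[of b]]
  unfolding norm_mult by linarith

lemma L2_mult_integrable:
  assumes f: "f \<in> L2" and g: "g \<in> L2"
  shows "integrable lborel (\<lambda>x. f x * g x)"
proof (rule Bochner_Integration.integrable_bound)
  note [measurable] = L2_D[OF f] L2_D[OF g]
  show "integrable lborel (\<lambda>x. (norm (f x))\<^sup>2 + (norm (g x))\<^sup>2)"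
    using L2_square_integrable[OF f] L2_square_integrable[OF g] by simp
  show "(\<lambda>x. f x * g x) \<in> borel_measurable lborel" by measurable
  show "AE x in lborel. norm (f x * g x) \<le> norm ((norm (f x))\<^sup>2 + (norm (g x))\<^sup>2)"
    using norm_mult_le_squares[of "f _" "g _"] by simp
qed

lemma L2_Cauchy_Schwarz:
  assumes f: "f \<in> L2" and g: "g \<in> L2"
  shows "ennreal ((norm (\<integral>x. f x * g x \<partial>lborel))\<^sup>2) \<le> energy f * energy g"
proof -
  note [measurable] = L2_D[OF f] L2_D[OF g]
  have "ennreal ((norm (\<integral>x. f x * g x \<partial>lborel))\<^sup>2) = (ennreal (norm (\<integral>x. f x * g x \<partial>lborel)))\<^sup>2"
    by (simp add: ennreal_power)
  also have "\<dots> \<le> (\<integral>\<^sup>+x. ennreal (norm (f x * g x)) \<partial>lborel)\<^sup>2"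
    by (intro power_mono integral_norm_bound_ennreal L2_mult_integrable f g) simp
  also have "\<dots> = (\<integral>\<^sup>+x. ennreal (norm (f x)) * ennreal (norm (g x)) \<partial>lborel)\<^sup>2"
    by (simp add: norm_mult ennreal_mult)
  also have "\<dots> \<le> (\<integral>\<^sup>+x. ennreal (norm (f x)) ^ 2 \<partial>lborel) * (\<integral>\<^sup>+x. ennreal (norm (g x)) ^ 2 \<partial>lborel)"
    by (rule Cauchy_Schwarz_nn_integral) measurable
  also have "\<dots> = energy f * energy g"
    by (simp add: energy_def ennreal_power)
  finally show ?thesis .
qed

lemma L2_pairing_tendsto:
  fixes f g :: "'a::euclidean_space \<Rightarrow> complex"
  assumes f: "f \<in> L2" and g: "g \<in> L2" and F: "\<And>k::nat. F k \<in> L2" and G: "\<And>k. G k \<in> L2"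
    and B: "\<And>k. energy (G k) \<le> B" "B < \<infinity>"
    and lF: "(\<lambda>k. energy (\<lambda>x. F k x - f x)) \<longlonglongrightarrow> 0" and lG: "(\<lambda>k. energy (\<lambda>x. G k x - g x)) \<longlonglongrightarrow> 0"
  shows "(\<lambda>k. \<integral>x. F k x * G k x \<partial>lborel) \<longlonglongrightarrow> (\<integral>x. f x * g x \<partial>lborel)"
proof -
  let ?d = "\<lambda>k. (\<integral>x. F k x * G k x \<partial>lborel) - (\<integral>x. f x * g x \<partial>lborel)"
  have le: "ennreal ((norm (?d k))\<^sup>2) \<le> 2 * B * energy (\<lambda>x. F k x - f x) + 2 * energy f * energy (\<lambda>x. G k x - g x)" for k
  proof -
    let ?p = "\<integral>x. (F k x - f x) * G k x \<partial>lborel" and ?q = "\<integral>x. f x * (G k x - g x) \<partial>lborel"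
    have Ff: "(\<lambda>x. F k x - f x) \<in> L2" and Gg: "(\<lambda>x. G k x - g x) \<in> L2"
      using F G f g by (auto intro: L2_diff)
    have "?d k = (\<integral>x. F k x * G k x - f x * g x \<partial>lborel)"
      by (rule Bochner_Integration.integral_diff[symmetric]) (intro L2_mult_integrable F G f g)+
    also have "\<dots> = (\<integral>x. (F k x - f x) * G k x + f x * (G k x - g x) \<partial>lborel)"
      by (simp add: algebra_simps)
    also have "\<dots> = ?p + ?q"
      by (intro Bochner_Integration.integral_add L2_mult_integrable Ff Gg G f)
    finally have "ennreal ((norm (?d k))\<^sup>2) \<le> ennreal (2 * (norm ?p)\<^sup>2 + 2 * (norm ?q)\<^sup>2)"
      by (simp only:) (intro ennreal_leI norm_add_square_le)
    also have "\<dots> = 2 * ennreal ((norm ?p)\<^sup>2) + 2 * ennreal ((norm ?q)\<^sup>2)"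
      by (simp add: ennreal_mult)
    also have "\<dots> \<le> 2 * (energy (\<lambda>x. F k x - f x) * energy (G k)) + 2 * (energy f * energy (\<lambda>x. G k x - g x))"
      by (intro add_mono mult_left_mono L2_Cauchy_Schwarz Ff Gg G f) auto
    also have "\<dots> \<le> 2 * (energy (\<lambda>x. F k x - f x) * B) + 2 * (energy f * energy (\<lambda>x. G k x - g x))"
      by (intro add_mono mult_left_mono B order_refl) auto
    finally show ?thesis by (simp add: mult_ac)
  qed
  have "(\<lambda>k. 2 * B * energy (\<lambda>x. F k x - f x) + 2 * energy f * energy (\<lambda>x. G k x - g x)) \<longlonglongrightarrow> 2 * B * 0 + 2 * energy f * 0"
    using f B(2) by (intro tendsto_add ennreal_tendsto_cmult lF lG) (auto simp: L2_def ennreal_mult_less_top)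
  then have "(\<lambda>k. ennreal ((norm (?d k))\<^sup>2)) \<longlonglongrightarrow> 0"
    by (intro ennreal_tendsto_0_le[OF le]) simp
  then have "(\<lambda>k. (norm (?d k))\<^sup>2) \<longlonglongrightarrow> 0"
    by (subst (asm) ennreal_tendsto_0_iff) auto
  then have "(\<lambda>k. sqrt ((norm (?d k))\<^sup>2)) \<longlonglongrightarrow> sqrt 0"
    by (rule tendsto_real_sqrt)
  then have "?d \<longlonglongrightarrow> 0" by (simp add: tendsto_norm_zero_iff)
  then show ?thesis by (simp add: LIM_zero_iff)
qed

lemma fourier_multiplication_L1:
  fixes a b :: "real^'n \<Rightarrow> complex"
  assumes a: "integrable lborel a" and b: "integrable lborel b"
  shows "(\<integral>x. fourier a x * b x \<partial>lborel) = (\<integral>x. a x * fourier b x \<partial>lborel)"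
proof -
  let ?c = "complex_of_real ((2 * pi) powr (- real CARD('n) / 2))"
  have [measurable]: "a \<in> borel_measurable borel" "b \<in> borel_measurable borel" using a b by auto
  have i: "integrable (lborel \<Otimes>\<^sub>M lborel) (\<lambda>(x, y). cis (- (x \<bullet> y)) * (b x * a y))"
    by (rule Bochner_Integration.integrable_bound[OF lborel_pair.integral_tensor(1)[OF b a]]) (auto simp: norm_mult)
  have "(\<integral>x. fourier a x * b x \<partial>lborel) = (\<integral>x. ?c * (\<integral>y. cis (- (x \<bullet> y)) * (b x * a y) \<partial>lborel) \<partial>lborel)"
  proof (intro Bochner_Integration.integral_cong refl)
    fix x
    have "(\<integral>y. cis (- (x \<bullet> y)) * (b x * a y) \<partial>lborel) = b x * (\<integral>y. cis (- (x \<bullet> y)) * a y \<partial>lborel)"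
      by (subst integral_mult_right_zero[symmetric]) (simp add: mult_ac)
    then show "fourier a x * b x = ?c * (\<integral>y. cis (- (x \<bullet> y)) * (b x * a y) \<partial>lborel)"
      by (simp add: fourier_eq)
  qed
  also have "\<dots> = ?c * (\<integral>x. \<integral>y. cis (- (x \<bullet> y)) * (b x * a y) \<partial>lborel \<partial>lborel)"
    by (rule integral_mult_right_zero)
  also have "(\<integral>x. \<integral>y. cis (- (x \<bullet> y)) * (b x * a y) \<partial>lborel \<partial>lborel) = (\<integral>y. \<integral>x. cis (- (x \<bullet> y)) * (b x * a y) \<partial>lborel \<partial>lborel)"
    using lborel_pair.Fubini_integral[OF i] by simp
  also have "?c * \<dots> = (\<integral>y. ?c * (\<integral>x. cis (- (x \<bullet> y)) * (b x * a y) \<partial>lborel) \<partial>lborel)"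
    by (rule integral_mult_right_zero[symmetric])
  also have "\<dots> = (\<integral>x. a x * fourier b x \<partial>lborel)"
  proof (intro Bochner_Integration.integral_cong refl)
    fix y
    have "(\<integral>x. cis (- (x \<bullet> y)) * (b x * a y) \<partial>lborel) = a y * (\<integral>x. cis (- (y \<bullet> x)) * b x \<partial>lborel)"
      by (subst integral_mult_right_zero[symmetric]) (simp add: mult_ac inner_commute)
    then show "?c * (\<integral>x. cis (- (x \<bullet> y)) * (b x * a y) \<partial>lborel) = a y * fourier b y"
      by (simp add: fourier_eq)
  qed
  finally show ?thesis .
qed

lemma fourier_trunc_L2:
  fixes f :: "real^'n \<Rightarrow> complex"
  assumes f: "f \<in> L2"
  shows "fourier (trunc R f) \<in> L2" and "energy (fourier (trunc R f)) \<le> energy f"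
proof -
  note [measurable] = L2_D[OF f]
  show *: "energy (fourier (trunc R f)) \<le> energy f"
    using energy_fourier_le[OF trunc_integrable[OF f]] energy_mono[OF norm_trunc_le] by (rule order_trans)
  then show "fourier (trunc R f) \<in> L2"
    using L2_energy[OF f] by (auto simp: L2_def)
qed

lemma fourier_L2_multiplication:
  fixes a b :: "real^'n \<Rightarrow> complex"
  assumes a: "a \<in> L2" and b: "b \<in> L2"
  shows "(\<integral>x. fourier_L2 a x * b x \<partial>lborel) = (\<integral>x. a x * fourier_L2 b x \<partial>lborel)"
proof -
  have rs: "filterlim real at_top sequentially" by (rule filterlim_real_sequentially)
  have "(\<lambda>k. \<integral>x. fourier (trunc (real k) a) x * trunc (real k) b x \<partial>lborel) \<longlonglongrightarrow> (\<integral>x. fourier_L2 a x * b x \<partial>lborel)"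
    using L2_energy[OF b]
    by (intro L2_pairing_tendsto[where B = "energy b"] fourier_L2_L2 fourier_trunc_L2 trunc_L2 a b energy_mono norm_trunc_le
        filterlim_compose[OF fourier_L2_tendsto rs] filterlim_compose[OF trunc_tail rs])
  moreover have "(\<lambda>k. \<integral>x. trunc (real k) a x * fourier (trunc (real k) b) x \<partial>lborel) \<longlonglongrightarrow> (\<integral>x. a x * fourier_L2 b x \<partial>lborel)"
    using L2_energy[OF b]
    by (intro L2_pairing_tendsto[where B = "energy b"] fourier_L2_L2 fourier_trunc_L2 trunc_L2 a b 
        filterlim_compose[OF fourier_L2_tendsto rs] filterlim_compose[OF trunc_tail rs])
  ultimately show ?thesis
    unfolding fourier_multiplication_L1[OF trunc_integrable[OF a] trunc_integrable[OF b]]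
    by (rule LIMSEQ_unique)
qed

text \<open>
  The substitution \<open>x = y + z / sqrt (k + 1)\<close> fixes the kernel and moves the dilation into \<open>b\<close>, after which
  dominated convergence applies at a point of continuity.
\<close>
lemma gauss_mean_tendsto:
  fixes b :: "'a::euclidean_space \<Rightarrow> real"
  assumes [measurable]: "b \<in> borel_measurable borel" and bd: "\<And>x. \<bar>b x\<bar> \<le> 1" and cont: "isCont b y"
  shows "(\<lambda>k. \<integral>x. b x * gauss_kernel (1 / real (Suc k)) (x - y) \<partial>lborel) \<longlonglongrightarrow> (2 * pi) ^ DIM('a) * b y"
proof -
  have gi: "integrable lborel (gauss_kernel 1 :: 'a \<Rightarrow> real)" and gv: "(\<integral>x. gauss_kernel 1 x \<partial>(lborel :: 'a measure)) = (2 * pi) ^ DIM('a)"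
  proof -
    show gi: "integrable lborel (gauss_kernel 1 :: 'a \<Rightarrow> real)"
      by (rule integrableI_bounded) (auto simp: nn_integral_gauss_kernel)
    have "ennreal (\<integral>x. gauss_kernel 1 x \<partial>(lborel :: 'a measure)) = ennreal ((2 * pi) ^ DIM('a))"
      using nn_integral_eq_integral[OF gi] by (simp add: nn_integral_gauss_kernel)
    then show "(\<integral>x. gauss_kernel 1 x \<partial>(lborel :: 'a measure)) = (2 * pi) ^ DIM('a)"
      by (subst (asm) ennreal_inj) (auto intro!: integral_nonneg_AE)
  qed
  have sub: "(\<integral>x. b x * gauss_kernel (1 / real (Suc k)) (x - y) \<partial>lborel) = (\<integral>z. b (y + (1 / sqrt (real (Suc k))) *\<^sub>R z) * gauss_kernel 1 z \<partial>lborel)" for k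
  proof -
    let ?c = "1 / sqrt (real (Suc k))"
    let ?f = "\<lambda>x. b x * gauss_kernel (1 / real (Suc k)) (x - y)"
    have "(\<integral>x. ?f x \<partial>lborel) = (\<integral>x. ?f x \<partial>(density (distr lborel borel (\<lambda>x. y + ?c *\<^sub>R x)) (\<lambda>_. ennreal (\<bar>?c\<bar> ^ DIM('a)))))"
      by (subst lborel_affine[of ?c y]) auto
    also have "\<dots> = (\<integral>z. \<bar>?c\<bar> ^ DIM('a) * ?f (y + ?c *\<^sub>R z) \<partial>lborel)"
      by (subst integral_density) (auto simp: integral_distr)
    also have "\<dots> = (\<integral>z. b (y + ?c *\<^sub>R z) * gauss_kernel 1 z \<partial>lborel)"
    proof (intro Bochner_Integration.integral_cong refl)
      fix z :: 'a
      have eq: "?c ^ DIM('a) * sqrt (2 * pi / (1 / real (Suc k))) ^ DIM('a) = sqrt (2 * pi / 1) ^ DIM('a)"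
        by (subst power_mult_distrib[symmetric]) (simp add: real_sqrt_mult)
      have e: "exp (- (norm (?c *\<^sub>R z))\<^sup>2 / (2 * (1 / real (Suc k)))) = exp (- (norm z)\<^sup>2 / (2 * 1))"
        by (simp add: power_divide del: of_nat_Suc)
      have "?c ^ DIM('a) * gauss_kernel (1 / real (Suc k)) (?c *\<^sub>R z) = gauss_kernel 1 z"
        unfolding gauss_kernel_def e by (simp only: mult.assoc[symmetric] eq)
      then show "\<bar>?c\<bar> ^ DIM('a) * ?f (y + ?c *\<^sub>R z) = b (y + ?c *\<^sub>R z) * gauss_kernel 1 z"
        by (simp del: of_nat_Suc)
    qed
    finally show ?thesis .
  qed
  have c0: "(\<lambda>k. 1 / sqrt (real (Suc k))) \<longlonglongrightarrow> 0"
  proof -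
    have "(\<lambda>k. sqrt (1 / real (Suc k))) \<longlonglongrightarrow> sqrt 0"
      by (intro tendsto_real_sqrt LIMSEQ_Suc[OF lim_1_over_n])
    then show ?thesis by (simp add: real_sqrt_divide)
  qed
  have "(\<lambda>k. \<integral>z. b (y + (1 / sqrt (real (Suc k))) *\<^sub>R z) * gauss_kernel 1 z \<partial>lborel) \<longlonglongrightarrow> (\<integral>z. b y * gauss_kernel 1 z \<partial>(lborel :: 'a measure))"
  proof (rule integral_dominated_convergence[where w = "gauss_kernel 1"])
    show "AE z in lborel. (\<lambda>k. b (y + (1 / sqrt (real (Suc k))) *\<^sub>R z) * gauss_kernel 1 z) \<longlonglongrightarrow> b y * gauss_kernel 1 z"
    proof (rule AE_I2)
      fix z :: 'a
      have "(\<lambda>k. y + (1 / sqrt (real (Suc k))) *\<^sub>R z) \<longlonglongrightarrow> y + 0 *\<^sub>R z"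
        by (intro tendsto_intros c0)
      then have "(\<lambda>k. b (y + (1 / sqrt (real (Suc k))) *\<^sub>R z)) \<longlonglongrightarrow> b y"
        by (intro isCont_tendsto_compose[OF cont]) simp
      then show "(\<lambda>k. b (y + (1 / sqrt (real (Suc k))) *\<^sub>R z) * gauss_kernel 1 z) \<longlonglongrightarrow> b y * gauss_kernel 1 z"
        by (intro tendsto_mult tendsto_const)
    qed
    show "AE z in lborel. norm (b (y + (1 / sqrt (real (Suc k))) *\<^sub>R z) * gauss_kernel 1 z) \<le> gauss_kernel 1 z" for k
      using bd by (auto simp: abs_mult intro!: mult_left_le_one_le)
  qed (use gi in auto)
  also have "(\<integral>z. b y * gauss_kernel 1 z \<partial>(lborel :: 'a measure)) = (2 * pi) ^ DIM('a) * b y"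
    by (simp add: gv)
  finally show ?thesis unfolding sub .
qed

lemma isCont_indicator_box:
  assumes "y \<in> box l u \<or> y \<notin> cbox l u"
  shows "isCont (indicator (box l u) :: 'a::euclidean_space \<Rightarrow> real) y"
proof -
  have "eventually (\<lambda>x. indicator (box l u) x = (indicator (box l u) y :: real)) (nhds y)"
  proof (cases "y \<in> box l u")
    case True
    then have "eventually (\<lambda>x. x \<in> box l u) (nhds y)" by (intro eventually_nhds_in_open) auto
    then show ?thesis by eventually_elim (use True in auto)
  next
    case False
    then have "y \<in> - cbox l u" using assms by auto
    then have "eventually (\<lambda>x. x \<in> - cbox l u) (nhds y)" by (intro eventually_nhds_in_open) auto
    then show ?thesis by eventually_elim (use False box_subset_cbox[of l u] in \<open>auto simp: indicator_def\<close>)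
  qed
  then show ?thesis
    by (subst isCont_cong[where g = "\<lambda>_. indicator (box l u) y"]) auto
qed

lemma AE_box_or_not_cbox: "AE y in lborel. y \<in> box l u \<or> y \<notin> cbox l (u::'a::euclidean_space)"
proof -
  have "emeasure lborel (cbox l u - box l u) = 0"
    using emeasure_Diff[of lborel "box l u" "cbox l u"] box_subset_cbox[of l u]
    by (auto simp: emeasure_lborel_box_eq emeasure_lborel_cbox_eq)
  then have "AE y in lborel. y \<notin> cbox l u - box l u"
    by (intro AE_not_in null_setsI) auto
  then show ?thesis by eventually_elim auto
qed

lemma fourier_gauss_mult_reflect:
  fixes b :: "real^'n \<Rightarrow> complex"
  assumes b: "integrable lborel b" and e: "e > 0"
  shows "fourier (\<lambda>x. complex_of_real (exp (- (e / 2) * (norm x)\<^sup>2)) * fourier b (- x)) y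
     = complex_of_real (((2 * pi) powr (- real CARD('n) / 2))\<^sup>2) * (\<integral>x. b x * complex_of_real (gauss_kernel e (x - y)) \<partial>lborel)"
proof -
  let ?c = "complex_of_real ((2 * pi) powr (- real CARD('n) / 2))"
  define g where "g x = complex_of_real (exp (- (e / 2) * (norm x)\<^sup>2)) * cis (x \<bullet> y)" for x :: "real^'n"
  have [measurable]: "b \<in> borel_measurable borel" "g \<in> borel_measurable borel"
    using b by (auto simp: g_def[abs_def])
  have gi: "integrable lborel g" unfolding g_def by (rule gaussian_fourier(1)[OF e])
  have fg: "fourier g x = ?c * complex_of_real (gauss_kernel e (x - y))" for x
  proof -
    have "(\<lambda>t. cis (- (x \<bullet> t)) * g t) = (\<lambda>t. complex_of_real (exp (- (e / 2) * (norm t)\<^sup>2)) * cis (t \<bullet> (y - x)))"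
      by (auto simp: g_def fun_eq_iff inner_diff_right inner_commute[of x] cis_mult mult.left_commute)
    then show ?thesis
      by (simp only: fourier_eq gaussian_fourier(2)[OF e]) (simp add: gauss_kernel_def norm_minus_commute)
  qed
  have "(\<integral>x. cis (- (y \<bullet> x)) * (complex_of_real (exp (- (e / 2) * (norm x)\<^sup>2)) * fourier b (- x)) \<partial>lborel)
      = (\<integral>x. fourier b (0 - x) * g (0 - x) \<partial>lborel)"
    by (intro Bochner_Integration.integral_cong refl) (simp add: g_def inner_commute mult_ac)
  also have "\<dots> = (\<integral>x. fourier b x * g x \<partial>lborel)"
    by (rule integral_lborel_reflect(1)[where f = "\<lambda>x. fourier b x * g x"]) measurable
  also have "\<dots> = (\<integral>x. b x * fourier g x \<partial>lborel)"
    by (rule fourier_multiplication_L1[OF b gi])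
  also have "\<dots> = (\<integral>x. ?c * (b x * complex_of_real (gauss_kernel e (x - y))) \<partial>lborel)"
    by (simp add: fg mult_ac)
  also have "\<dots> = ?c * (\<integral>x. b x * complex_of_real (gauss_kernel e (x - y)) \<partial>lborel)"
    by (rule integral_mult_right_zero)
  finally show ?thesis
    by (subst fourier_eq) (simp add: power2_eq_square)
qed

text \<open>
  Damping the transform by a Gaussian before transforming back gives the Gaussian means of the indicator
  (\<open>fourier_gauss_mult_reflect\<close>).  They converge pointwise off the boundary, and also in mean square to the
  undamped double transform; the two limits agree.
\<close>
lemma fourier_inversion_box:
  fixes l u :: "real^'n"
  defines "b \<equiv> (\<lambda>x. complex_of_real (indicator (box l u) x))"
  shows "b \<in> L2" "integrable lborel b" "AE y in lborel. fourier_L2 (\<lambda>x. fourier b (- x)) y = b y"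
proof -
  let ?c = "(2 * pi) powr (- real CARD('n) / 2)"
  have [measurable]: "b \<in> borel_measurable borel" unfolding b_def by measurable
  have bi: "integrable lborel (indicator (box l u) :: real^'n \<Rightarrow> real)"
    by (intro integrable_real_indicator) (auto simp: emeasure_lborel_box_eq)
  then show i: "integrable lborel b" unfolding b_def by (rule integrable_of_real)
  have "energy b = (\<integral>\<^sup>+x. indicator (box l u) x \<partial>lborel)"
    unfolding energy_def b_def by (intro nn_integral_cong) (simp split: split_indicator)
  also have "\<dots> < \<infinity>" by (simp add: emeasure_lborel_box_eq)
  finally show b: "b \<in> L2" by (simp add: L2_def)
  define v where "v = (\<lambda>x. fourier b (- x))"
  have fb: "fourier b \<in> L2"
    using order_trans[OF energy_fourier_le[OF i]] L2_energy[OF b] by (auto simp: L2_def intro: le_less_trans[OF energy_fourier_le[OF i]])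
  then have v: "v \<in> L2" unfolding v_def by (rule L2_reflect)
  note [measurable] = L2_D[OF v]
  define G where "G k x = complex_of_real (exp (- (1 / real (Suc k) / 2) * (norm x)\<^sup>2))" for k and x :: "real^'n"
  have [measurable]: "G k \<in> borel_measurable borel" for k unfolding G_def by measurable
  have G1: "norm (G k x) \<le> 1" for k x by (simp add: G_def)
  define w where "w k x = G k x * v x" for k x
  have wv: "w k \<in> L2" for k
    unfolding w_def by (rule L2_bound[OF v]) (auto simp: norm_mult G1 mult_left_le_one_le)
  have Gi: "integrable lborel (G k)" for k
    using gaussian_fourier(1)[of "1 / real (Suc k)" "0::real^'n"] unfolding G_def[abs_def] by simp
  have GL2: "G k \<in> L2" for k
  proof -
    have "energy (G k) \<le> (\<integral>\<^sup>+x. ennreal (norm (G k x)) \<partial>lborel)"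
      unfolding energy_def using G1 by (intro nn_integral_mono ennreal_leI) (simp add: power2_eq_square mult_left_le_one_le)
    also have "\<dots> < \<infinity>" using Gi by (simp add: integrable_iff_bounded)
    finally show ?thesis by (simp add: L2_def)
  qed
  have wi: "integrable lborel (w k)" for k
    unfolding w_def by (rule L2_mult_integrable[OF GL2 v])
  have wlim: "(\<lambda>k. energy (\<lambda>x. w k x - v x)) \<longlonglongrightarrow> 0"
  proof -
    have "(\<lambda>k. \<integral>\<^sup>+x. ennreal ((norm (w k x - v x))\<^sup>2) \<partial>lborel) \<longlonglongrightarrow> (\<integral>\<^sup>+x. 0 \<partial>(lborel :: (real^'n) measure))"
    proof (rule nn_integral_dominated_convergence)
      show "(\<integral>\<^sup>+x. ennreal ((norm (v x))\<^sup>2) \<partial>lborel) < \<infinity>" using v by (simp add: L2_def energy_def)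
      show "AE x in lborel. ennreal ((norm (w k x - v x))\<^sup>2) \<le> ennreal ((norm (v x))\<^sup>2)" for k
      proof (intro AE_I2 ennreal_leI power_mono norm_ge_zero)
        fix x
        have "w k x - v x = complex_of_real (exp (- (1 / real (Suc k) / 2) * (norm x)\<^sup>2) - 1) * v x"
          by (simp add: w_def G_def algebra_simps)
        moreover have "\<bar>exp (- (1 / real (Suc k) / 2) * (norm x)\<^sup>2) - 1\<bar> \<le> 1"
          by (simp add: abs_le_iff add_increasing2)
        ultimately show "norm (w k x - v x) \<le> norm (v x)"
          by (simp only: norm_mult norm_of_real) (rule mult_left_le_one_le, auto)
      qed
      show "AE x in lborel. (\<lambda>k. ennreal ((norm (w k x - v x))\<^sup>2)) \<longlonglongrightarrow> 0"
      proof (rule AE_I2)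
        fix x
        have "(\<lambda>k. G k x * v x - v x) \<longlonglongrightarrow> complex_of_real (exp (- (0 / 2) * (norm x)\<^sup>2)) * v x - v x"
          unfolding G_def by (intro tendsto_intros LIMSEQ_Suc[OF lim_1_over_n]) simp
        then have "(\<lambda>k. (norm (w k x - v x))\<^sup>2) \<longlonglongrightarrow> (norm (0::complex))\<^sup>2"
          unfolding w_def by (intro tendsto_power tendsto_norm) simp
        then show "(\<lambda>k. ennreal ((norm (w k x - v x))\<^sup>2)) \<longlonglongrightarrow> 0"
          using tendsto_ennrealI by fastforce
      qed
    qed (auto simp: w_def)
    then show ?thesis by (simp add: energy_def)
  qed
  have Fw: "fourier (w k) y = complex_of_real (?c\<^sup>2 * (\<integral>x. indicator (box l u) x * gauss_kernel (1 / real (Suc k)) (x - y) \<partial>lborel))" for k y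
  proof -
    have "w k = (\<lambda>x. complex_of_real (exp (- (1 / real (Suc k) / 2) * (norm x)\<^sup>2)) * fourier b (- x))"
      by (auto simp: w_def G_def v_def fun_eq_iff)
    moreover have "(\<integral>x. b x * complex_of_real (gauss_kernel (1 / real (Suc k)) (x - y)) \<partial>lborel)
        = complex_of_real (\<integral>x. indicator (box l u) x * gauss_kernel (1 / real (Suc k)) (x - y) \<partial>lborel)"
      unfolding b_def of_real_mult[symmetric] by (rule integral_complex_of_real)
    ultimately show ?thesis
      using fourier_gauss_mult_reflect[OF i, of "1 / real (Suc k)" y] by simp
  qed
  have Flim: "AE y in lborel. (\<lambda>k. fourier (w k) y) \<longlonglongrightarrow> b y"
    using AE_box_or_not_cbox[of l u]
  proof eventually_elim
    case (elim y)
    have "(\<lambda>k. fourier (w k) y) \<longlonglongrightarrow> complex_of_real (?c\<^sup>2 * ((2 * pi) ^ DIM(real^'n) * indicator (box l u) y))"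
      unfolding Fw by (intro tendsto_intros gauss_mean_tendsto isCont_indicator_box elim) (auto split: split_indicator)
    also have "?c\<^sup>2 * ((2 * pi) ^ DIM(real^'n) * indicator (box l u) y) = indicator (box l u) y"
      using fourier_const_sq[where 'n = 'n] by (simp add: mult.assoc[symmetric])
    finally show ?case by (simp add: b_def)
  qed
  note [measurable] = L2_D[OF fourier_L2_L2[OF v]] L2_D[OF wv]
  have e0: "energy (\<lambda>y. fourier (w k) y - fourier_L2 v y) \<le> 2 * energy (\<lambda>x. w k x - v x)" for k
  proof -
    have "energy (\<lambda>y. fourier (w k) y - fourier_L2 v y) = energy (fourier_L2 (\<lambda>x. w k x - v x))"
    proof (rule energy_cong_AE)
      show "AE x in lborel. fourier (w k) x - fourier_L2 v x = fourier_L2 (\<lambda>x. w k x - v x) x"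
        using fourier_L2_eq_fourier[OF wv wi, of k] fourier_L2_diff[OF wv[of k] v] by eventually_elim simp
    qed
    also have "\<dots> \<le> 2 * energy (\<lambda>x. w k x - v x)"
      by (rule energy_fourier_L2_le[OF L2_diff[OF wv v]])
    finally show ?thesis .
  qed
  have "(\<lambda>k. 2 * energy (\<lambda>x. w k x - v x)) \<longlonglongrightarrow> 2 * 0"
    by (intro ennreal_tendsto_cmult wlim) auto
  then have lim0: "(\<lambda>k. energy (\<lambda>y. fourier (w k) y - fourier_L2 v y)) \<longlonglongrightarrow> 0"
    by (intro ennreal_tendsto_0_le[OF e0]) simp
  have "energy (\<lambda>y. b y - fourier_L2 v y) \<le> liminf (\<lambda>k. energy (\<lambda>y. fourier (w k) y - fourier_L2 v y))"
    using Flim by (intro energy_Fatou) (auto intro!: tendsto_intros)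
  also have "\<dots> = 0" by (rule lim_imp_Liminf[OF trivial_limit_sequentially lim0])
  finally have "AE y in lborel. b y - fourier_L2 v y = 0"
    by (intro energy_0_AE) auto
  then show "AE y in lborel. fourier_L2 (\<lambda>x. fourier b (- x)) y = b y"
    unfolding v_def by eventually_elim simp
qed

lemma set_integral_zero_of_boxes:
  fixes d :: "'a::euclidean_space \<Rightarrow> complex"
  assumes i: "\<And>l u. set_integrable lborel (box l u) d" 
    and z: "\<And>l u. (LINT x:box l u|lborel. d x) = 0"
    and S: "S \<in> sets borel"
  shows "(LINT x:(S \<inter> box l u)|lborel. d x) = 0"
proof -
  have sub: "set_integrable lborel (T \<inter> box l u) d" if "T \<in> sets borel" for T
    using that by (intro set_integrable_subset[OF i[of l u]]) auto
  let ?E = "range (\<lambda>(a, b). box a b :: 'a set)"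
  have S': "S \<in> sigma_sets UNIV ?E" using S by (simp add: borel_eq_box)
  have st: "Int_stable ?E" by (auto simp: Int_stable_def box_Int_box)
  show ?thesis
  proof (rule sigma_sets_induct_disjoint[OF st _ S', of "\<lambda>T. (LINT x:(T \<inter> box l u)|lborel. d x) = 0"])
    fix A assume "A \<in> ?E"
    then obtain a b where A: "A = box a b" by auto
    have "A \<inter> box l u \<in> ?E" using st unfolding A by (auto simp: Int_stable_def box_Int_box)
    then show "(LINT x:(A \<inter> box l u)|lborel. d x) = 0" using z by auto
  next
    show "(LINT x:({} \<inter> box l u)|lborel. d x) = 0" by (simp add: set_lebesgue_integral_def)
  next
    fix A assume A: "A \<in> sigma_sets UNIV ?E" and IH: "(LINT x:(A \<inter> box l u)|lborel. d x) = 0"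
    then have Ab: "A \<in> sets borel" by (simp add: borel_eq_box)
    have "box l u = (A \<inter> box l u) \<union> ((UNIV - A) \<inter> box l u)" by auto
    then have "(LINT x:box l u|lborel. d x) = (LINT x:(A \<inter> box l u) \<union> ((UNIV - A) \<inter> box l u)|lborel. d x)" by simp
    also have "\<dots> = (LINT x:(A \<inter> box l u)|lborel. d x) + (LINT x:((UNIV - A) \<inter> box l u)|lborel. d x)"
      using Ab by (intro set_integral_Un sub) auto
    finally show "(LINT x:((UNIV - A) \<inter> box l u)|lborel. d x) = 0" using IH z by simp
  next
    fix A :: "nat \<Rightarrow> 'a set"
    assume dis: "disjoint_family A" and A: "range A \<subseteq> sigma_sets UNIV ?E" and IH: "\<And>n. (LINT x:(A n \<inter> box l u)|lborel. d x) = 0"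
    have Ab: "A n \<in> sets borel" for n using A by (auto simp: borel_eq_box)
    have eq: "(\<Union>n. A n) \<inter> box l u = (\<Union>n. A n \<inter> box l u)" by auto
    have "(LINT x:(\<Union>n. A n \<inter> box l u)|lborel. d x) = (\<Sum>n. (LINT x:(A n \<inter> box l u)|lborel. d x))"
    proof (rule lebesgue_integral_countable_add)
      show "set_integrable lborel (\<Union>n. A n \<inter> box l u) d" unfolding eq[symmetric] using Ab by (intro sub) auto
      show "\<And>n. A n \<inter> box l u \<in> sets lborel" using Ab by auto
      show "\<And>i j. i \<noteq> j \<Longrightarrow> (A i \<inter> box l u) \<inter> (A j \<inter> box l u) = {}" using dis by (auto simp: disjoint_family_on_def)
    qed
    then show "(LINT x:((\<Union>n. A n) \<inter> box l u)|lborel. d x) = 0" unfolding eq using IH by simp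
  qed auto
qed

lemma AE_zero_of_boxes_real:
  fixes d :: "'a::euclidean_space \<Rightarrow> real"
  assumes [measurable]: "d \<in> borel_measurable borel"
    and i: "\<And>l u. integrable lborel (\<lambda>x. d x * indicator (box l u) x)"
    and z: "\<And>S l u. S \<in> sets borel \<Longrightarrow> (\<integral>x. d x * indicator (S \<inter> box l u) x \<partial>lborel) = 0"
  shows "AE x in lborel. d x = 0"
proof -
  have "AE x in lborel. d x * indicator (box (- (real n *\<^sub>R One)) (real n *\<^sub>R One)) x = 0" for n :: nat
  proof -
    let ?b = "box (- (real n *\<^sub>R One)) (real n *\<^sub>R One) :: 'a set"
    have "(\<integral>x\<in>S. d x * indicator ?b x \<partial>lborel) = (\<integral>x\<in>S. 0 \<partial>lborel)" if "S \<in> sets borel" for S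
    proof -
      have "(\<integral>x\<in>S. d x * indicator ?b x \<partial>lborel) = (\<integral>x. d x * indicator (S \<inter> ?b) x \<partial>lborel)"
        unfolding set_lebesgue_integral_def by (intro Bochner_Integration.integral_cong) (auto split: split_indicator)
      then show ?thesis using z[OF that] by simp
    qed
    then show ?thesis using i by (intro density_unique_real) auto
  qed
  then have "AE x in lborel. \<forall>n::nat. d x * indicator (box (- (real n *\<^sub>R One)) (real n *\<^sub>R One)) x = 0"
    unfolding AE_all_countable by blast
  then show ?thesis
  proof eventually_elim
    case (elim x)
    have "x \<in> (\<Union>n::nat. box (- (real n *\<^sub>R One)) (real n *\<^sub>R One))" by (simp add: UN_box_eq_UNIV)
    then obtain n :: nat where "x \<in> box (- (real n *\<^sub>R One)) (real n *\<^sub>R One)" by blast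
    with elim[rule_format, of n] show ?case by simp
  qed
qed

text \<open>
  Boxes form an intersection-stable generator of the Borel sets, so the integrals over all bounded Borel sets
  vanish as well.
\<close>
lemma L2_zero_of_boxes:
  fixes d :: "'a::euclidean_space \<Rightarrow> complex"
  assumes d: "d \<in> L2" 
    and z: "\<And>l u. (\<integral>x. d x * complex_of_real (indicator (box l u) x) \<partial>lborel) = 0"
  shows "AE x in lborel. d x = 0"
proof -
  note [measurable] = L2_D[OF d]
  have b: "(\<lambda>x. complex_of_real (indicator (box l u) x)) \<in> L2" for l u :: 'a
  proof -
    have "energy (\<lambda>x. complex_of_real (indicator (box l u) x)) = (\<integral>\<^sup>+x. indicator (box l u) x \<partial>lborel)"
      unfolding energy_def by (intro nn_integral_cong) (simp split: split_indicator)
    also have "\<dots> < \<infinity>" by (simp add: emeasure_lborel_box_eq)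
    finally show ?thesis by (simp add: L2_def)
  qed
  have eq: "indicator S x *\<^sub>R d x = d x * complex_of_real (indicator S x)" for S x
    by (simp add: scaleR_conv_of_real)
  have i: "set_integrable lborel (box l u) d" for l u
    unfolding set_integrable_def eq by (rule L2_mult_integrable[OF d b])
  have z': "(LINT x:box l u|lborel. d x) = 0" for l u
    using z unfolding set_lebesgue_integral_def eq .
  have zS: "(\<integral>x. d x * complex_of_real (indicator (S \<inter> box l u) x) \<partial>lborel) = 0" if "S \<in> sets borel" for S l u
    using set_integral_zero_of_boxes[OF i z' that, of l u] unfolding set_lebesgue_integral_def eq .
  have iS: "integrable lborel (\<lambda>x. d x * complex_of_real (indicator (S \<inter> box l u) x))" if "S \<in> sets borel" for S l u
    using set_integrable_subset[OF i[of l u], of "S \<inter> box l u"] that unfolding set_integrable_def eq by auto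
  have "AE x in lborel. Re (d x) = 0"
  proof (rule AE_zero_of_boxes_real)
    show "integrable lborel (\<lambda>x. Re (d x) * indicator (box l u) x)" for l u
      using integrable_Re[OF iS[of UNIV l u]] by simp
    show "(\<integral>x. Re (d x) * indicator (S \<inter> box l u) x \<partial>lborel) = 0" if "S \<in> sets borel" for S l u
      using integral_Re[OF iS[OF that, of l u]] zS[OF that, of l u] by simp
  qed measurable
  moreover have "AE x in lborel. Im (d x) = 0"
  proof (rule AE_zero_of_boxes_real)
    show "integrable lborel (\<lambda>x. Im (d x) * indicator (box l u) x)" for l u
      using integrable_Im[OF iS[of UNIV l u]] by simp
    show "(\<integral>x. Im (d x) * indicator (S \<inter> box l u) x \<partial>lborel) = 0" if "S \<in> sets borel" for S l u
      using integral_Im[OF iS[OF that, of l u]] zS[OF that, of l u] by simp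
  qed measurable
  ultimately show ?thesis by eventually_elim (simp add: complex_eq_iff)
qed

text \<open>
  By duality: the multiplication formula, applied twice, moves both transforms to the indicator of a box,
  where inversion is known.
\<close>
lemma fourier_L2_inversion:
  fixes h :: "real^'n \<Rightarrow> complex"
  assumes h: "h \<in> L2"
  shows "AE x in lborel. fourier_L2 (inverse_fourier_L2 h) x = h x"
proof -
  define R where "R = (\<lambda>x. fourier_L2 h (- x))"
  have R: "R \<in> L2" unfolding R_def by (intro L2_reflect fourier_L2_L2 h)
  have FR: "fourier_L2 R \<in> L2" by (rule fourier_L2_L2[OF R])
  note [measurable] = L2_D[OF FR] L2_D[OF h] L2_D[OF R] L2_D[OF fourier_L2_L2[OF h]]
  have "AE x in lborel. fourier_L2 R x - h x = 0"
  proof (rule L2_zero_of_boxes[OF L2_diff[OF FR h]])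
    fix l u :: "real^'n"
    define b where "b = (\<lambda>x::real^'n. complex_of_real (indicator (box l u) x))"
    note box = fourier_inversion_box[of l u, folded b_def]
    have fb: "fourier b \<in> L2"
      using le_less_trans[OF energy_fourier_le[OF box(2)] L2_energy[OF box(1)]] L2_D[OF box(1)] by (auto simp: L2_def)
    note [measurable] = L2_D[OF fb] L2_D[OF box(1)] L2_D[OF fourier_L2_L2[OF box(1)]] L2_D[OF fourier_L2_L2[OF L2_reflect[OF fb]]]
    have "(\<integral>x. fourier_L2 R x * b x \<partial>lborel) = (\<integral>x. R x * fourier_L2 b x \<partial>lborel)"
      by (rule fourier_L2_multiplication[OF R box(1)])
    also have "\<dots> = (\<integral>x. R x * fourier b x \<partial>lborel)"
      using fourier_L2_eq_fourier[OF box(1,2)] by (intro integral_cong_AE) auto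
    also have "\<dots> = (\<integral>x. fourier_L2 h (0 - x) * fourier b (- (0 - x)) \<partial>lborel)"
      by (simp add: R_def)
    also have "\<dots> = (\<integral>x. fourier_L2 h x * fourier b (- x) \<partial>lborel)"
      by (rule integral_lborel_reflect(1)[where f = "\<lambda>x. fourier_L2 h x * fourier b (- x)"]) measurable
    also have "\<dots> = (\<integral>x. h x * fourier_L2 (\<lambda>x. fourier b (- x)) x \<partial>lborel)"
      by (rule fourier_L2_multiplication[OF h L2_reflect[OF fb]])
    also have "\<dots> = (\<integral>x. h x * b x \<partial>lborel)"
    proof (rule integral_cong_AE)
      have "AE x in lborel. fourier_L2 (\<lambda>x. fourier b (- x)) x = b x"
        using box(3) by (simp add: b_def)
      then show "AE x in lborel. h x * fourier_L2 (\<lambda>x. fourier b (- x)) x = h x * b x"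
        by eventually_elim simp
    qed measurable
    finally have "(\<integral>x. fourier_L2 R x * b x \<partial>lborel) = (\<integral>x. h x * b x \<partial>lborel)" .
    then have "(\<integral>x. fourier_L2 R x * b x - h x * b x \<partial>lborel) = 0"
      by (subst Bochner_Integration.integral_diff) (auto intro!: L2_mult_integrable FR h box(1))
    then show "(\<integral>x. (fourier_L2 R x - h x) * complex_of_real (indicator (box l u) x) \<partial>lborel) = 0"
      by (simp add: b_def left_diff_distrib)
  qed
  then show ?thesis
    unfolding inverse_fourier_L2_def[abs_def] R_def[symmetric] by eventually_elim simp
qed

section \<open>Integration of radial functions\<close>

text \<open>
  Dilation multiplies both sides evaluated at \<open>{..a}\<close> by the same power of \<open>a\<close>, so they agree on these sets once they
  agree at \<open>a = 1\<close>, and these sets generate the Borel sets.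
\<close>
lemma radial_measure:
  fixes p :: "'a::euclidean_space \<Rightarrow> real"
  assumes cont: "continuous_on UNIV p" and nn: "\<And>x. 0 \<le> p x"
    and hom: "\<And>c x. c > 0 \<Longrightarrow> p (c *\<^sub>R x) = c ^ d * p x"
  shows "\<exists>P\<ge>0. distr (density lborel (\<lambda>x. ennreal (p x))) borel norm
     = density lborel (\<lambda>\<rho>. ennreal (P * \<rho> ^ (DIM('a) + d - 1) * indicator {0..} \<rho>))"
proof -
  have [measurable]: "p \<in> borel_measurable borel" by (rule borel_measurable_continuous_onI[OF cont])
  have [measurable]: "cball (0::'a) a \<in> sets borel" for a by (intro borel_closed closed_cball)
  define m where "m = DIM('a) + d"
  have m: "m > 0" by (simp add: m_def DIM_positive)
  define I where "I = (\<integral>\<^sup>+x. ennreal (p x) * indicator (cball 0 1) x \<partial>lborel)"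
  have "compact (p ` cball 0 1)"
    by (intro compact_continuous_image continuous_on_subset[OF cont]) auto
  then obtain B where B: "\<And>x. x \<in> cball 0 1 \<Longrightarrow> p x \<le> B"
    using compact_imp_bounded[of "p ` cball 0 1"] unfolding bounded_iff by (force simp: abs_le_iff)
  have "I \<le> (\<integral>\<^sup>+x. ennreal B * indicator (cball (0::'a) 1) x \<partial>lborel)"
    unfolding I_def by (intro nn_integral_mono) (use B in \<open>auto simp: ennreal_leI split: split_indicator\<close>)
  also have "\<dots> = ennreal B * emeasure lborel (cball (0::'a) 1)" by (subst nn_integral_cmult_indicator) auto
  also have "\<dots> < \<infinity>" using emeasure_lborel_cball_finite[of "0::'a" 1] by (simp add: ennreal_mult_less_top)
  finally obtain i where i: "i \<ge> 0" "I = ennreal i"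
    unfolding infinity_ennreal_def less_top_ennreal by blast
  let ?M = "distr (density lborel (\<lambda>x. ennreal (p x))) borel norm"
  let ?N = "density lborel (\<lambda>\<rho>. ennreal ((real m * i) * \<rho> ^ (DIM('a) + d - 1) * indicator {0..} \<rho>))"
  have M: "emeasure ?M {..a} = (if a \<le> 0 then 0 else ennreal (a ^ m * i))" for a
  proof -
    have "emeasure ?M {..a} = (\<integral>\<^sup>+x. ennreal (p x) * indicator (cball 0 a) x \<partial>lborel)"
    proof -
      have "norm -` {..a} = cball (0::'a) a" by auto
      then show ?thesis by (simp add: emeasure_distr emeasure_density)
    qed
    also have "\<dots> = (if a \<le> 0 then 0 else ennreal (a ^ m * i))"
    proof (cases "a \<le> 0")
      case True
      have "AE x in lborel. x \<noteq> (0::'a)" by (rule AE_lborel_singleton)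
      then have "AE x in lborel. ennreal (p x) * indicator (cball 0 a) x = 0"
        by eventually_elim (use True in \<open>auto split: split_indicator dest: order_trans[of "norm _" a 0]\<close>)
      then have "(\<integral>\<^sup>+x. ennreal (p x) * indicator (cball 0 a) x \<partial>lborel) = (\<integral>\<^sup>+x. 0 \<partial>(lborel::'a measure))"
        by (rule nn_integral_cong_AE)
      with True show ?thesis by simp
    next
      case False
      then have a: "a > 0" by simp
      have "(\<integral>\<^sup>+x. ennreal (p x) * indicator (cball 0 a) x \<partial>lborel)
         = ennreal (\<bar>a\<bar> ^ DIM('a)) * (\<integral>\<^sup>+x. ennreal (p (0 + a *\<^sub>R x)) * indicator (cball 0 a) (0 + a *\<^sub>R x) \<partial>lborel)"
        by (rule nn_integral_lborel_affine) (use a in auto)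
      also have "(\<integral>\<^sup>+x. ennreal (p (0 + a *\<^sub>R x)) * indicator (cball 0 a) (0 + a *\<^sub>R x) \<partial>lborel)
         = (\<integral>\<^sup>+x. ennreal (a ^ d) * (ennreal (p x) * indicator (cball 0 1) x) \<partial>lborel)"
        using a by (intro nn_integral_cong) (auto simp: hom ennreal_mult nn split: split_indicator)
      also have "\<dots> = ennreal (a ^ d) * I" unfolding I_def by (rule nn_integral_cmult) measurable
      finally show ?thesis using a i by (simp add: m_def power_add ennreal_mult mult.assoc)
    qed
    finally show ?thesis .
  qed
  have N: "emeasure ?N {..a} = (if a \<le> 0 then 0 else ennreal (a ^ m * i))" for a
  proof -
    have "emeasure ?N {..a} = (\<integral>\<^sup>+\<rho>. ennreal ((real m * i) * \<rho> ^ (m - 1)) * indicator {0..a} \<rho> \<partial>lborel)"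
      by (subst emeasure_density) (auto intro!: nn_integral_cong split: split_indicator simp: m_def)
    also have "\<dots> = (if a \<le> 0 then 0 else ennreal (a ^ m * i))"
    proof (cases "a < 0")
      case False
      have "(\<integral>\<^sup>+\<rho>. ennreal ((real m * i) * \<rho> ^ (m - 1)) * indicator {0..a} \<rho> \<partial>lborel) = ennreal (i * a ^ m - i * 0 ^ m)"
        using False i(1) by (intro nn_integral_FTC_Icc) (auto intro!: derivative_eq_intros)
      then show ?thesis using False m by (auto simp: mult.commute power_0_left)
    qed simp
    finally show ?thesis .
  qed
  have "?M = ?N"
  proof (rule measure_eqI_generator_eq)
    show "Int_stable (range (\<lambda>a::real. {..a}))" by (auto simp: Int_stable_def)
    show "range (\<lambda>a::real. {..a}) \<subseteq> Pow UNIV" by simp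
    show "emeasure ?M X = emeasure ?N X" if "X \<in> range (\<lambda>a::real. {..a})" for X
      using that M N by auto
    show "sets ?M = sigma_sets UNIV (range (\<lambda>a::real. {..a}))" "sets ?N = sigma_sets UNIV (range (\<lambda>a::real. {..a}))"
      by (simp_all add: borel_eq_atMost)
    show "range (\<lambda>i. {..real i}) \<subseteq> range (\<lambda>a::real. {..a})" by auto
    show "(\<Union>i. {..real i}) = UNIV" by (auto intro: real_arch_simple)
    show "emeasure ?M {..real i} \<noteq> \<infinity>" for i by (simp add: M)
  qed
  then show ?thesis using i by (intro exI[of _ "real m * i"]) simp
qed

text \<open>
  For \<open>p\<close> homogeneous of degree \<open>d\<close> this is the integral of \<open>p\<close> over the unit sphere.
\<close>
definition sphere_const :: "('a::euclidean_space \<Rightarrow> real) \<Rightarrow> nat \<Rightarrow> real" where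
  "sphere_const p d = (SOME P. P \<ge> 0 \<and> distr (density lborel (\<lambda>x. ennreal (p x))) borel norm
     = density lborel (\<lambda>\<rho>. ennreal (P * \<rho> ^ (DIM('a) + d - 1) * indicator {0..} \<rho>)))"

definition homogeneous :: "('a::euclidean_space \<Rightarrow> real) \<Rightarrow> nat \<Rightarrow> bool" where
  "homogeneous p d \<longleftrightarrow> continuous_on UNIV p \<and> (\<forall>x. 0 \<le> p x) \<and> (\<forall>c x. c > 0 \<longrightarrow> p (c *\<^sub>R x) = c ^ d * p x)"

lemma sphere_const:
  fixes p :: "'a::euclidean_space \<Rightarrow> real"
  assumes "homogeneous p d"
  shows sphere_const_nonneg: "sphere_const p d \<ge> 0"
    and sphere_const_measure: "distr (density lborel (\<lambda>x. ennreal (p x))) borel norm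
     = density lborel (\<lambda>\<rho>. ennreal (sphere_const p d * \<rho> ^ (DIM('a) + d - 1) * indicator {0..} \<rho>))"
proof -
  have "\<exists>P. P \<ge> 0 \<and> distr (density lborel (\<lambda>x. ennreal (p x))) borel norm
     = density lborel (\<lambda>\<rho>. ennreal (P * \<rho> ^ (DIM('a) + d - 1) * indicator {0..} \<rho>))"
    using radial_measure[of p d] assms unfolding homogeneous_def by blast
  from someI_ex[OF this] show "sphere_const p d \<ge> 0" "distr (density lborel (\<lambda>x. ennreal (p x))) borel norm
     = density lborel (\<lambda>\<rho>. ennreal (sphere_const p d * \<rho> ^ (DIM('a) + d - 1) * indicator {0..} \<rho>))"
    unfolding sphere_const_def by blast+
qed

lemma nn_integral_radial:
  fixes p :: "'a::euclidean_space \<Rightarrow> real"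
  assumes p: "homogeneous p d" and [measurable]: "F \<in> borel_measurable borel"
  shows "(\<integral>\<^sup>+x. F (norm x) * ennreal (p x) \<partial>lborel)
    = ennreal (sphere_const p d) * (\<integral>\<^sup>+\<rho>. F \<rho> * ennreal (\<rho> ^ (DIM('a) + d - 1)) * indicator {0..} \<rho> \<partial>lborel)"
proof -
  have [measurable]: "p \<in> borel_measurable borel" using p by (auto simp: homogeneous_def borel_measurable_continuous_onI)
  have "(\<integral>\<^sup>+x. F (norm x) * ennreal (p x) \<partial>lborel) = (\<integral>\<^sup>+\<rho>. F \<rho> \<partial>(distr (density lborel (\<lambda>x. ennreal (p x))) borel norm))"
    by (subst nn_integral_distr) (auto simp: nn_integral_density mult.commute)
  also have "\<dots> = (\<integral>\<^sup>+\<rho>. ennreal (sphere_const p d * \<rho> ^ (DIM('a) + d - 1) * indicator {0..} \<rho>) * F \<rho> \<partial>lborel)"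
    unfolding sphere_const_measure[OF p] by (subst nn_integral_density) auto
  also have "\<dots> = (\<integral>\<^sup>+\<rho>. ennreal (sphere_const p d) * (F \<rho> * ennreal (\<rho> ^ (DIM('a) + d - 1)) * indicator {0..} \<rho>) \<partial>lborel)"
    using sphere_const_nonneg[OF p] by (intro nn_integral_cong) (auto simp: ennreal_mult mult_ac split: split_indicator)
  also have "\<dots> = ennreal (sphere_const p d) * (\<integral>\<^sup>+\<rho>. F \<rho> * ennreal (\<rho> ^ (DIM('a) + d - 1)) * indicator {0..} \<rho> \<partial>lborel)"
    by (rule nn_integral_cmult) measurable
  finally show ?thesis .
qed

lemma integral_radial:
  fixes p :: "'a::euclidean_space \<Rightarrow> real" and F :: "real \<Rightarrow> complex"
  assumes p: "homogeneous p d" and [measurable]: "F \<in> borel_measurable borel"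
  shows "(\<integral>x. F (norm x) * complex_of_real (p x) \<partial>lborel)
    = complex_of_real (sphere_const p d) * (\<integral>\<rho>. F \<rho> * complex_of_real (\<rho> ^ (DIM('a) + d - 1) * indicator {0..} \<rho>) \<partial>lborel)"
proof -
  have [measurable]: "p \<in> borel_measurable borel" using p by (auto simp: homogeneous_def borel_measurable_continuous_onI)
  have nn: "0 \<le> p x" for x using p by (auto simp: homogeneous_def)
  have "(\<integral>x. F (norm x) * complex_of_real (p x) \<partial>lborel) = (\<integral>x. F (norm x) \<partial>(density lborel (\<lambda>x. ennreal (p x))))"
    by (subst integral_density) (auto simp: scaleR_conv_of_real mult.commute nn)
  also have "\<dots> = (\<integral>\<rho>. F \<rho> \<partial>(distr (density lborel (\<lambda>x. ennreal (p x))) borel norm))"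
    by (subst integral_distr) auto
  also have "\<dots> = (\<integral>\<rho>. (sphere_const p d * \<rho> ^ (DIM('a) + d - 1) * indicator {0..} \<rho>) *\<^sub>R F \<rho> \<partial>lborel)"
    unfolding sphere_const_measure[OF p] using sphere_const_nonneg[OF p]
    by (subst integral_density) (auto split: split_indicator)
  also have "\<dots> = (\<integral>\<rho>. complex_of_real (sphere_const p d) * (F \<rho> * complex_of_real (\<rho> ^ (DIM('a) + d - 1) * indicator {0..} \<rho>)) \<partial>lborel)"
    by (intro Bochner_Integration.integral_cong) (auto simp: scaleR_conv_of_real)
  also have "\<dots> = complex_of_real (sphere_const p d) * (\<integral>\<rho>. F \<rho> * complex_of_real (\<rho> ^ (DIM('a) + d - 1) * indicator {0..} \<rho>) \<partial>lborel)"
    by (rule integral_mult_right_zero)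
  finally show ?thesis .
qed

lemma homogeneous_1: "homogeneous (\<lambda>_::'a::euclidean_space. 1) 0"
  by (auto simp: homogeneous_def)

lemma homogeneous_inner_power: "homogeneous (\<lambda>x::'a::euclidean_space. (e \<bullet> x) ^ (2 * k)) (2 * k)"
  by (auto simp: homogeneous_def power_mult_distrib intro!: continuous_intros)

section \<open>Spherical means of plane waves\<close>

definition gauss_abs_moment :: "nat \<Rightarrow> real" where
  "gauss_abs_moment k = (\<integral>x. std_normal_density x * \<bar>x\<bar> ^ k \<partial>lborel)"

lemma gauss_abs_moment_even: "gauss_abs_moment (2 * k) = fact (2 * k) / (2 ^ k * fact k)"
  using integral_std_normal_moment_even[of k] by (simp add: gauss_abs_moment_def power_even_abs)

lemma gauss_abs_moment_odd: "gauss_abs_moment (2 * k + 1) = sqrt (2 / pi) * 2 ^ k * fact k"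
  using integral_std_normal_moment_abs_odd[of k] by (simp add: gauss_abs_moment_def)

lemma gauss_abs_moment_rec: "gauss_abs_moment (k + 2) = real (k + 1) * gauss_abs_moment k"
proof (cases "even k")
  case True
  then obtain j where k: "k = 2 * j" by auto
  have "gauss_abs_moment (2 * Suc j) = real (2 * j + 1) * gauss_abs_moment (2 * j)"
  proof -
    have "fact (2 * Suc j) = (2 * (real j + 1)) * ((2 * real j + 1) * fact (2 * j))"
      by (simp add: algebra_simps)
    moreover have "2 ^ Suc j * fact (Suc j) = (2 * (real j + 1)) * (2 ^ j * fact j)"
      by (simp add: algebra_simps)
    moreover have "2 * (real j + 1) \<noteq> 0" by (simp add: add_nonneg_eq_0_iff)
    ultimately show ?thesis
      unfolding gauss_abs_moment_even by (simp only: mult_divide_mult_cancel_left) simp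
  qed
  then show ?thesis by (simp add: k)
next
  case False
  then obtain j where k: "k = 2 * j + 1" by (auto elim: oddE)
  have "gauss_abs_moment (2 * Suc j + 1) = real (2 * j + 2) * gauss_abs_moment (2 * j + 1)"
    unfolding gauss_abs_moment_odd by (simp add: field_simps)
  then show ?thesis by (simp add: k)
qed

lemma gauss_abs_moment_pos: "gauss_abs_moment k > 0"
proof (cases "even k")
  case True
  then obtain j where "k = 2 * j" by auto
  then show ?thesis using gauss_abs_moment_even[of j] by simp
next
  case False
  then obtain j where "k = 2 * j + 1" by (auto elim: oddE)
  then show ?thesis using gauss_abs_moment_odd[of j] by simp
qed

lemma nn_integral_gauss_abs_moment:
  "(\<integral>\<^sup>+x. ennreal (std_normal_density x) * ennreal (\<bar>x\<bar> ^ k) \<partial>lborel) = ennreal (gauss_abs_moment k)"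
proof -
  have "(\<integral>\<^sup>+x. ennreal (std_normal_density x) * ennreal (\<bar>x\<bar> ^ k) \<partial>lborel) = (\<integral>\<^sup>+x. ennreal (std_normal_density x * \<bar>x\<bar> ^ k) \<partial>lborel)"
    by (simp add: ennreal_mult normal_density_nonneg)
  also have "\<dots> = ennreal (gauss_abs_moment k)"
    unfolding gauss_abs_moment_def
    by (intro nn_integral_eq_integral integrable_std_normal_moment_abs) (auto simp: normal_density_nonneg)
  finally show ?thesis .
qed

text \<open>
  A unit vector picks a standard normal coordinate of a standard Gaussian: the characteristic functions agree.
\<close>
lemma gaussian_marginal:
  fixes e :: "'a::euclidean_space"
  assumes e: "norm e = 1"
  defines "c \<equiv> 1 / sqrt (2 * pi) ^ DIM('a)"
  shows "distr (density lborel (\<lambda>x::'a. ennreal (c * exp (- (norm x)\<^sup>2 / 2)))) borel ((\<bullet>) e) = density lborel std_normal_density"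
proof -
  let ?D = "density lborel (\<lambda>x::'a. ennreal (c * exp (- (norm x)\<^sup>2 / 2)))"
  have c: "c > 0" by (simp add: c_def)
  have "(\<integral>\<^sup>+x. ennreal (c * exp (- (norm x)\<^sup>2 / 2)) \<partial>(lborel::'a measure)) 
     = (\<integral>\<^sup>+x. ennreal (c / sqrt (2 * pi) ^ DIM('a)) * ennreal (gauss_kernel 1 x) \<partial>(lborel::'a measure))"
    using c by (intro nn_integral_cong) (simp add: gauss_kernel_def ennreal_mult[symmetric])
  also have "\<dots> = ennreal (c / sqrt (2 * pi) ^ DIM('a) * (2 * pi) ^ DIM('a))"
    by (subst nn_integral_cmult) (use c in \<open>auto simp: nn_integral_gauss_kernel ennreal_mult[symmetric]\<close>)
  also have "c / sqrt (2 * pi) ^ DIM('a) * (2 * pi) ^ DIM('a) = 1"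
  proof -
    have "sqrt (2 * pi) ^ DIM('a) * sqrt (2 * pi) ^ DIM('a) = (2 * pi) ^ DIM('a)"
      by (simp only: power_mult_distrib[symmetric] real_sqrt_mult_self) simp
    then show ?thesis by (simp add: c_def field_simps)
  qed
  finally have "prob_space ?D"
    by (intro prob_spaceI) (simp add: emeasure_density)
  then have rd: "real_distribution (distr ?D borel ((\<bullet>) e))"
    by (intro prob_space.real_distribution_distr) auto
  show ?thesis
  proof (rule Levy_uniqueness[OF rd real_dist_normal_dist])
    show "char (distr ?D borel ((\<bullet>) e)) = char std_normal_distribution"
    proof
      fix t
      have "char (distr ?D borel ((\<bullet>) e)) t = (\<integral>x. cis (t * (e \<bullet> x)) \<partial>?D)"
        unfolding char_def by (subst integral_distr) (auto simp: cis_conv_exp)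
      also have "\<dots> = (\<integral>x. complex_of_real c * (complex_of_real (exp (- (1 / 2) * (norm x)\<^sup>2)) * cis (x \<bullet> (t *\<^sub>R e))) \<partial>lborel)"
        using c by (subst integral_density) (auto simp: scaleR_conv_of_real inner_commute mult.assoc)
      also have "\<dots> = complex_of_real c * complex_of_real (gauss_kernel 1 (t *\<^sub>R e))"
        by (subst integral_mult_right_zero) (simp only: gaussian_fourier(2)[OF zero_less_one])
      also have "\<dots> = complex_of_real (exp (- (t\<^sup>2) / 2))"
      proof -
        have "c * gauss_kernel 1 (t *\<^sub>R e) = exp (- (t\<^sup>2) / 2)"
          using e by (simp add: gauss_kernel_def c_def)
        then show ?thesis by (simp only: of_real_mult[symmetric])
      qed
      also have "\<dots> = char std_normal_distribution t"
        by (simp add: char_std_normal_distribution)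
      finally show "char (distr ?D borel ((\<bullet>) e)) t = char std_normal_distribution t" .
    qed
  qed
qed

definition sphere_area :: "'a::euclidean_space itself \<Rightarrow> real" where
  "sphere_area _ = sphere_const (\<lambda>_::'a. 1) 0"

lemma half_line_gauss_moment:
  "\<exists>K>0. \<forall>m. ennreal K * (\<integral>\<^sup>+\<rho>. ennreal (std_normal_density \<rho>) * ennreal (\<rho> ^ m) * indicator {0..} \<rho> \<partial>lborel) = ennreal (gauss_abs_moment m)"
proof -
  let ?K = "sphere_const (\<lambda>_::real. 1) 0"
  have std: "std_normal_density \<bar>x\<bar> = std_normal_density x" for x by (simp add: std_normal_density_def)
  have *: "ennreal ?K * (\<integral>\<^sup>+\<rho>. ennreal (std_normal_density \<rho>) * ennreal (\<rho> ^ m) * indicator {0..} \<rho> \<partial>lborel) = ennreal (gauss_abs_moment m)" for m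
  proof -
    have "ennreal (gauss_abs_moment m) = (\<integral>\<^sup>+x. ennreal (std_normal_density (norm x)) * ennreal (norm x ^ m) * ennreal 1 \<partial>(lborel::real measure))"
      by (simp add: nn_integral_gauss_abs_moment[symmetric] std)
    also have "\<dots> = ennreal ?K * (\<integral>\<^sup>+\<rho>. ennreal (std_normal_density \<rho>) * ennreal (\<rho> ^ m) * ennreal (\<rho> ^ (DIM(real) + 0 - 1)) * indicator {0..} \<rho> \<partial>lborel)"
      by (rule nn_integral_radial[OF homogeneous_1]) measurable
    finally show ?thesis by simp
  qed
  have "?K \<noteq> 0"
  proof
    assume "?K = 0"
    with *[of 0] gauss_abs_moment_pos[of 0] show False by simp
  qed
  with sphere_const_nonneg[OF homogeneous_1, where 'a = real] * show ?thesis
    by (intro exI[of _ ?K]) auto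
qed

text \<open>
  The Gaussian integral of \<open>(e \<bullet> x)\<^sup>2\<^sup>k\<close> computed in two ways, as a moment of the normal coordinate and in polar
  form.  The constants \<open>K\<close> and \<open>c\<close> are the same for all \<open>k\<close> and \<open>e\<close>, so ratios of consecutive moments are explicit.
\<close>
lemma sphere_moment_identity:
  "\<exists>K>0. \<exists>c>0. \<forall>(e::'a::euclidean_space) k. norm e = 1 \<longrightarrow>
     sphere_const (\<lambda>x. (e \<bullet> x) ^ (2 * k)) (2 * k) * c * gauss_abs_moment (DIM('a) + 2 * k - 1) = K * gauss_abs_moment (2 * k)"
proof -
  obtain K where K: "K > 0" and HK: "\<And>m. ennreal K * (\<integral>\<^sup>+\<rho>. ennreal (std_normal_density \<rho>) * ennreal (\<rho> ^ m) * indicator {0..} \<rho> \<partial>lborel) = ennreal (gauss_abs_moment m)"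
    using half_line_gauss_moment by blast
  define c where "c = 1 / sqrt (2 * pi) ^ DIM('a)"
  define c' where "c' = c * sqrt (2 * pi)"
  have c: "c > 0" "c' > 0" by (simp_all add: c_def c'_def)
  have "sphere_const (\<lambda>x. (e \<bullet> x) ^ (2 * k)) (2 * k) * c' * gauss_abs_moment (DIM('a) + 2 * k - 1) = K * gauss_abs_moment (2 * k)"
    if e: "norm e = 1" for e :: 'a and k
  proof -
    let ?P = "sphere_const (\<lambda>x. (e \<bullet> x) ^ (2 * k)) (2 * k)"
    let ?m = "DIM('a) + 2 * k - 1"
    let ?H = "\<integral>\<^sup>+\<rho>. ennreal (std_normal_density \<rho>) * ennreal (\<rho> ^ ?m) * indicator {0..} \<rho> \<partial>lborel"
    have P: "?P \<ge> 0" by (rule sphere_const_nonneg[OF homogeneous_inner_power])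
    have "ennreal (gauss_abs_moment (2 * k)) = (\<integral>\<^sup>+y. ennreal (y ^ (2 * k)) \<partial>std_normal_distribution)"
      by (subst nn_integral_density) (auto simp: nn_integral_gauss_abs_moment[symmetric] power_even_abs)
    also have "\<dots> = (\<integral>\<^sup>+x. ennreal (c * exp (- (norm x)\<^sup>2 / 2)) * ennreal ((e \<bullet> x) ^ (2 * k)) \<partial>lborel)"
      unfolding gaussian_marginal[OF e, symmetric] c_def[symmetric]
      by (subst nn_integral_distr) (auto simp: nn_integral_density)
    also have "\<dots> = ennreal ?P * (\<integral>\<^sup>+\<rho>. ennreal (c * exp (- \<rho>\<^sup>2 / 2)) * ennreal (\<rho> ^ ?m) * indicator {0..} \<rho> \<partial>lborel)"
      by (rule nn_integral_radial[OF homogeneous_inner_power]) measurable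
    also have "(\<integral>\<^sup>+\<rho>. ennreal (c * exp (- \<rho>\<^sup>2 / 2)) * ennreal (\<rho> ^ ?m) * indicator {0..} \<rho> \<partial>lborel)
       = (\<integral>\<^sup>+\<rho>. ennreal c' * (ennreal (std_normal_density \<rho>) * ennreal (\<rho> ^ ?m) * indicator {0..} \<rho>) \<partial>lborel)"
    proof (intro nn_integral_cong)
      fix \<rho> :: real
      have "c * exp (- \<rho>\<^sup>2 / 2) = c' * std_normal_density \<rho>" by (simp add: c'_def std_normal_density_def)
      then show "ennreal (c * exp (- \<rho>\<^sup>2 / 2)) * ennreal (\<rho> ^ ?m) * indicator {0..} \<rho> = ennreal c' * (ennreal (std_normal_density \<rho>) * ennreal (\<rho> ^ ?m) * indicator {0..} \<rho>)"
        using c by (simp only: ennreal_mult normal_density_nonneg less_imp_le mult.assoc)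
    qed
    also have "\<dots> = ennreal c' * ?H" by (rule nn_integral_cmult) measurable
    finally have "ennreal K * ennreal (gauss_abs_moment (2 * k)) = ennreal ?P * ennreal c' * (ennreal K * ?H)"
      by (simp add: mult_ac)
    also have "\<dots> = ennreal ?P * ennreal c' * ennreal (gauss_abs_moment ?m)" by (simp only: HK)
    finally have "ennreal (K * gauss_abs_moment (2 * k)) = ennreal (?P * c' * gauss_abs_moment ?m)"
      using P c K gauss_abs_moment_pos[of "2 * k"] gauss_abs_moment_pos[of ?m]
      by (simp add: ennreal_mult less_imp_le)
    then have "K * gauss_abs_moment (2 * k) = ?P * c' * gauss_abs_moment ?m"
      using P c K gauss_abs_moment_pos[of "2 * k"] gauss_abs_moment_pos[of ?m]
      by (subst (asm) ennreal_inj) (auto simp: less_imp_le)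
    then show ?thesis by simp
  qed
  then show ?thesis using K c(2) by blast
qed

lemma sphere_area_pos: "sphere_area TYPE('a::euclidean_space) > 0"
proof -
  obtain K c where K: "K > 0" "c > 0" and eq: "\<forall>(e::'a) k. norm e = 1 \<longrightarrow>
     sphere_const (\<lambda>x. (e \<bullet> x) ^ (2 * k)) (2 * k) * c * gauss_abs_moment (DIM('a) + 2 * k - 1) = K * gauss_abs_moment (2 * k)"
    using sphere_moment_identity[where 'a = 'a] by blast
  obtain e :: 'a where e: "norm e = 1" using SOME_Basis norm_Basis by blast
  from eq[rule_format, OF e, of 0] have "sphere_area TYPE('a) * c * gauss_abs_moment (DIM('a) - 1) = K * gauss_abs_moment 0"
    by (simp add: sphere_area_def)
  moreover have "K * gauss_abs_moment 0 > 0" using K gauss_abs_moment_pos[of 0] by simp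
  ultimately have "sphere_area TYPE('a) \<noteq> 0" by auto
  moreover have "sphere_area TYPE('a) \<ge> 0" unfolding sphere_area_def by (rule sphere_const_nonneg[OF homogeneous_1])
  ultimately show ?thesis by simp
qed

text \<open>
  The average of \<open>(e \<bullet> \<omega>)\<^sup>2\<^sup>k\<close> over the unit sphere of \<open>\<real>\<^sup>N\<close>, for a unit vector \<open>e\<close>.
\<close>
fun mean_power :: "nat \<Rightarrow> nat \<Rightarrow> real" where
  "mean_power N 0 = 1"
| "mean_power N (Suc k) = mean_power N k * real (2 * k + 1) / real (N + 2 * k)"

lemma sphere_const_inner_power:
  fixes e :: "'a::euclidean_space"
  assumes e: "norm e = 1"
  shows "sphere_const (\<lambda>x. (e \<bullet> x) ^ (2 * k)) (2 * k) = sphere_area TYPE('a) * mean_power DIM('a) k"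
proof (induction k)
  case 0
  then show ?case by (simp add: sphere_area_def)
next
  case (Suc k)
  obtain K c where K: "K > 0" "c > 0" and eq: "\<forall>(e::'a) k. norm e = 1 \<longrightarrow>
     sphere_const (\<lambda>x. (e \<bullet> x) ^ (2 * k)) (2 * k) * c * gauss_abs_moment (DIM('a) + 2 * k - 1) = K * gauss_abs_moment (2 * k)"
    using sphere_moment_identity[where 'a = 'a] by blast
  define P where "P k = sphere_const (\<lambda>x. (e \<bullet> x) ^ (2 * k)) (2 * k)" for k
  define g where "g = gauss_abs_moment (DIM('a) + 2 * k - 1)"
  have g: "g > 0" unfolding g_def by (rule gauss_abs_moment_pos)
  have D: "DIM('a) > 0" by (rule DIM_positive)
  have g1: "gauss_abs_moment (DIM('a) + 2 * Suc k - 1) = real (DIM('a) + 2 * k) * g"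
  proof -
    have "DIM('a) + 2 * Suc k - 1 = (DIM('a) + 2 * k - 1) + 2" "DIM('a) + 2 * k - 1 + 1 = DIM('a) + 2 * k" using D by auto
    then show ?thesis using gauss_abs_moment_rec[of "DIM('a) + 2 * k - 1"] unfolding g_def by simp
  qed
  have g2: "gauss_abs_moment (2 * Suc k) = real (2 * k + 1) * gauss_abs_moment (2 * k)"
    using gauss_abs_moment_rec[of "2 * k"] by simp
  have e1: "P k * c * g = K * gauss_abs_moment (2 * k)"
    using eq e unfolding P_def g_def by blast
  have "P (Suc k) * c * (real (DIM('a) + 2 * k) * g) = K * (real (2 * k + 1) * gauss_abs_moment (2 * k))"
    using eq[rule_format, OF e, of "Suc k"] unfolding P_def[symmetric] g1 g2 .
  also have "\<dots> = real (2 * k + 1) * (P k * c * g)" unfolding e1 by simp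
  finally have "(P (Suc k) * real (DIM('a) + 2 * k)) * (c * g) = (real (2 * k + 1) * P k) * (c * g)"
    by (simp only: mult_ac)
  then have "P (Suc k) * real (DIM('a) + 2 * k) = real (2 * k + 1) * P k"
    using g K by simp
  moreover have nz: "real (DIM('a) + 2 * k) \<noteq> 0" using D unfolding of_nat_eq_0_iff by simp
  ultimately have "P (Suc k) = real (2 * k + 1) * P k / real (DIM('a) + 2 * k)"
    by (subst nonzero_eq_divide_eq[OF nz])
  also have "\<dots> = sphere_area TYPE('a) * mean_power DIM('a) (Suc k)"
    using Suc unfolding P_def by (simp add: mult_ac)
  finally show ?case unfolding P_def .
qed

lemma mean_power_bounds: "N > 0 \<Longrightarrow> 0 \<le> mean_power N k \<and> mean_power N k \<le> 1"
proof (induction k)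
  case (Suc k)
  then have "real (2 * k + 1) / real (N + 2 * k) \<le> 1" "0 \<le> real (2 * k + 1) / real (N + 2 * k)" by auto
  with Suc show ?case by (auto simp: mult_le_one simp flip: times_divide_eq_right)
qed simp

definition bessel_coeff :: "nat \<Rightarrow> nat \<Rightarrow> real" where
  "bessel_coeff N k = (- 1) ^ k * mean_power N k / fact (2 * k)"

text \<open>
  The coefficient form of the differential equation in \<open>sphere_mean_ode\<close>.
\<close>
lemma bessel_coeff_rec:
  assumes "N > 0"
  shows "real (Suc k) * real (4 * k + 2 * N) * bessel_coeff N (Suc k) = - bessel_coeff N k"
proof -
  have N: "real (N + 2 * k) \<noteq> 0" using assms by simp
  have f: "fact (2 * Suc k) = real (2 * k + 2) * (real (2 * k + 1) * fact (2 * k))"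
    by (simp add: algebra_simps)
  have "bessel_coeff N (Suc k) = - ((- 1) ^ k * (mean_power N k * real (2 * k + 1) / real (N + 2 * k)) / (real (2 * k + 2) * (real (2 * k + 1) * fact (2 * k))))"
    unfolding bessel_coeff_def f by simp
  also have "\<dots> = - (bessel_coeff N k / (real (N + 2 * k) * real (2 * k + 2)))"
  proof -
    have cancel: "a * (b * w / n) / (m * (w * f)) = a * b / f / (n * m)" if "w \<noteq> 0" for a b n m f w :: real
      using that by (simp add: field_simps)
    have "real (2 * k + 1) \<noteq> 0" by simp
    from cancel[OF this] show ?thesis unfolding bessel_coeff_def by (simp only:)
  qed
  finally have "bessel_coeff N (Suc k) = - (bessel_coeff N k / (real (N + 2 * k) * real (2 * k + 2)))" .
  moreover have "real (Suc k) * real (4 * k + 2 * N) = real (N + 2 * k) * real (2 * k + 2)"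
    by (simp add: algebra_simps)
  moreover have "real (N + 2 * k) * real (2 * k + 2) \<noteq> 0" using N by simp
  ultimately show ?thesis by (simp only:) simp
qed

lemma bessel_coeff_le: "N > 0 \<Longrightarrow> \<bar>bessel_coeff N k\<bar> \<le> 1 / fact (2 * k)"
  using mean_power_bounds[of N k] by (simp add: bessel_coeff_def abs_mult divide_right_mono)

lemma summable_power_over_fact_double: "summable (\<lambda>k. z ^ k / fact (2 * k) :: real)"
proof (rule summable_comparison_test'[where N = 0])
  show "summable (\<lambda>k. \<bar>z\<bar> ^ k / fact k)"
    using summable_exp[of "\<bar>z\<bar>"] by (simp add: field_simps)
  show "norm (z ^ k / fact (2 * k)) \<le> \<bar>z\<bar> ^ k / fact k" for k
    by (auto simp: power_abs intro!: divide_left_mono fact_mono)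
qed

lemma summable_bessel: 
  assumes "N > 0"
  shows "summable (\<lambda>k. bessel_coeff N k * z ^ k)"
proof (rule summable_comparison_test'[OF summable_power_over_fact_double[of "\<bar>z\<bar>"], where N = 0])
  fix k
  have "\<bar>bessel_coeff N k\<bar> * \<bar>z\<bar> ^ k \<le> (1 / fact (2 * k)) * \<bar>z\<bar> ^ k"
    by (intro mult_right_mono bessel_coeff_le assms) simp
  then show "norm (bessel_coeff N k * z ^ k) \<le> \<bar>z\<bar> ^ k / fact (2 * k)"
    by (simp add: abs_mult power_abs)
qed

text \<open>
  The average of \<open>cos (r (e \<bullet> \<omega>))\<close> over the unit sphere of \<open>\<real>\<^sup>N\<close>, expanded in powers of \<open>r\<close>; it is a constant
  multiple of \<open>r powr (1 - N / 2)\<close> times the Bessel function of order \<open>N / 2 - 1\<close>.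
\<close>
definition sphere_mean :: "nat \<Rightarrow> real \<Rightarrow> real" where
  "sphere_mean N r = (\<Sum>k. bessel_coeff N k * (r\<^sup>2) ^ k)"

text \<open>
  The equation \<open>J'' + ((N - 1) / r) J' + J = 0\<close>, as a first-order system.  In the variable \<open>z = r\<^sup>2\<close> it becomes
  \<open>4 z f'' + 2 N f' + f = 0\<close>, which is checked coefficient by coefficient.
\<close>
lemma sphere_mean_ode:
  assumes N: "N > 0"
  obtains J' where "\<And>r. (sphere_mean N has_real_derivative J' r) (at r)"
    and "\<And>r. r > 0 \<Longrightarrow> (J' has_real_derivative (- (real N - 1) / r * J' r - sphere_mean N r)) (at r)"
proof -
  let ?b = "bessel_coeff N"
  define f where "f z = (\<Sum>k. ?b k * z ^ k)" for z
  define f1 where "f1 z = (\<Sum>k. diffs ?b k * z ^ k)" for z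
  define f2 where "f2 z = (\<Sum>k. diffs (diffs ?b) k * z ^ k)" for z
  note sm = summable_bessel[OF N]
  have sm1: "summable (\<lambda>k. diffs ?b k * z ^ k)" for z
    by (rule termdiff_converges_all) (rule sm)
  have sm2: "summable (\<lambda>k. diffs (diffs ?b) k * z ^ k)" for z
    by (rule termdiff_converges_all) (rule sm1)
  have d: "(f has_real_derivative f1 z) (at z)" for z
    unfolding f_def[abs_def] f1_def by (rule termdiffs_strong_converges_everywhere) (rule sm)
  have d1: "(f1 has_real_derivative f2 z) (at z)" for z
    unfolding f1_def[abs_def] f2_def by (rule termdiffs_strong_converges_everywhere) (rule sm1)
  have ode: "4 * z * f2 z + 2 * real N * f1 z + f z = 0" for z
  proof -
    have s0: "(\<lambda>k. ?b k * z ^ k) sums f z" unfolding f_def by (rule summable_sums[OF sm])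
    have s1: "(\<lambda>k. diffs ?b k * z ^ k) sums f1 z" unfolding f1_def by (rule summable_sums[OF sm1])
    have "(\<lambda>k. z * (diffs (diffs ?b) k * z ^ k)) sums (z * f2 z)" unfolding f2_def by (intro sums_mult summable_sums[OF sm2])
    then have "(\<lambda>k. real (Suc k) * diffs ?b (Suc k) * z ^ Suc k) sums (z * f2 z)"
      by (simp add: diffs_def mult_ac)
    then have s2: "(\<lambda>k. real k * diffs ?b k * z ^ k) sums (z * f2 z)"
      using sums_Suc_iff[of "\<lambda>k. real k * diffs ?b k * z ^ k" "z * f2 z"] by simp
    have "(\<lambda>k. 4 * (real k * diffs ?b k * z ^ k) + 2 * real N * (diffs ?b k * z ^ k) + ?b k * z ^ k) sums (4 * (z * f2 z) + 2 * real N * f1 z + f z)"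
      by (intro sums_add sums_mult s0 s1 s2)
    moreover have "4 * (real k * diffs ?b k * z ^ k) + 2 * real N * (diffs ?b k * z ^ k) + ?b k * z ^ k = 0" for k
    proof -
      have "4 * (real k * diffs ?b k * z ^ k) + 2 * real N * (diffs ?b k * z ^ k) + ?b k * z ^ k
        = (real (Suc k) * real (4 * k + 2 * N) * ?b (Suc k) + ?b k) * z ^ k"
        by (simp add: diffs_def algebra_simps)
      then show ?thesis using bessel_coeff_rec[OF N, of k] by simp
    qed
    ultimately have "(\<lambda>k. 0 :: real) sums (4 * (z * f2 z) + 2 * real N * f1 z + f z)" by simp
    then have "4 * (z * f2 z) + 2 * real N * f1 z + f z = 0" using sums_unique2 sums_zero by blast
    then show ?thesis by (simp add: mult.assoc)
  qed
  have Jf: "sphere_mean N = (\<lambda>r. f (r\<^sup>2))" by (auto simp: sphere_mean_def f_def)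
  show thesis
  proof (rule that)
    show "(sphere_mean N has_real_derivative f1 (r\<^sup>2) * (2 * r)) (at r)" for r
      unfolding Jf by (rule DERIV_chain2[OF d]) (auto intro!: derivative_eq_intros)
    fix r :: real assume r: "r > 0"
    have "((\<lambda>r. f1 (r\<^sup>2) * (2 * r)) has_real_derivative (f2 (r\<^sup>2) * (2 * r)) * (2 * r) + 2 * f1 (r\<^sup>2)) (at r)"
      by (rule derivative_eq_intros DERIV_chain2[OF d1] refl)+ (auto simp: mult_ac)
    moreover have "(f2 (r\<^sup>2) * (2 * r)) * (2 * r) + 2 * f1 (r\<^sup>2) = - (real N - 1) / r * (f1 (r\<^sup>2) * (2 * r)) - sphere_mean N r"
    proof -
      have "- (real N - 1) / r * (f1 (r\<^sup>2) * (2 * r)) = - (real N - 1) * 2 * f1 (r\<^sup>2)" using r by simp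
      then show ?thesis using ode[of "r\<^sup>2"] unfolding Jf by (simp add: algebra_simps power2_eq_square)
    qed
    ultimately show "((\<lambda>r. f1 (r\<^sup>2) * (2 * r)) has_real_derivative (- (real N - 1) / r * (f1 (r\<^sup>2) * (2 * r)) - sphere_mean N r)) (at r)"
      by simp
  qed
qed

text \<open>
  The quantity \<open>V\<close> is the natural energy \<open>r\<^sup>D (A\<^sup>2 + B\<^sup>2)\<close> with a cross term chosen so that the terms of size
  \<open>V / r\<close> cancel in its derivative.  What remains is of size \<open>V / r\<^sup>2\<close>, which is integrable at infinity and is
  absorbed by the factor \<open>exp (D / r)\<close>.
\<close>
lemma sphere_mean_decay_energy:
  fixes A B :: "real \<Rightarrow> real" and D :: nat
  assumes A: "\<And>r. r > 0 \<Longrightarrow> (A has_real_derivative B r) (at r)"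
    and B: "\<And>r. r > 0 \<Longrightarrow> (B has_real_derivative (- real D / r * B r - A r)) (at r)"
  shows "\<exists>C. \<forall>r\<ge>real D + 1. r ^ D * (A r)\<^sup>2 \<le> C"
proof -
  define V where "V r = r ^ D * ((A r)\<^sup>2 + (B r)\<^sup>2 + real D / r * (A r * B r))" for r
  have V_eq: "(V has_real_derivative (- (real D / r\<^sup>2) * r ^ D * (A r * B r))) (at r)" if r: "r > 0" for r
  proof -
    have "real D * r ^ (D - 1) = r ^ D * (real D / r)"
      using r by (cases D) auto
    then have d1: "((\<lambda>r. r ^ D) has_real_derivative (r ^ D * (real D / r))) (at r)"
      using DERIV_pow[of D r] by simp
    have d2: "((\<lambda>r. (A r)\<^sup>2 + (B r)\<^sup>2 + real D / r * (A r * B r)) has_real_derivative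
       (2 * A r * B r + 2 * B r * (- real D / r * B r - A r) + (- (real D / r\<^sup>2) * (A r * B r) + real D / r * (B r * B r + A r * (- real D / r * B r - A r))))) (at r)"
      using r by (auto intro!: derivative_eq_intros A B simp: power2_eq_square field_simps)
    have "(V has_real_derivative 
       (r ^ D * (real D / r)) * ((A r)\<^sup>2 + (B r)\<^sup>2 + real D / r * (A r * B r))
       + r ^ D * (2 * A r * B r + 2 * B r * (- real D / r * B r - A r) + (- (real D / r\<^sup>2) * (A r * B r) + real D / r * (B r * B r + A r * (- real D / r * B r - A r))))) (at r)"
      unfolding V_def[abs_def] using DERIV_mult[OF d1 d2] by (simp only: mult.commute add.commute)
    moreover have "r ^ D * (real D / r) * ((A r)\<^sup>2 + (B r)\<^sup>2 + real D / r * (A r * B r))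
       + r ^ D * (2 * A r * B r + 2 * B r * (- real D / r * B r - A r) + (- (real D / r\<^sup>2) * (A r * B r) + real D / r * (B r * B r + A r * (- real D / r * B r - A r))))
       = - (real D / r\<^sup>2) * r ^ D * (A r * B r)"
      using r by (simp add: field_simps power2_eq_square)
    ultimately show ?thesis by simp
  qed
  have dW: "\<exists>y. ((\<lambda>r. V r * exp (real D / r)) has_real_derivative y) (at r) \<and> y \<le> 0" if r: "r \<ge> real D + 1" for r
  proof -
    have r0: "r > 0" using r by linarith
    let ?y = "(- (real D / r\<^sup>2) * r ^ D * (A r * B r)) * exp (real D / r) + V r * (exp (real D / r) * (- (real D / r\<^sup>2)))"
    have "((\<lambda>r. V r * exp (real D / r)) has_real_derivative ?y) (at r)"
      using r0 by (auto intro!: derivative_eq_intros V_eq simp: power2_eq_square)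
    moreover have "?y = - (exp (real D / r) * (real D / r\<^sup>2) * r ^ D) * ((A r)\<^sup>2 + (B r)\<^sup>2 + (1 + real D / r) * (A r * B r))"
      unfolding V_def using r0 by (simp add: field_simps)
    moreover have "(A r)\<^sup>2 + (B r)\<^sup>2 + (1 + real D / r) * (A r * B r) \<ge> 0"
    proof -
      have t: "0 \<le> 1 + real D / r" "1 + real D / r \<le> 2" using r r0 by (auto simp: field_simps)
      have "\<bar>(1 + real D / r) * (A r * B r)\<bar> \<le> 2 * \<bar>A r * B r\<bar>"
        unfolding abs_mult[of "1 + real D / r"] using t by (intro mult_right_mono) auto
      moreover have "2 * \<bar>A r * B r\<bar> \<le> (A r)\<^sup>2 + (B r)\<^sup>2"
        using sum_squares_bound[of "\<bar>A r\<bar>" "\<bar>B r\<bar>"] by (simp add: abs_mult)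
      ultimately show ?thesis by linarith
    qed
    then have "- (exp (real D / r) * (real D / r\<^sup>2) * r ^ D) * ((A r)\<^sup>2 + (B r)\<^sup>2 + (1 + real D / r) * (A r * B r)) \<le> 0"
      using r0 by (intro mult_nonpos_nonneg) auto
    ultimately show ?thesis by metis
  qed
  define r0 where "r0 = real D + 1"
  have "r ^ D * (A r)\<^sup>2 \<le> 2 * (V r0 * exp (real D / r0))" if r: "r \<ge> r0" for r
  proof -
    have rp: "r > 0" using r by (simp add: r0_def)
    have dec: "V r * exp (real D / r) \<le> V r0 * exp (real D / r0)"
      using r dW unfolding r0_def by (intro DERIV_nonpos_imp_nonincreasing[of "real D + 1" r]) auto
    have half: "real D / r * \<bar>A r * B r\<bar> \<le> ((A r)\<^sup>2 + (B r)\<^sup>2) / 2"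
    proof -
      have "real D / r * \<bar>A r * B r\<bar> \<le> 1 * \<bar>A r * B r\<bar>"
        using r rp by (intro mult_right_mono) (auto simp: r0_def field_simps)
      also have "\<dots> \<le> ((A r)\<^sup>2 + (B r)\<^sup>2) / 2"
        using sum_squares_bound[of "\<bar>A r\<bar>" "\<bar>B r\<bar>"] by (simp add: abs_mult)
      finally show ?thesis .
    qed
    have "- (real D / r * \<bar>A r * B r\<bar>) \<le> real D / r * (A r * B r)"
      using mult_left_mono[of "- \<bar>A r * B r\<bar>" "A r * B r" "real D / r"] rp by simp
    moreover have "X \<le> (a + b) / 2 \<Longrightarrow> - X \<le> T \<Longrightarrow> 0 \<le> b \<Longrightarrow> a / 2 \<le> a + b + T" for a b X T :: real
      by (simp add: field_simps)
    ultimately have "(A r)\<^sup>2 / 2 \<le> (A r)\<^sup>2 + (B r)\<^sup>2 + real D / r * (A r * B r)"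
      using half zero_le_power2[of "B r"] by blast
    \<comment> \<open>Beyond \<open>D + 1\<close> the cross term takes away at most half of the energy.\<close>
    then have V: "r ^ D * ((A r)\<^sup>2 / 2) \<le> V r"
      unfolding V_def using rp by (intro mult_left_mono) auto
    moreover have "0 \<le> r ^ D * ((A r)\<^sup>2 / 2)" using rp by simp
    ultimately have "V r \<ge> 0" by linarith
    then have "V r * 1 \<le> V r * exp (real D / r)"
      using rp by (intro mult_left_mono) auto
    with V dec show ?thesis by simp
  qed
  then show ?thesis unfolding r0_def by blast
qed

lemma isCont_sphere_mean: "N > 0 \<Longrightarrow> isCont (sphere_mean N) r"
  using sphere_mean_ode[of N] DERIV_isCont by metis

lemma sphere_mean_measurable [measurable]: "N > 0 \<Longrightarrow> sphere_mean N \<in> borel_measurable borel"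
  by (intro borel_measurable_continuous_onI continuous_at_imp_continuous_on ballI isCont_sphere_mean)

lemma sphere_mean_decay:
  assumes N: "N > 0"
  shows "\<exists>C>0. \<forall>r>0. \<bar>sphere_mean N r\<bar> \<le> C * min 1 (r powr (- (real N - 1) / 2))"
proof -
  define D where "D = N - 1"
  have ND: "real D = real N - 1" using N by (simp add: D_def)
  obtain J' where J: "\<And>r. (sphere_mean N has_real_derivative J' r) (at r)"
    "\<And>r. r > 0 \<Longrightarrow> (J' has_real_derivative (- real D / r * J' r - sphere_mean N r)) (at r)"
    using sphere_mean_ode[OF N] unfolding ND by metis
  obtain C0 where C0: "\<And>r. r \<ge> real D + 1 \<Longrightarrow> r ^ D * (sphere_mean N r)\<^sup>2 \<le> C0"
    using sphere_mean_decay_energy[of "sphere_mean N" J' D] J by blast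
  have "compact (sphere_mean N ` {0..real D + 1})"
    by (intro compact_continuous_image continuous_at_imp_continuous_on ballI isCont_sphere_mean N) auto
  then obtain B where B: "\<And>r. 0 \<le> r \<Longrightarrow> r \<le> real D + 1 \<Longrightarrow> \<bar>sphere_mean N r\<bar> \<le> B"
  proof -
    assume "compact (sphere_mean N ` {0..real D + 1})"
    then obtain b where "\<forall>y\<in>sphere_mean N ` {0..real D + 1}. norm y \<le> b"
      using compact_imp_bounded bounded_iff by metis
    then show thesis by (intro that[of b]) auto
  qed
  have B0: "B \<ge> 0" using B[of 0] by simp
  have C00: "C0 \<ge> 0"
    using C0[of "real D + 1"] by (rule order_trans[rotated]) auto
  let ?p = "\<lambda>r. r powr (- (real N - 1) / 2)"
  have big: "\<bar>sphere_mean N r\<bar> \<le> sqrt C0 * ?p r" if r: "r \<ge> real D + 1" for r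
  proof -
    have rp: "r > 0" using r by linarith
    have "(?p r)\<^sup>2 = r powr (- real D)" using rp by (simp add: power2_eq_square ND flip: powr_add)
    also have "\<dots> = 1 / r ^ D" using rp by (simp add: powr_minus_divide powr_realpow)
    finally have p: "(?p r)\<^sup>2 = 1 / r ^ D" .
    have "(sphere_mean N r)\<^sup>2 \<le> C0 * (?p r)\<^sup>2"
      using C0[OF r] rp unfolding p by (simp add: field_simps)
    then have "sqrt ((sphere_mean N r)\<^sup>2) \<le> sqrt (C0 * (?p r)\<^sup>2)" by (rule real_sqrt_le_mono)
    then show ?thesis by (simp add: real_sqrt_mult)
  qed
  define C where "C = (sqrt C0 + B * (real D + 1) powr (real D / 2)) + B + 1"
  have q1: "(real D + 1) powr (real D / 2) \<ge> 1" by (rule ge_one_powr_ge_zero) auto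
  then have Bq: "B \<le> B * (real D + 1) powr (real D / 2)" using B0 by (simp add: mult_le_cancel_left1)
  have Cp: "C > 0" using B0 C00 q1 unfolding C_def by (simp add: add_nonneg_pos)
  have "\<bar>sphere_mean N r\<bar> \<le> C * min 1 (?p r)" if r: "r > 0" for r
  proof -
    have m: "C * min 1 (?p r) = min C (C * ?p r)"
      using Cp by (simp add: min_mult_distrib_left)
    show ?thesis
    proof (cases "r \<ge> real D + 1")
      case True
      have p1: "?p r \<le> 1" using powr_mono[of "- (real N - 1) / 2" 0 r] True N by simp
      have "sqrt C0 * ?p r \<le> C * ?p r"
        using B0 Bq unfolding C_def by (intro mult_right_mono) auto
      moreover have "C * ?p r \<le> C" using p1 Cp by (simp add: mult_le_cancel_left1)
      ultimately show ?thesis unfolding m using big[OF True] by simp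
    next
      case False
      then have a: "\<bar>sphere_mean N r\<bar> \<le> B" using B r by simp
      have "(real D + 1) powr (- (real D / 2)) \<le> r powr (- (real D / 2))"
        using False r by (intro powr_mono2') auto
      then have "1 \<le> (real D + 1) powr (real D / 2) * r powr (- (real D / 2))"
        using q1 by (simp add: powr_minus field_simps)
      then have "B \<le> B * ((real D + 1) powr (real D / 2) * r powr (- (real D / 2)))"
        using B0 by (simp add: mult_le_cancel_left1)
      also have "\<dots> = (B * (real D + 1) powr (real D / 2)) * ?p r"
      proof -
        have ex: "- (real D / 2) = - (real N - 1) / 2" unfolding ND by (rule minus_divide_left)
        show ?thesis by (simp only: ex mult.assoc)
      qed
      also have "\<dots> \<le> C * ?p r"
        unfolding C_def using B0 C00 by (intro mult_right_mono) auto
      finally have "B \<le> C * ?p r" .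
      moreover have "B \<le> C" unfolding C_def using Bq B0 C00 by simp
      ultimately show ?thesis unfolding m using a by simp
    qed
  qed
  with Cp show ?thesis by blast
qed

section \<open>Fourier transforms of radial functions\<close>

lemma integrable_radial:
  fixes F :: "real \<Rightarrow> complex"
  assumes [measurable]: "F \<in> borel_measurable borel"
  shows "integrable lborel (\<lambda>x::'a::euclidean_space. F (norm x)) \<longleftrightarrow>
     integrable lborel (\<lambda>\<rho>. F \<rho> * complex_of_real (\<rho> ^ (DIM('a) - 1) * indicator {0..} \<rho>))"
proof -
  let ?s = "sphere_const (\<lambda>_::'a. 1) 0"
  have s: "?s > 0" using sphere_area_pos[where 'a = 'a] by (simp add: sphere_area_def)
  have "integrable lborel (\<lambda>x::'a. F (norm x)) \<longleftrightarrow> integrable (distr (density lborel (\<lambda>x::'a. ennreal 1)) borel norm) F"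
    by (subst integrable_distr_eq) (auto simp: density_1)
  also have "\<dots> \<longleftrightarrow> integrable lborel (\<lambda>\<rho>. (?s * \<rho> ^ (DIM('a) - 1) * indicator {0..} \<rho>) *\<^sub>R F \<rho>)"
    unfolding sphere_const_measure[OF homogeneous_1] using s
    by (subst integrable_density) (auto split: split_indicator)
  also have "(\<lambda>\<rho>. (?s * \<rho> ^ (DIM('a) - 1) * indicator {0..} \<rho>) *\<^sub>R F \<rho>) 
     = (\<lambda>\<rho>. complex_of_real ?s * (F \<rho> * complex_of_real (\<rho> ^ (DIM('a) - 1) * indicator {0..} \<rho>)))"
    by (auto simp: fun_eq_iff scaleR_conv_of_real)
  also have "integrable lborel \<dots> \<longleftrightarrow> integrable lborel (\<lambda>\<rho>. F \<rho> * complex_of_real (\<rho> ^ (DIM('a) - 1) * indicator {0..} \<rho>))"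
  proof
    assume "integrable lborel (\<lambda>\<rho>. complex_of_real ?s * (F \<rho> * complex_of_real (\<rho> ^ (DIM('a) - 1) * indicator {0..} \<rho>)))"
    then have "integrable lborel (\<lambda>\<rho>. inverse (complex_of_real ?s) * (complex_of_real ?s * (F \<rho> * complex_of_real (\<rho> ^ (DIM('a) - 1) * indicator {0..} \<rho>))))"
      by (rule integrable_mult_right)
    then show "integrable lborel (\<lambda>\<rho>. F \<rho> * complex_of_real (\<rho> ^ (DIM('a) - 1) * indicator {0..} \<rho>))"
      using s by (simp add: mult.assoc[symmetric])
  qed (rule integrable_mult_right)
  finally show ?thesis .
qed

lemma integral_radial_sin:
  fixes F :: "real \<Rightarrow> complex" and x :: "'a::euclidean_space"
  assumes [measurable]: "F \<in> borel_measurable borel"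
  shows "(\<integral>\<xi>. F (norm \<xi>) * complex_of_real (sin (x \<bullet> \<xi>)) \<partial>lborel) = 0"
proof -
  let ?I = "\<integral>\<xi>. F (norm \<xi>) * complex_of_real (sin (x \<bullet> \<xi>)) \<partial>lborel"
  have "?I = (\<integral>\<xi>. F (norm (0 - \<xi>)) * complex_of_real (sin (x \<bullet> (0 - \<xi>))) \<partial>lborel)"
    by (rule integral_lborel_reflect(1)[symmetric]) measurable
  also have "\<dots> = - ?I" by simp
  finally show ?thesis by simp
qed

text \<open>
  Expand the plane wave in powers of \<open>x \<bullet> \<xi>\<close>.  Odd powers drop out by reflection, and in the even ones the radial
  integral turns \<open>(x \<bullet> \<xi>)\<^sup>2\<^sup>k\<close> into its spherical average.  Bounded support makes the series absolutely convergent
  under the integral.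
\<close>
lemma fourier_radial:
  fixes F :: "real \<Rightarrow> complex" and x :: "'a::euclidean_space"
  assumes [measurable]: "F \<in> borel_measurable borel"
    and i: "integrable lborel (\<lambda>\<xi>::'a. F (norm \<xi>))" and supp: "\<And>\<rho>. \<rho> > R \<Longrightarrow> F \<rho> = 0" and R: "R \<ge> 0"
  shows "(\<integral>\<xi>. cis (x \<bullet> \<xi>) * F (norm \<xi>) \<partial>lborel)
     = complex_of_real (sphere_area TYPE('a)) * (\<integral>\<rho>. F \<rho> * complex_of_real (\<rho> ^ (DIM('a) - 1) * sphere_mean DIM('a) (\<rho> * norm x) * indicator {0..} \<rho>) \<partial>lborel)"
proof -
  let ?N = "DIM('a)"
  have N: "?N > 0" by (rule DIM_positive)
  note [measurable] = sphere_mean_measurable[OF N]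
  let ?Fr = "\<lambda>\<rho>. F \<rho> * complex_of_real (\<rho> ^ (?N - 1) * indicator {0..} \<rho>)"
  obtain e :: 'a where e: "norm e = 1" "x = norm x *\<^sub>R e"
  proof (cases "x = 0")
    case True
    obtain b :: 'a where "norm b = 1" using SOME_Basis norm_Basis by blast
    with True show thesis by (intro that[of b]) auto
  next
    case False
    then show thesis by (intro that[of "(1 / norm x) *\<^sub>R x"]) auto
  qed
  have xe: "(x \<bullet> \<xi>) ^ m = norm x ^ m * (e \<bullet> \<xi>) ^ m" for \<xi> m
    by (subst e(2)) (simp add: power_mult_distrib)
  have iR: "integrable lborel ?Fr" using i by (subst (asm) integrable_radial) auto
  let ?c = "\<lambda>k. (- 1) ^ k / fact (2 * k) :: real"
  define f where "f k \<xi> = F (norm \<xi>) * complex_of_real (?c k * (x \<bullet> \<xi>) ^ (2 * k))" for k \<xi>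
  define g where "g k \<rho> = ?Fr \<rho> * complex_of_real (bessel_coeff ?N k * ((\<rho> * norm x)\<^sup>2) ^ k)" for k \<rho>
  let ?M = "(R * norm x)\<^sup>2"
  have f_le: "norm (f k \<xi>) \<le> norm (F (norm \<xi>)) * (?M ^ k / fact (2 * k))" for k \<xi>
  proof (cases "norm \<xi> > R")
    case False
    have "\<bar>x \<bullet> \<xi>\<bar> \<le> norm x * norm \<xi>" by (rule Cauchy_Schwarz_ineq2)
    also have "\<dots> \<le> R * norm x" using False by (simp add: mult.commute mult_right_mono)
    finally have "\<bar>x \<bullet> \<xi>\<bar> ^ (2 * k) \<le> (R * norm x) ^ (2 * k)" by (intro power_mono) auto
    then have "\<bar>?c k * (x \<bullet> \<xi>) ^ (2 * k)\<bar> \<le> ?M ^ k / fact (2 * k)"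
      by (simp add: abs_mult power_abs power_mult divide_right_mono)
    then show ?thesis unfolding f_def by (simp only: norm_mult norm_of_real) (rule mult_left_mono, auto)
  qed (simp add: f_def supp)
  have g_le: "norm (g k \<rho>) \<le> norm (?Fr \<rho>) * (?M ^ k / fact (2 * k))" for k \<rho>
  proof (cases "\<rho> > R \<or> \<rho> < 0")
    case False
    then have le: "\<rho> * norm x \<le> R * norm x" and nonneg: "0 \<le> \<rho> * norm x"
      by (auto intro: mult_right_mono)
    have "((\<rho> * norm x)\<^sup>2) ^ k \<le> ?M ^ k"
      by (rule power_mono[OF power_mono[OF le nonneg] zero_le_power2])
    then have "\<bar>bessel_coeff ?N k * ((\<rho> * norm x)\<^sup>2) ^ k\<bar> \<le> (1 / fact (2 * k)) * ?M ^ k"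
      unfolding abs_mult using bessel_coeff_le[OF N, of k] by (intro mult_mono) auto
    then show ?thesis unfolding g_def by (simp only: norm_mult norm_of_real) (rule mult_left_mono, auto)
  qed (auto simp: g_def supp)
  note sm = summable_power_over_fact_double[of ?M]
  have fi: "integrable lborel (f k)" for k
  proof (rule Bochner_Integration.integrable_bound)
    show "integrable lborel (\<lambda>\<xi>::'a. F (norm \<xi>) * complex_of_real (?M ^ k / fact (2 * k)))" by (intro integrable_mult_left i)
    show "f k \<in> borel_measurable lborel" unfolding f_def by measurable
    show "AE \<xi> in lborel. norm (f k \<xi>) \<le> norm (F (norm \<xi>) * complex_of_real (?M ^ k / fact (2 * k)))"
      using f_le by (intro AE_I2) (simp only: norm_mult norm_of_real, simp add: abs_mult)
  qed
  have gi: "integrable lborel (g k)" for k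
  proof (rule Bochner_Integration.integrable_bound)
    show "integrable lborel (\<lambda>\<rho>. ?Fr \<rho> * complex_of_real (?M ^ k / fact (2 * k)))" by (intro integrable_mult_left iR)
    show "g k \<in> borel_measurable lborel" unfolding g_def by measurable
    show "AE \<rho> in lborel. norm (g k \<rho>) \<le> norm (?Fr \<rho> * complex_of_real (?M ^ k / fact (2 * k)))"
      using g_le by (intro AE_I2) (simp only: norm_mult norm_of_real, simp add: abs_mult)
  qed
  have fs: "(\<lambda>k. f k \<xi>) sums (F (norm \<xi>) * complex_of_real (cos (x \<bullet> \<xi>)))" for \<xi>
    unfolding f_def by (intro sums_mult sums_of_real cos_paired)
  have gs: "(\<lambda>k. g k \<rho>) sums (?Fr \<rho> * complex_of_real (sphere_mean ?N (\<rho> * norm x)))" for \<rho>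
    unfolding g_def sphere_mean_def by (intro sums_mult sums_of_real summable_sums summable_bessel N)
  have "(\<lambda>k. \<integral>\<xi>. f k \<xi> \<partial>lborel) sums (\<integral>\<xi>. (\<Sum>k. f k \<xi>) \<partial>lborel)"
  proof (rule sums_integral[OF fi])
    show "AE \<xi> in lborel. summable (\<lambda>k. norm (f k \<xi>))"
      by (intro AE_I2 summable_comparison_test'[OF summable_mult[OF sm], where N = 0]) (use f_le in auto)
    show "summable (\<lambda>k. \<integral>\<xi>. norm (f k \<xi>) \<partial>lborel)"
    proof (rule summable_comparison_test'[OF summable_mult[OF sm], where N = 0])
      fix k
      have "(\<integral>\<xi>. norm (f k \<xi>) \<partial>lborel) \<le> (\<integral>\<xi>. norm (F (norm \<xi>)) * (?M ^ k / fact (2 * k)) \<partial>(lborel::'a measure))"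
        by (intro integral_mono integrable_mult_left integrable_norm fi i f_le)
      then show "norm (\<integral>\<xi>. norm (f k \<xi>) \<partial>lborel) \<le> (\<integral>\<xi>. norm (F (norm \<xi>)) \<partial>(lborel::'a measure)) * (?M ^ k / fact (2 * k))"
        by (simp add: integral_nonneg_AE)
    qed
  qed
  then have S1: "(\<lambda>k. \<integral>\<xi>. f k \<xi> \<partial>lborel) sums (\<integral>\<xi>. F (norm \<xi>) * complex_of_real (cos (x \<bullet> \<xi>)) \<partial>lborel)"
    by (simp add: sums_unique[OF fs, symmetric])
  have "(\<lambda>k. \<integral>\<rho>. g k \<rho> \<partial>lborel) sums (\<integral>\<rho>. (\<Sum>k. g k \<rho>) \<partial>lborel)"
  proof (rule sums_integral[OF gi])
    show "AE \<rho> in lborel. summable (\<lambda>k. norm (g k \<rho>))"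
      by (intro AE_I2 summable_comparison_test'[OF summable_mult[OF sm], where N = 0]) (use g_le in auto)
    show "summable (\<lambda>k. \<integral>\<rho>. norm (g k \<rho>) \<partial>lborel)"
    proof (rule summable_comparison_test'[OF summable_mult[OF sm], where N = 0])
      fix k
      have "(\<integral>\<rho>. norm (g k \<rho>) \<partial>lborel) \<le> (\<integral>\<rho>. norm (?Fr \<rho>) * (?M ^ k / fact (2 * k)) \<partial>lborel)"
        using gi iR g_le by (intro integral_mono integrable_mult_left integrable_norm) auto
      also have "\<dots> = (\<integral>\<rho>. norm (?Fr \<rho>) \<partial>lborel) * (?M ^ k / fact (2 * k))" by (rule integral_mult_left_zero)
      finally show "norm (\<integral>\<rho>. norm (g k \<rho>) \<partial>lborel) \<le> (\<integral>\<rho>. norm (?Fr \<rho>) \<partial>lborel) * (?M ^ k / fact (2 * k))"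
        by (simp add: integral_nonneg_AE)
    qed
  qed
  then have S2: "(\<lambda>k. \<integral>\<rho>. g k \<rho> \<partial>lborel) sums (\<integral>\<rho>. ?Fr \<rho> * complex_of_real (sphere_mean ?N (\<rho> * norm x)) \<partial>lborel)"
    by (simp add: sums_unique[OF gs, symmetric])
  have fg: "(\<integral>\<xi>. f k \<xi> \<partial>lborel) = complex_of_real (sphere_area TYPE('a)) * (\<integral>\<rho>. g k \<rho> \<partial>lborel)" for k
  proof -
    have "(\<integral>\<xi>. f k \<xi> \<partial>lborel) = (\<integral>\<xi>. complex_of_real (?c k * norm x ^ (2 * k)) * (F (norm \<xi>) * complex_of_real ((e \<bullet> \<xi>) ^ (2 * k))) \<partial>lborel)"
      unfolding f_def xe by (intro Bochner_Integration.integral_cong refl) (simp add: mult_ac)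
    also have "\<dots> = complex_of_real (?c k * norm x ^ (2 * k)) * (\<integral>\<xi>. F (norm \<xi>) * complex_of_real ((e \<bullet> \<xi>) ^ (2 * k)) \<partial>lborel)"
      by (rule integral_mult_right_zero)
    also have "\<dots> = complex_of_real (?c k * norm x ^ (2 * k)) * (complex_of_real (sphere_area TYPE('a) * mean_power ?N k) * (\<integral>\<rho>. F \<rho> * complex_of_real (\<rho> ^ (?N + 2 * k - 1) * indicator {0..} \<rho>) \<partial>lborel))"
      by (subst integral_radial[OF homogeneous_inner_power]) (auto simp: sphere_const_inner_power[OF e(1)])
    also have "\<dots> = complex_of_real (sphere_area TYPE('a)) * (complex_of_real (?c k * norm x ^ (2 * k) * mean_power ?N k) * (\<integral>\<rho>. F \<rho> * complex_of_real (\<rho> ^ (?N + 2 * k - 1) * indicator {0..} \<rho>) \<partial>lborel))"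
      by (simp add: mult_ac)
    also have "complex_of_real (?c k * norm x ^ (2 * k) * mean_power ?N k) * (\<integral>\<rho>. F \<rho> * complex_of_real (\<rho> ^ (?N + 2 * k - 1) * indicator {0..} \<rho>) \<partial>lborel)
       = (\<integral>\<rho>. complex_of_real (?c k * norm x ^ (2 * k) * mean_power ?N k) * (F \<rho> * complex_of_real (\<rho> ^ (?N + 2 * k - 1) * indicator {0..} \<rho>)) \<partial>lborel)"
      by (rule integral_mult_right_zero[symmetric])
    also have "\<dots> = (\<integral>\<rho>. g k \<rho> \<partial>lborel)"
    proof (intro Bochner_Integration.integral_cong refl)
      fix \<rho> :: real
      have "\<rho> ^ (?N + 2 * k - 1) = \<rho> ^ (?N - 1) * (\<rho>\<^sup>2) ^ k"
        using N by (simp add: power_add[symmetric] power_mult[symmetric])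
      then have "?c k * norm x ^ (2 * k) * mean_power ?N k * (\<rho> ^ (?N + 2 * k - 1) * indicator {0..} \<rho>)
         = (\<rho> ^ (?N - 1) * indicator {0..} \<rho>) * (bessel_coeff ?N k * ((\<rho> * norm x)\<^sup>2) ^ k)"
        by (simp add: bessel_coeff_def power_mult power_mult_distrib)
      then have "complex_of_real (?c k * norm x ^ (2 * k) * mean_power ?N k) * complex_of_real (\<rho> ^ (?N + 2 * k - 1) * indicator {0..} \<rho>)
         = complex_of_real (\<rho> ^ (?N - 1) * indicator {0..} \<rho>) * complex_of_real (bessel_coeff ?N k * ((\<rho> * norm x)\<^sup>2) ^ k)"
        by (simp only: of_real_mult[symmetric])
      then show "complex_of_real (?c k * norm x ^ (2 * k) * mean_power ?N k) * (F \<rho> * complex_of_real (\<rho> ^ (?N + 2 * k - 1) * indicator {0..} \<rho>)) = g k \<rho>"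
        unfolding g_def by (simp only: mult.assoc mult.left_commute)
    qed
    finally show ?thesis .
  qed
  have "(\<integral>\<xi>. F (norm \<xi>) * complex_of_real (cos (x \<bullet> \<xi>)) \<partial>lborel)
     = complex_of_real (sphere_area TYPE('a)) * (\<integral>\<rho>. ?Fr \<rho> * complex_of_real (sphere_mean ?N (\<rho> * norm x)) \<partial>lborel)"
    using S1 sums_mult[OF S2, of "complex_of_real (sphere_area TYPE('a))"] unfolding fg by (rule sums_unique2)
  moreover have "(\<integral>\<xi>. cis (x \<bullet> \<xi>) * F (norm \<xi>) \<partial>lborel) 
     = (\<integral>\<xi>. F (norm \<xi>) * complex_of_real (cos (x \<bullet> \<xi>)) \<partial>lborel)"
  proof -
    have ic: "integrable lborel (\<lambda>\<xi>. F (norm \<xi>) * complex_of_real (cos (x \<bullet> \<xi>)))"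
      by (rule Bochner_Integration.integrable_bound[OF i]) (auto simp: norm_mult mult_left_le)
    have isn: "integrable lborel (\<lambda>\<xi>. \<i> * (F (norm \<xi>) * complex_of_real (sin (x \<bullet> \<xi>))))"
      by (rule Bochner_Integration.integrable_bound[OF i]) (auto simp: norm_mult mult_left_le)
    have "cis (x \<bullet> \<xi>) * F (norm \<xi>) = F (norm \<xi>) * complex_of_real (cos (x \<bullet> \<xi>)) + \<i> * (F (norm \<xi>) * complex_of_real (sin (x \<bullet> \<xi>)))" for \<xi>
      by (simp add: complex_eq_iff cis.ctr)
    then have "(\<integral>\<xi>. cis (x \<bullet> \<xi>) * F (norm \<xi>) \<partial>lborel) = (\<integral>\<xi>. F (norm \<xi>) * complex_of_real (cos (x \<bullet> \<xi>)) \<partial>lborel) + (\<integral>\<xi>. \<i> * (F (norm \<xi>) * complex_of_real (sin (x \<bullet> \<xi>))) \<partial>lborel)"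
      by (simp only: Bochner_Integration.integral_add[OF ic isn])
    also have "(\<integral>\<xi>. \<i> * (F (norm \<xi>) * complex_of_real (sin (x \<bullet> \<xi>))) \<partial>lborel) = \<i> * (\<integral>\<xi>. F (norm \<xi>) * complex_of_real (sin (x \<bullet> \<xi>)) \<partial>lborel)"
      by (rule integral_mult_right_zero)
    finally show ?thesis by (simp add: integral_radial_sin)
  qed
  ultimately show ?thesis by (simp add: mult_ac)
qed

lemma energy_tendsto_0_AE_subseq:
  assumes u: "\<And>k::nat. u k \<in> L2" and lim: "(\<lambda>k. energy (u k)) \<longlonglongrightarrow> 0"
  shows "\<exists>r::nat \<Rightarrow> nat. strict_mono r \<and> (AE x in lborel. (\<lambda>k. u (r k) x) \<longlonglongrightarrow> 0)"
proof -
  have i: "integrable lborel (\<lambda>x. (norm (u k x))\<^sup>2)" for k by (rule L2_square_integrable[OF u])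
  have e: "energy (u k) = ennreal (\<integral>x. norm ((norm (u k x))\<^sup>2) \<partial>lborel)" for k
    unfolding energy_def using nn_integral_eq_integral[OF i] by simp
  have "(\<lambda>k. \<integral>x. norm ((norm (u k x))\<^sup>2) \<partial>lborel) \<longlonglongrightarrow> 0"
    using lim unfolding e by (subst (asm) ennreal_tendsto_0_iff) (auto intro: integral_nonneg_AE)
  from tendsto_L1_AE_subseq[OF i this] obtain r :: "nat \<Rightarrow> nat" where r: "strict_mono r"
    and ae: "AE x in lborel. (\<lambda>k. (norm (u (r k) x))\<^sup>2) \<longlonglongrightarrow> 0" by blast
  from ae have "AE x in lborel. (\<lambda>k. u (r k) x) \<longlonglongrightarrow> 0"
  proof eventually_elim
    case (elim x)
    then have "(\<lambda>k. sqrt ((norm (u (r k) x))\<^sup>2)) \<longlonglongrightarrow> sqrt 0" by (rule tendsto_real_sqrt)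
    then show ?case by (simp add: tendsto_norm_zero_iff)
  qed
  with r show ?thesis by blast
qed

text \<open>
  The transforms of the truncations are explicit functions of the norm by \<open>fourier_radial\<close>; so is the limit
  of a subsequence that converges almost everywhere.
\<close>
lemma fourier_L2_radial:
  fixes \<phi> :: "real^'n \<Rightarrow> complex"
  assumes \<phi>: "\<phi> \<in> L2" and rad: "radially_symmetric \<phi>"
  obtains g :: "real \<Rightarrow> complex" where "g \<in> borel_measurable borel" "AE \<xi> in lborel. fourier_L2 \<phi> \<xi> = g (norm \<xi>)"
proof -
  obtain f :: "real \<Rightarrow> complex" where f [measurable]: "f \<in> borel_measurable borel" and eq: "AE x in lborel. \<phi> x = f (norm x)"
    using rad unfolding radially_symmetric_def by blast
  define \<psi> where "\<psi> = (\<lambda>x::real^'n. f (norm x))"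
  note [measurable] = L2_D[OF \<phi>]
  have [measurable]: "\<psi> \<in> borel_measurable borel" unfolding \<psi>_def by measurable
  have \<psi>: "\<psi> \<in> L2" using \<phi> energy_cong_AE[OF eq] unfolding L2_def \<psi>_def by auto
  have F\<psi>: "fourier_L2 \<phi> = fourier_L2 \<psi>" using eq by (intro fourier_L2_cong_AE) (auto simp: \<psi>_def)
  let ?N = "DIM(real^'n)"
  have N: "?N > 0" by (rule DIM_positive)
  note [measurable] = sphere_mean_measurable[OF N]
  define F where "F k \<rho> = indicator {..real k} \<rho> * f \<rho>" for k :: nat and \<rho>
  have [measurable]: "F k \<in> borel_measurable borel" for k unfolding F_def by measurable
  define G where "G k r = complex_of_real ((2 * pi) powr (- real CARD('n) / 2)) * (complex_of_real (sphere_area TYPE(real^'n)) *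
     (\<integral>\<rho>. F k \<rho> * complex_of_real (\<rho> ^ (?N - 1) * sphere_mean ?N (\<rho> * r) * indicator {0..} \<rho>) \<partial>lborel))" for k r
  have [measurable]: "G k \<in> borel_measurable borel" for k
    unfolding G_def by measurable
  have FG: "fourier (trunc (real k) \<psi>) \<xi> = G k (norm \<xi>)" for k \<xi>
  proof -
    have t: "trunc (real k) \<psi> = (\<lambda>x. F k (norm x))"
      by (auto simp: trunc_def \<psi>_def F_def fun_eq_iff split: split_indicator)
    have "integrable lborel (\<lambda>x::real^'n. F k (norm x))"
      using trunc_integrable[OF \<psi>, of "real k"] unfolding t .
    then have "(\<integral>x. cis ((- \<xi>) \<bullet> x) * F k (norm x) \<partial>lborel) = complex_of_real (sphere_area TYPE(real^'n)) *
      (\<integral>\<rho>. F k \<rho> * complex_of_real (\<rho> ^ (?N - 1) * sphere_mean ?N (\<rho> * norm (- \<xi>)) * indicator {0..} \<rho>) \<partial>lborel)"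
      by (intro fourier_radial[where R = "real k"]) (auto simp: F_def)
    then show ?thesis unfolding fourier_eq t G_def by simp
  qed
  have "(\<lambda>k. energy (\<lambda>\<xi>. fourier (trunc (real k) \<psi>) \<xi> - fourier_L2 \<psi> \<xi>)) \<longlonglongrightarrow> 0"
    by (rule filterlim_compose[OF fourier_L2_tendsto[OF \<psi>] filterlim_real_sequentially])
  from energy_tendsto_0_AE_subseq[OF L2_diff[OF fourier_trunc_L2(1)[OF \<psi>] fourier_L2_L2[OF \<psi>]] this]
  obtain r :: "nat \<Rightarrow> nat" where ae: "AE \<xi> in lborel. (\<lambda>k. fourier (trunc (real (r k)) \<psi>) \<xi> - fourier_L2 \<psi> \<xi>) \<longlonglongrightarrow> 0"
    by blast
  define g where "g \<rho> = lim (\<lambda>k. G (r k) \<rho>)" for \<rho>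
  show thesis
  proof
    show "g \<in> borel_measurable borel" unfolding g_def by measurable
    from ae show "AE \<xi> in lborel. fourier_L2 \<phi> \<xi> = g (norm \<xi>)"
    proof eventually_elim
      case (elim \<xi>)
      then have "(\<lambda>k. G (r k) (norm \<xi>)) \<longlonglongrightarrow> fourier_L2 \<psi> \<xi>"
        unfolding FG by (simp add: LIM_zero_iff)
      then show ?case unfolding F\<psi> g_def by (simp add: limI)
    qed
  qed
qed

section \<open>Powers of the norm and Schwartz functions\<close>

lemma has_integral_times_indicator:
  fixes f :: "real \<Rightarrow> real"
  assumes "(f has_integral c) S"
  shows "((\<lambda>x. f x * indicator S x) has_integral c) UNIV"
proof -
  have "(\<lambda>x. f x * indicator S x) = (\<lambda>x. if x \<in> S then f x else 0)" by (auto simp: fun_eq_iff)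
  with assms show ?thesis by (simp add: has_integral_restrict_UNIV)
qed

lemma nn_integral_powr_near_0:
  assumes a: "a > - real DIM('a::euclidean_space)"
  shows "(\<integral>\<^sup>+x. ennreal (norm x powr a) * indicator {x. norm x \<le> 1} x \<partial>(lborel::'a measure)) < \<infinity>"
proof -
  let ?N = "DIM('a)"
  have N: "?N > 0" by (rule DIM_positive)
  have b: "a + real ?N - 1 > -1" using a by simp
  have "((\<lambda>\<rho>. \<rho> powr (a + real ?N - 1)) has_integral 1 powr (a + real ?N - 1 + 1) / (a + real ?N - 1 + 1)) {0..1}"
    using b by (intro has_integral_powr_from_0) auto
  then have h: "((\<lambda>\<rho>. \<rho> powr (a + real ?N - 1) * indicator {0..1} \<rho>) has_integral 1 powr (a + real ?N - 1 + 1) / (a + real ?N - 1 + 1)) UNIV"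
    by (rule has_integral_times_indicator)
  have "(\<integral>\<^sup>+x. (ennreal (norm x powr a) * indicator {..1} (norm x)) * ennreal 1 \<partial>(lborel::'a measure))
    = ennreal (sphere_const (\<lambda>_::'a. 1) 0) * (\<integral>\<^sup>+\<rho>. (ennreal (\<rho> powr a) * indicator {..1} \<rho>) * ennreal (\<rho> ^ (?N + 0 - 1)) * indicator {0..} \<rho> \<partial>lborel)"
    by (rule nn_integral_radial[OF homogeneous_1]) measurable
  also have "(\<integral>\<^sup>+\<rho>. (ennreal (\<rho> powr a) * indicator {..1} \<rho>) * ennreal (\<rho> ^ (?N + 0 - 1)) * indicator {0..} \<rho> \<partial>lborel)
     = (\<integral>\<^sup>+\<rho>. ennreal (\<rho> powr (a + real ?N - 1) * indicator {0..1} \<rho>) \<partial>lborel)"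
  proof (intro nn_integral_cong)
    fix \<rho> :: real
    show "(ennreal (\<rho> powr a) * indicator {..1} \<rho>) * ennreal (\<rho> ^ (?N + 0 - 1)) * indicator {0..} \<rho> = ennreal (\<rho> powr (a + real ?N - 1) * indicator {0..1} \<rho>)"
    proof (cases "\<rho> > 0")
      case True
      have "\<rho> powr (a + real ?N - 1) = \<rho> powr a * \<rho> ^ (?N - 1)"
        using True N by (simp add: powr_realpow[symmetric] powr_add[symmetric] of_nat_diff algebra_simps)
      then show ?thesis using True by (auto simp: ennreal_mult split: split_indicator)
    qed (cases "\<rho> = 0", auto)
  qed
  also have "\<dots> = ennreal (1 powr (a + real ?N - 1 + 1) / (a + real ?N - 1 + 1))"
    using h by (intro nn_integral_has_integral_lborel) (auto split: split_indicator)
  also have "ennreal (sphere_const (\<lambda>_::'a. 1) 0) * \<dots> < \<infinity>" by (simp add: ennreal_mult_less_top)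
  finally show ?thesis by (simp add: indicator_def)
qed

lemma nn_integral_powr_far:
  assumes a: "a < - real DIM('a::euclidean_space)"
  shows "(\<integral>\<^sup>+x. ennreal (norm x powr a) * indicator {x. 1 \<le> norm x} x \<partial>(lborel::'a measure)) < \<infinity>"
proof -
  let ?N = "DIM('a)"
  have N: "?N > 0" by (rule DIM_positive)
  have b: "a + real ?N - 1 < -1" using a by simp
  have "((\<lambda>\<rho>. \<rho> powr (a + real ?N - 1)) has_integral - (1 powr (a + real ?N - 1 + 1)) / (a + real ?N - 1 + 1)) {1..}"
    using b by (intro has_integral_powr_to_inf) auto
  then have h: "((\<lambda>\<rho>. \<rho> powr (a + real ?N - 1) * indicator {1..} \<rho>) has_integral - (1 powr (a + real ?N - 1 + 1)) / (a + real ?N - 1 + 1)) UNIV"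
    by (rule has_integral_times_indicator)
  have "(\<integral>\<^sup>+x. (ennreal (norm x powr a) * indicator {1..} (norm x)) * ennreal 1 \<partial>(lborel::'a measure))
    = ennreal (sphere_const (\<lambda>_::'a. 1) 0) * (\<integral>\<^sup>+\<rho>. (ennreal (\<rho> powr a) * indicator {1..} \<rho>) * ennreal (\<rho> ^ (?N + 0 - 1)) * indicator {0..} \<rho> \<partial>lborel)"
    by (rule nn_integral_radial[OF homogeneous_1]) measurable
  also have "(\<integral>\<^sup>+\<rho>. (ennreal (\<rho> powr a) * indicator {1..} \<rho>) * ennreal (\<rho> ^ (?N + 0 - 1)) * indicator {0..} \<rho> \<partial>lborel)
     = (\<integral>\<^sup>+\<rho>. ennreal (\<rho> powr (a + real ?N - 1) * indicator {1..} \<rho>) \<partial>lborel)"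
  proof (intro nn_integral_cong)
    fix \<rho> :: real
    show "(ennreal (\<rho> powr a) * indicator {1..} \<rho>) * ennreal (\<rho> ^ (?N + 0 - 1)) * indicator {0..} \<rho> = ennreal (\<rho> powr (a + real ?N - 1) * indicator {1..} \<rho>)"
    proof (cases "\<rho> \<ge> 1")
      case True
      have "\<rho> powr (a + real ?N - 1) = \<rho> powr a * \<rho> ^ (?N - 1)"
        using True N by (simp add: powr_realpow[symmetric] powr_add[symmetric] of_nat_diff algebra_simps)
      then show ?thesis using True by (auto simp: ennreal_mult split: split_indicator)
    qed auto
  qed
  also have "\<dots> = ennreal (- (1 powr (a + real ?N - 1 + 1)) / (a + real ?N - 1 + 1))"
    using h by (intro nn_integral_has_integral_lborel) (auto split: split_indicator)
  also have "ennreal (sphere_const (\<lambda>_::'a. 1) 0) * \<dots> < \<infinity>" by (simp add: ennreal_mult_less_top)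
  finally show ?thesis by (simp add: indicator_def)
qed

text \<open>
  The form in which integrability is checked below: one power governs the unit ball, the other one its
  complement.
\<close>
lemma nn_integral_two_powers:
  assumes a: "a > - real DIM('a::euclidean_space)" and b: "b < - real DIM('a)"
    and [measurable]: "f \<in> borel_measurable borel"
    and near: "\<And>x::'a. norm x \<le> 1 \<Longrightarrow> x \<noteq> 0 \<Longrightarrow> f x \<le> C * norm x powr a" 
    and far: "\<And>x::'a. norm x \<ge> 1 \<Longrightarrow> f x \<le> C * norm x powr b"
    and C: "C \<ge> 0"
  shows "(\<integral>\<^sup>+x. ennreal (f x) \<partial>(lborel::'a measure)) < \<infinity>"
proof -
  have "(\<integral>\<^sup>+x. ennreal (f x) \<partial>(lborel::'a measure)) \<le> 
     (\<integral>\<^sup>+x. ennreal C * (ennreal (norm x powr a) * indicator {x. norm x \<le> 1} x) + ennreal C * (ennreal (norm x powr b) * indicator {x. 1 \<le> norm x} x) \<partial>(lborel::'a measure))"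
  proof (rule nn_integral_mono_AE)
    have "AE x in lborel. x \<noteq> (0::'a)" by (rule AE_lborel_singleton)
    then show "AE x in lborel. ennreal (f x) \<le> ennreal C * (ennreal (norm x powr a) * indicator {x. norm x \<le> 1} x) + ennreal C * (ennreal (norm x powr b) * indicator {x. 1 \<le> norm x} x)"
    proof eventually_elim
      case (elim x)
      show ?case
      proof (cases "norm x \<le> 1")
        case True
        then have "ennreal (f x) \<le> ennreal (C * norm x powr a)" using near elim by (intro ennreal_leI) auto
        also have "\<dots> = ennreal C * (ennreal (norm x powr a) * indicator {x. norm x \<le> 1} x)"
          using True C by (simp add: ennreal_mult)
        finally show ?thesis by (rule order_trans) simp
      next
        case False
        then have "ennreal (f x) \<le> ennreal (C * norm x powr b)" using far by (intro ennreal_leI) auto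
        also have "\<dots> = ennreal C * (ennreal (norm x powr b) * indicator {x. 1 \<le> norm x} x)"
          using False C by (simp add: ennreal_mult)
        finally show ?thesis by (rule order_trans) simp
      qed
    qed
  qed
  also have "\<dots> = ennreal C * (\<integral>\<^sup>+x. ennreal (norm x powr a) * indicator {x. norm x \<le> 1} x \<partial>(lborel::'a measure)) 
     + ennreal C * (\<integral>\<^sup>+x. ennreal (norm x powr b) * indicator {x. 1 \<le> norm x} x \<partial>(lborel::'a measure))"
    by (subst nn_integral_add) (auto simp: nn_integral_cmult)
  also have "\<dots> < \<infinity>"
    using nn_integral_powr_near_0[OF a] nn_integral_powr_far[OF b] by (simp add: ennreal_mult_less_top)
  finally show ?thesis .
qed

lemma schwartz_D:
  fixes \<psi> :: "real^'n \<Rightarrow> complex"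
  assumes "\<psi> \<in> schwartz"
  shows schwartz_differentiable: "partial_derivs is \<psi> differentiable (at x)"
    and schwartz_continuous: "continuous_on UNIV (partial_derivs is \<psi>)"
    and schwartz_decay: "\<exists>C\<ge>0. \<forall>x. norm (partial_derivs is \<psi> x) \<le> C * (1 + norm x) powr (- real k)"
proof -
  have d: "partial_derivs is \<psi> differentiable_on UNIV" and b: "bounded (range (\<lambda>x. (1 + norm x) ^ k * norm (partial_derivs is \<psi> x)))"
    using assms unfolding schwartz_def by auto
  from d show "partial_derivs is \<psi> differentiable (at x)" by (simp add: differentiable_on_def)
  from d show "continuous_on UNIV (partial_derivs is \<psi>)" by (rule differentiable_imp_continuous_on)
  from b obtain C where C: "\<And>x. norm ((1 + norm x) ^ k * norm (partial_derivs is \<psi> x)) \<le> C"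
    unfolding bounded_iff by blast
  have "norm (partial_derivs is \<psi> x) \<le> C * (1 + norm x) powr (- real k)" for x
  proof -
    have p: "1 + norm x > 0" by (simp add: add_pos_nonneg)
    have "(1 + norm x) ^ k * norm (partial_derivs is \<psi> x) \<le> C" using C[of x] by simp
    then have "norm (partial_derivs is \<psi> x) \<le> C / (1 + norm x) ^ k" using p by (simp add: field_simps)
    also have "\<dots> = C * (1 + norm x) powr (- real k)"
      using p by (simp add: powr_minus_divide powr_realpow)
    finally show ?thesis .
  qed
  moreover have "C \<ge> 0" using C[of 0] norm_ge_zero order_trans by blast
  ultimately show "\<exists>C\<ge>0. \<forall>x. norm (partial_derivs is \<psi> x) \<le> C * (1 + norm x) powr (- real k)" by blast
qed

lemma nn_integral_poly_decay:
  assumes k: "real k > real DIM('a::euclidean_space)"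
  shows "(\<integral>\<^sup>+x. ennreal ((1 + norm x) powr (- real k)) \<partial>(lborel::'a measure)) < \<infinity>"
proof (rule nn_integral_two_powers[where a = 0 and b = "- real k" and C = 1])
  fix x :: 'a assume "x \<noteq> 0"
  then show "(1 + norm x) powr (- real k) \<le> 1 * norm x powr 0"
    using powr_mono[of "- real k" 0 "1 + norm x"] by (simp split: if_splits)
next
  fix x :: 'a assume "1 \<le> norm x"
  then show "(1 + norm x) powr (- real k) \<le> 1 * norm x powr (- real k)"
    by (simp, intro powr_mono2') auto
qed (use k in auto)

lemma poly_decay_L1_L2:
  fixes f :: "'a::euclidean_space \<Rightarrow> complex"
  assumes [measurable]: "f \<in> borel_measurable borel"
    and k: "real k > real DIM('a)" and le: "\<And>x. norm (f x) \<le> C * (1 + norm x) powr (- real k)"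
  shows "integrable lborel f" "f \<in> L2" 
    "energy f \<le> ennreal (C\<^sup>2) * (\<integral>\<^sup>+x. ennreal ((1 + norm x) powr (- real k)) \<partial>(lborel::'a measure))"
proof -
  let ?I = "\<integral>\<^sup>+x. ennreal ((1 + norm x) powr (- real k)) \<partial>(lborel::'a measure)"
  have I: "?I < \<infinity>" by (rule nn_integral_poly_decay[OF k])
  have p1: "(1 + norm x) powr (- real k) \<le> 1" for x :: 'a
    using powr_mono[of "- real k" 0 "1 + norm x"] by (simp split: if_splits)
  have C: "C \<ge> 0" using order_trans[OF norm_ge_zero le[of 0]] by simp
  show "integrable lborel f"
  proof (rule integrableI_bounded)
    have "(\<integral>\<^sup>+x. ennreal (norm (f x)) \<partial>lborel) \<le> (\<integral>\<^sup>+x. ennreal C * ennreal ((1 + norm x) powr (- real k)) \<partial>(lborel::'a measure))"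
      using le C by (intro nn_integral_mono) (simp flip: ennreal_mult)
    also have "\<dots> = ennreal C * ?I" by (rule nn_integral_cmult) measurable
    also have "\<dots> < \<infinity>" using I by (simp add: ennreal_mult_less_top)
    finally show "(\<integral>\<^sup>+x. ennreal (norm (f x)) \<partial>lborel) < \<infinity>" .
  qed simp
  have "energy f \<le> (\<integral>\<^sup>+x. ennreal (C\<^sup>2) * ennreal ((1 + norm x) powr (- real k)) \<partial>(lborel::'a measure))"
    unfolding energy_def
  proof (rule nn_integral_mono)
    fix x :: 'a
    have "(norm (f x))\<^sup>2 \<le> (C * (1 + norm x) powr (- real k))\<^sup>2" by (intro power_mono le norm_ge_zero)
    also have "\<dots> = C\<^sup>2 * ((1 + norm x) powr (- real k) * (1 + norm x) powr (- real k))" by (simp add: power2_eq_square)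
    also have "\<dots> \<le> C\<^sup>2 * (1 * (1 + norm x) powr (- real k))" by (intro mult_left_mono mult_right_mono p1) auto
    finally show "ennreal ((norm (f x))\<^sup>2) \<le> ennreal (C\<^sup>2) * ennreal ((1 + norm x) powr (- real k))"
      by (simp flip: ennreal_mult)
  qed
  also have "\<dots> = ennreal (C\<^sup>2) * ?I" by (rule nn_integral_cmult) measurable
  finally show E: "energy f \<le> ennreal (C\<^sup>2) * ?I" .
  also have "\<dots> < \<infinity>" using I by (simp add: ennreal_mult_less_top)
  finally show "f \<in> L2" by (simp add: L2_def)
qed

lemma schwartz_L1_L2:
  fixes \<psi> :: "real^'n \<Rightarrow> complex"
  assumes \<psi>: "\<psi> \<in> schwartz"
  shows "\<psi> \<in> borel_measurable borel" "integrable lborel \<psi>" "\<psi> \<in> L2"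
proof -
  show [measurable]: "\<psi> \<in> borel_measurable borel"
    using schwartz_continuous[OF \<psi>, of "[]"] by (simp add: borel_measurable_continuous_onI)
  obtain C where C: "\<And>x. norm (\<psi> x) \<le> C * (1 + norm x) powr (- real (Suc DIM(real^'n)))"
    using schwartz_decay[OF \<psi>, of "[]" "Suc DIM(real^'n)"] by auto
  show "integrable lborel \<psi>" "\<psi> \<in> L2" by (rule poly_decay_L1_L2[OF _ _ C]; simp)+
qed

lemma schwartz_difference_quotient:
  fixes \<psi> :: "real^'n \<Rightarrow> complex"
  assumes \<psi>: "\<psi> \<in> schwartz"
  shows "\<exists>C. \<forall>x. \<forall>h. 0 < h \<and> h \<le> 1 \<longrightarrow> norm ((\<psi> (x + h *\<^sub>R axis i 1) - \<psi> x) / complex_of_real h) \<le> C * (1 + norm x) powr (- real k)"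
proof -
  let ?e = "axis i 1 :: real^'n"
  obtain C where C: "C \<ge> 0" "\<And>x. norm (partial_derivs [i] \<psi> x) \<le> C * (1 + norm x) powr (- real k)"
    using schwartz_decay[OF \<psi>, of "[i]" k] by blast
  have "norm ((\<psi> (x + h *\<^sub>R ?e) - \<psi> x) / complex_of_real h) \<le> (C * 2 ^ k) * (1 + norm x) powr (- real k)"
    if h: "0 < h" "h \<le> 1" for x h
  proof -
    let ?B = "C * 2 ^ k * (1 + norm x) powr (- real k)"
    define g where "g t = \<psi> (x + t *\<^sub>R ?e)" for t
    have "norm (g h - g 0) \<le> ?B * norm (h - 0)"
    proof (rule differentiable_bound)
      show "convex {0..h}" by simp
      fix t assume t: "t \<in> {0..h}"
      let ?y = "x + t *\<^sub>R ?e"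
      have d: "(\<psi> has_derivative frechet_derivative \<psi> (at ?y)) (at ?y)"
        using schwartz_differentiable[OF \<psi>, of "[]"] by (simp add: frechet_derivative_works[symmetric])
      have lin: "linear (frechet_derivative \<psi> (at ?y))" using d by (rule has_derivative_linear)
      have "(g has_derivative (\<lambda>s. frechet_derivative \<psi> (at ?y) (s *\<^sub>R ?e))) (at t)"
        unfolding g_def[abs_def]
      proof -
        have "((\<lambda>t. x + t *\<^sub>R ?e) has_derivative (\<lambda>s. s *\<^sub>R ?e)) (at t)"
          by (auto intro!: derivative_eq_intros)
        from has_derivative_compose[where g = \<psi>, OF this d]
        show "((\<lambda>t. \<psi> (x + t *\<^sub>R ?e)) has_derivative (\<lambda>s. frechet_derivative \<psi> (at ?y) (s *\<^sub>R ?e))) (at t)" .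
      qed
      then show "(g has_derivative (\<lambda>s. s *\<^sub>R partial_derivs [i] \<psi> ?y)) (at t within {0..h})"
        by (simp add: linear_scale[OF lin] has_derivative_at_withinI)
      have "norm x \<le> norm ?y + norm (t *\<^sub>R ?e)"
        using norm_triangle_ineq4[of ?y "t *\<^sub>R ?e"] by simp
      moreover have "norm (t *\<^sub>R ?e) \<le> 1" using t h by simp
      moreover have "a \<le> b + c \<Longrightarrow> c \<le> 1 \<Longrightarrow> 0 \<le> b \<Longrightarrow> 1 + a \<le> 2 * (1 + b)" for a b c :: real
        by argo
      ultimately have "1 + norm x \<le> 2 * (1 + norm ?y)" using norm_ge_zero[of ?y] by blast
      then have "(2 * (1 + norm ?y)) powr (- real k) \<le> (1 + norm x) powr (- real k)"
        by (intro powr_mono2') (auto simp: add_pos_nonneg)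
      moreover have "(2 * (1 + norm ?y)) powr (- real k) = (1 + norm ?y) powr (- real k) / 2 ^ k"
        by (subst powr_mult) (auto simp: powr_minus_divide powr_realpow)
      ultimately have "(1 + norm ?y) powr (- real k) / 2 ^ k \<le> (1 + norm x) powr (- real k)" by (simp only:)
      then have "(1 + norm ?y) powr (- real k) \<le> 2 ^ k * (1 + norm x) powr (- real k)" by (simp add: field_simps)
      then have "norm (partial_derivs [i] \<psi> ?y) \<le> C * (2 ^ k * (1 + norm x) powr (- real k))"
        using C(2)[of ?y] C(1) by (meson mult_left_mono order_trans)
      then have v: "norm (partial_derivs [i] \<psi> ?y) \<le> ?B" by (simp add: mult.assoc)
      show "onorm (\<lambda>s. s *\<^sub>R partial_derivs [i] \<psi> ?y) \<le> ?B"
      proof (rule onorm_le)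
        fix s :: real
        show "norm (s *\<^sub>R partial_derivs [i] \<psi> ?y) \<le> ?B * norm s"
          using mult_left_mono[OF v, of "\<bar>s\<bar>"] by (simp add: mult.commute)
      qed
    qed (use h in auto)
    then have "norm (\<psi> (x + h *\<^sub>R ?e) - \<psi> x) \<le> ?B * h" using h by (simp add: g_def)
    then show ?thesis using h by (simp add: norm_divide field_simps)
  qed
  then show ?thesis by blast
qed

lemma fourier_translate:
  fixes f :: "real^'n \<Rightarrow> complex"
  assumes [measurable]: "f \<in> borel_measurable borel"
  shows "fourier (\<lambda>x. f (x + a)) \<xi> = cis (\<xi> \<bullet> a) * fourier f \<xi>"
proof -
  let ?g = "\<lambda>x. cis (- (\<xi> \<bullet> (x - a))) * f x"
  have "(\<integral>x. cis (- (\<xi> \<bullet> x)) * f (x + a) \<partial>lborel) = (\<integral>x. ?g (a + x) \<partial>lborel)"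
    by (simp add: add.commute)
  also have "\<dots> = (\<integral>x. ?g x \<partial>(distr lborel borel ((+) a)))"
    by (subst integral_distr) auto
  also have "\<dots> = (\<integral>x. ?g x \<partial>lborel)" by (simp only: lborel_distr_plus)
  also have "\<dots> = (\<integral>x. cis (\<xi> \<bullet> a) * (cis (- (\<xi> \<bullet> x)) * f x) \<partial>lborel)"
    by (intro Bochner_Integration.integral_cong refl) (simp add: inner_diff_right cis_mult mult.assoc[symmetric])
  also have "\<dots> = cis (\<xi> \<bullet> a) * (\<integral>x. cis (- (\<xi> \<bullet> x)) * f x \<partial>lborel)"
    by (rule integral_mult_right_zero)
  finally show ?thesis by (simp add: fourier_eq)
qed

lemma integrable_translate:
  fixes f :: "'a::euclidean_space \<Rightarrow> complex"
  assumes f: "integrable lborel f"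
  shows "integrable lborel (\<lambda>x. f (x + a))"
proof -
  have [measurable]: "f \<in> borel_measurable borel" using f by auto
  have "integrable (distr lborel borel ((+) a)) f" using f by (simp only: lborel_distr_plus)
  then show ?thesis by (subst (asm) integrable_distr_eq) (auto simp: add.commute)
qed

text \<open>
  The difference quotients of \<open>\<psi>\<close> are bounded in mean square, and their transforms converge pointwise to
  \<open>\<i> \<xi>\<^sub>i\<close> times the transform of \<open>\<psi>\<close>; Bessel and Fatou conclude.
\<close>
lemma schwartz_fourier_component:
  fixes \<psi> :: "real^'n \<Rightarrow> complex"
  assumes \<psi>: "\<psi> \<in> schwartz"
  shows "energy (\<lambda>\<xi>. complex_of_real (\<xi> $ i) * fourier \<psi> \<xi>) < \<infinity>"
proof -
  let ?k = "Suc DIM(real^'n)" and ?e = "axis i 1 :: real^'n"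
  note [measurable] = schwartz_L1_L2(1)[OF \<psi>]
  obtain C where C: "\<And>x h. 0 < h \<Longrightarrow> h \<le> 1 \<Longrightarrow> norm ((\<psi> (x + h *\<^sub>R ?e) - \<psi> x) / complex_of_real h) \<le> C * (1 + norm x) powr (- real ?k)"
    using schwartz_difference_quotient[OF \<psi>, of i ?k] by blast
  define h where "h m = 1 / real (Suc m)" for m
  have h: "0 < h m" "h m \<le> 1" for m by (auto simp: h_def)
  define Q where "Q m x = (\<psi> (x + h m *\<^sub>R ?e) - \<psi> x) / complex_of_real (h m)" for m x
  have Qm [measurable]: "Q m \<in> borel_measurable borel" for m unfolding Q_def by measurable
  have Q: "norm (Q m x) \<le> C * (1 + norm x) powr (- real ?k)" for m x unfolding Q_def by (rule C[OF h])
  have k: "real ?k > real DIM(real^'n)" by simp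
  let ?B = "ennreal (C\<^sup>2) * (\<integral>\<^sup>+x. ennreal ((1 + norm x) powr (- real ?k)) \<partial>(lborel::(real^'n) measure))"
  have B: "?B < \<infinity>" using nn_integral_poly_decay[OF k] by (simp add: ennreal_mult_less_top)
  have FQ: "fourier (Q m) \<xi> = (cis (h m * (\<xi> $ i)) - 1) / complex_of_real (h m) * fourier \<psi> \<xi>" for m \<xi>
  proof -
    note i = schwartz_L1_L2(2)[OF \<psi>]
    have "fourier (Q m) \<xi> = fourier (\<lambda>x. \<psi> (x + h m *\<^sub>R ?e) - \<psi> x) \<xi> / complex_of_real (h m)"
      unfolding fourier_eq Q_def by simp
    also have "fourier (\<lambda>x. \<psi> (x + h m *\<^sub>R ?e) - \<psi> x) \<xi> = cis (\<xi> \<bullet> (h m *\<^sub>R ?e)) * fourier \<psi> \<xi> - fourier \<psi> \<xi>"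
      by (subst fourier_diff) (auto simp: fourier_translate integrable_translate i)
    finally show ?thesis by (simp add: inner_axis field_simps)
  qed
  have lim: "(\<lambda>m. (cis (h m * y) - 1) / complex_of_real (h m)) \<longlonglongrightarrow> \<i> * complex_of_real y" for y
  proof -
    have "((\<lambda>z::complex. exp (\<i> * complex_of_real y * z)) has_field_derivative (\<i> * complex_of_real y)) (at 0)"
      by (auto intro!: derivative_eq_intros)
    then have d: "((\<lambda>z. (exp (\<i> * complex_of_real y * (0 + z)) - exp (\<i> * complex_of_real y * 0)) / z) \<longlongrightarrow> \<i> * complex_of_real y) (at 0)"
      unfolding DERIV_def .
    have "h \<longlonglongrightarrow> 0" unfolding h_def by (rule LIMSEQ_Suc[OF lim_1_over_n])
    then have "(\<lambda>m. complex_of_real (h m)) \<longlonglongrightarrow> complex_of_real 0" by (intro tendsto_of_real)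
    then have "filterlim (\<lambda>m. complex_of_real (h m)) (at 0) sequentially"
      using h by (intro filterlim_atI) (auto simp: less_imp_neq[symmetric])
    from filterlim_compose[OF d this] show ?thesis
      by (simp add: cis_conv_exp mult_ac)
  qed
  have "energy (\<lambda>\<xi>. \<i> * complex_of_real (\<xi> $ i) * fourier \<psi> \<xi>) \<le> liminf (\<lambda>m. energy (fourier (Q m)))"
    unfolding FQ[abs_def] by (intro energy_Fatou AE_I2 tendsto_mult lim tendsto_const) measurable
  also have "\<dots> \<le> liminf (\<lambda>m. ?B)"
    by (intro Liminf_mono always_eventually allI order_trans[OF energy_fourier_le] poly_decay_L1_L2[OF Qm k Q])
  also have "\<dots> = ?B" by (simp add: Liminf_const)
  finally have "energy (\<lambda>\<xi>. \<i> * complex_of_real (\<xi> $ i) * fourier \<psi> \<xi>) < \<infinity>" using B by (rule le_less_trans)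
  then show ?thesis unfolding energy_def by (simp add: norm_mult)
qed

lemma schwartz_fourier_weighted:
  fixes \<psi> :: "real^'n \<Rightarrow> complex"
  assumes \<psi>: "\<psi> \<in> schwartz"
  shows "(\<lambda>\<xi>. complex_of_real (norm \<xi>) * fourier \<psi> \<xi>) \<in> L2"
proof -
  note [measurable] = schwartz_L1_L2(1)[OF \<psi>]
  have "energy (\<lambda>\<xi>. complex_of_real (norm \<xi>) * fourier \<psi> \<xi>) = (\<integral>\<^sup>+\<xi>. (\<Sum>i\<in>UNIV. ennreal ((norm (complex_of_real (\<xi> $ i) * fourier \<psi> \<xi>))\<^sup>2)) \<partial>lborel)"
    unfolding energy_def
  proof (rule nn_integral_cong)
    fix \<xi> :: "real^'n"
    have "(norm \<xi>)\<^sup>2 = (\<Sum>i\<in>UNIV. (\<xi> $ i)\<^sup>2)"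
      unfolding power2_norm_eq_inner inner_vec_def by (simp add: power2_eq_square)
    then have "(norm (complex_of_real (norm \<xi>) * fourier \<psi> \<xi>))\<^sup>2 = (\<Sum>i\<in>UNIV. (norm (complex_of_real (\<xi> $ i) * fourier \<psi> \<xi>))\<^sup>2)"
      by (simp add: norm_mult power_mult_distrib sum_distrib_right)
    then show "ennreal ((norm (complex_of_real (norm \<xi>) * fourier \<psi> \<xi>))\<^sup>2) = (\<Sum>i\<in>UNIV. ennreal ((norm (complex_of_real (\<xi> $ i) * fourier \<psi> \<xi>))\<^sup>2))"
      by (simp only: sum_ennreal[OF zero_le_power2])
  qed
  also have "\<dots> = (\<Sum>i\<in>UNIV. energy (\<lambda>\<xi>. complex_of_real (\<xi> $ i) * fourier \<psi> \<xi>))"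
    unfolding energy_def by (rule nn_integral_sum) measurable
  also have "\<dots> < \<infinity>" using schwartz_fourier_component[OF \<psi>] by simp
  finally show ?thesis by (simp add: L2_def)
qed

text \<open>
  The pairing that defines \<open>abs_D\<close> converges absolutely because of this: near the origin the transform is
  bounded and \<open>\<bar>\<xi>\<bar> powr s\<close> is square-integrable, and outside the unit ball \<open>\<bar>\<xi>\<bar> powr s \<le> \<bar>\<xi>\<bar>\<close>.
\<close>
lemma schwartz_fourier_powr_L2:
  fixes \<psi> :: "real^'n \<Rightarrow> complex"
  assumes \<psi>: "\<psi> \<in> schwartz" and s: "- real CARD('n) / 2 < s" "s \<le> 1"
  shows "(\<lambda>\<xi>. complex_of_real (norm \<xi> powr s) * fourier \<psi> \<xi>) \<in> L2"
proof -
  note [measurable] = schwartz_L1_L2(1)[OF \<psi>]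
  define M where "M = (2 * pi) powr (- real CARD('n) / 2) * (\<integral>x. norm (\<psi> x) \<partial>lborel)"
  have M: "norm (fourier \<psi> \<xi>) \<le> M" for \<xi>
  proof -
    have "norm (\<integral>x. cis (- (\<xi> \<bullet> x)) * \<psi> x \<partial>lborel) \<le> (\<integral>x. norm (cis (- (\<xi> \<bullet> x)) * \<psi> x) \<partial>lborel)" by (rule integral_norm_bound)
    then have "norm (\<integral>x. cis (- (\<xi> \<bullet> x)) * \<psi> x \<partial>lborel) \<le> (\<integral>x. norm (\<psi> x) \<partial>lborel)" by (simp add: norm_mult)
    then have "(2 * pi) powr (- real CARD('n) / 2) * norm (\<integral>x. cis (- (\<xi> \<bullet> x)) * \<psi> x \<partial>lborel) \<le> M"
      unfolding M_def by (rule mult_left_mono) simp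
    then show ?thesis unfolding fourier_eq norm_mult norm_of_real by simp
  qed
  have "energy (\<lambda>\<xi>. complex_of_real (norm \<xi> powr s) * fourier \<psi> \<xi>) \<le> 
    (\<integral>\<^sup>+\<xi>. ennreal (M\<^sup>2) * (ennreal (norm \<xi> powr (2 * s)) * indicator {\<xi>. norm \<xi> \<le> 1} \<xi>) + ennreal ((norm (complex_of_real (norm \<xi>) * fourier \<psi> \<xi>))\<^sup>2) \<partial>(lborel::(real^'n) measure))"
    unfolding energy_def
  proof (rule nn_integral_mono)
    fix \<xi> :: "real^'n"
    have e: "(norm (complex_of_real (norm \<xi> powr s) * fourier \<psi> \<xi>))\<^sup>2 = norm \<xi> powr (2 * s) * (norm (fourier \<psi> \<xi>))\<^sup>2"
    proof -
      have sq: "(norm \<xi> powr s)\<^sup>2 = norm \<xi> powr (2 * s)"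
        unfolding power2_eq_square mult_2 by (rule powr_add[symmetric])
      show ?thesis by (simp add: norm_mult power_mult_distrib sq)
    qed
    show "ennreal ((norm (complex_of_real (norm \<xi> powr s) * fourier \<psi> \<xi>))\<^sup>2) \<le> ennreal (M\<^sup>2) * (ennreal (norm \<xi> powr (2 * s)) * indicator {\<xi>. norm \<xi> \<le> 1} \<xi>) + ennreal ((norm (complex_of_real (norm \<xi>) * fourier \<psi> \<xi>))\<^sup>2)"
    proof (cases "norm \<xi> \<le> 1")
      case True
      have "norm \<xi> powr (2 * s) * (norm (fourier \<psi> \<xi>))\<^sup>2 \<le> norm \<xi> powr (2 * s) * M\<^sup>2"
        by (intro mult_left_mono power_mono M) auto
      then have "ennreal (norm \<xi> powr (2 * s) * (norm (fourier \<psi> \<xi>))\<^sup>2) \<le> ennreal (norm \<xi> powr (2 * s) * M\<^sup>2)"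
        by (rule ennreal_leI)
      also have "\<dots> = ennreal (M\<^sup>2) * (ennreal (norm \<xi> powr (2 * s)) * indicator {\<xi>. norm \<xi> \<le> 1} \<xi>)"
        using True by (simp add: ennreal_mult mult.commute)
      finally have "ennreal (norm \<xi> powr (2 * s) * (norm (fourier \<psi> \<xi>))\<^sup>2) \<le> ennreal (M\<^sup>2) * (ennreal (norm \<xi> powr (2 * s)) * indicator {\<xi>. norm \<xi> \<le> 1} \<xi>)" .
      then show ?thesis unfolding e by (rule order_trans) simp
    next
      case False
      have "norm \<xi> powr (2 * s) \<le> norm \<xi> powr 2" using False s by (intro powr_mono) auto
      then have "norm \<xi> powr (2 * s) \<le> (norm \<xi>)\<^sup>2" by simp
      then have "norm \<xi> powr (2 * s) * (norm (fourier \<psi> \<xi>))\<^sup>2 \<le> (norm (complex_of_real (norm \<xi>) * fourier \<psi> \<xi>))\<^sup>2"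
        by (simp add: norm_mult power_mult_distrib mult_right_mono)
      from ennreal_leI[OF this] show ?thesis unfolding e by (rule order_trans) simp
    qed
  qed
  also have "\<dots> = ennreal (M\<^sup>2) * (\<integral>\<^sup>+\<xi>. ennreal (norm \<xi> powr (2 * s)) * indicator {\<xi>. norm \<xi> \<le> 1} \<xi> \<partial>(lborel::(real^'n) measure)) + energy (\<lambda>\<xi>. complex_of_real (norm \<xi>) * fourier \<psi> \<xi>)"
    unfolding energy_def by (subst nn_integral_add) (auto simp: nn_integral_cmult)
  also have "\<dots> < \<infinity>"
    using nn_integral_powr_near_0[where 'a = "real^'n", of "2 * s"] s L2_energy[OF schwartz_fourier_weighted[OF \<psi>]]
    by (simp add: ennreal_mult_less_top)
  finally show ?thesis by (simp add: L2_def)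
qed

section \<open>Dyadic frequency bands\<close>

text \<open>
  For \<open>H\<close> supported in a band of length \<open>L\<close>, Cauchy-Schwarz bounds the supremum in time and \<open>bessel_phase\<close> the square
  integral; the power \<open>q\<close> lies between them.
\<close>
lemma band_time_bound:
  fixes H :: "real \<Rightarrow> complex"
  assumes L: "L > 0" and H: "H \<in> L2" and supp: "\<And>\<rho>. H \<rho> \<noteq> 0 \<Longrightarrow> L \<le> \<rho> \<and> \<rho> < 2 * L" and q: "q \<ge> 2"
  shows "integrable lborel H"
    and "(\<integral>\<^sup>+t. ennreal (norm (\<integral>\<rho>. cis (- (t * \<rho>\<^sup>2)) * H \<rho> \<partial>lborel) powr q) \<partial>lborel)
      \<le> ennreal (pi * L powr (q / 2 - 2) * enn2real (energy H) powr (q / 2))"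
proof -
  note [measurable] = L2_D[OF H]
  define e where "e = enn2real (energy H)"
  have e: "e \<ge> 0" "energy H = ennreal e" using L2_energy[OF H] by (auto simp: e_def)
  define b where "b = (\<lambda>\<rho>. complex_of_real (indicator {L..<2 * L} \<rho>))"
  have bE: "energy b = ennreal L"
  proof -
    have "energy b = (\<integral>\<^sup>+\<rho>. indicator {L..<2 * L} \<rho> \<partial>lborel)"
      unfolding energy_def b_def by (intro nn_integral_cong) (simp split: split_indicator)
    then show ?thesis using L by simp
  qed
  have b: "b \<in> L2" unfolding L2_def using bE by (auto simp: b_def)
  have bH: "b \<rho> * H \<rho> = H \<rho>" for \<rho> using supp[of \<rho>] by (auto simp: b_def split: split_indicator)
  show i: "integrable lborel H"
    using L2_mult_integrable[OF b H] by (simp add: bH)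
  define U where "U t = (\<integral>\<rho>. cis (- (t * \<rho>\<^sup>2)) * H \<rho> \<partial>lborel)" for t
  have sup: "(norm (U t))\<^sup>2 \<le> L * e" for t
  proof -
    define h where "h = (\<lambda>\<rho>. cis (- (t * \<rho>\<^sup>2)) * H \<rho>)"
    have eh: "energy h = ennreal e" unfolding e(2)[symmetric] energy_def h_def by (simp add: norm_mult)
    have h: "h \<in> L2" unfolding L2_def using eh by (auto simp: h_def)
    have bh: "b \<rho> * h \<rho> = h \<rho>" for \<rho> using bH[of \<rho>] unfolding h_def by (simp add: mult.left_commute)
    have "ennreal ((norm (\<integral>\<rho>. h \<rho> \<partial>lborel))\<^sup>2) \<le> ennreal L * ennreal e"
      using L2_Cauchy_Schwarz[OF b h] unfolding bh bE eh .
    also have "\<dots> = ennreal (L * e)" using L e by (simp add: ennreal_mult)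
    finally have "(norm (\<integral>\<rho>. h \<rho> \<partial>lborel))\<^sup>2 \<le> L * e"
      by (rule ennreal_le_iff[THEN iffD1, rotated]) (use L e(1) in simp)
    then show ?thesis unfolding U_def h_def .
  qed
  have tm: "(\<integral>\<^sup>+t. ennreal ((norm (U t))\<^sup>2) \<partial>lborel) \<le> ennreal (pi / L) * ennreal e"
  proof -
    have "(\<integral>\<^sup>+t. ennreal ((norm (\<integral>\<rho>. cis (- (t \<bullet> \<rho>\<^sup>2)) * H \<rho> \<partial>lborel))\<^sup>2) \<partial>lborel)
      \<le> ennreal ((2 * pi / (2 * L)) ^ DIM(real)) * (\<integral>\<^sup>+x. ennreal ((norm (H x))\<^sup>2) \<partial>lborel)"
    proof (rule bessel_phase[where \<theta> = "\<lambda>\<rho>. \<rho>\<^sup>2"])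
      \<comment> \<open>On the band \<open>x + y \<ge> 2 L\<close>, so the phase separates points by the factor \<open>2 L\<close>.\<close>
      fix x y assume "H x \<noteq> 0" "H y \<noteq> 0"
      then have "2 * L \<le> x + y" using supp[of x] supp[of y] by auto
      then have "2 * L * \<bar>x - y\<bar> \<le> \<bar>x + y\<bar> * \<bar>x - y\<bar>" by (intro mult_right_mono) auto
      also have "\<dots> = \<bar>x\<^sup>2 - y\<^sup>2\<bar>" unfolding abs_mult[symmetric] by (simp add: power2_eq_square algebra_simps)
      finally show "2 * L * norm (x - y) \<le> norm (x\<^sup>2 - y\<^sup>2)" by simp
    qed (use L i in auto)
    then show ?thesis using e(2) unfolding U_def energy_def by simp
  qed
  have "(\<integral>\<^sup>+t. ennreal (norm (U t) powr q) \<partial>lborel) \<le> (\<integral>\<^sup>+t. ennreal ((L * e) powr ((q - 2) / 2)) * ennreal ((norm (U t))\<^sup>2) \<partial>lborel)"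
  proof (rule nn_integral_mono)
    fix t
    have "norm (U t) powr q \<le> (L * e) powr ((q - 2) / 2) * (norm (U t))\<^sup>2"
    proof (cases "norm (U t) = 0")
      case False
      then have n: "norm (U t) > 0" by simp
      have "norm (U t) powr q = norm (U t) powr ((q - 2) + 2)" by simp
      also have "\<dots> = norm (U t) powr (q - 2) * norm (U t) powr 2" by (rule powr_add)
      also have "norm (U t) powr 2 = (norm (U t))\<^sup>2" by simp
      also have "norm (U t) powr (q - 2) = ((norm (U t))\<^sup>2) powr ((q - 2) / 2)"
      proof -
        have "((norm (U t))\<^sup>2) powr ((q - 2) / 2) = (norm (U t) powr 2) powr ((q - 2) / 2)" by simp
        also have "\<dots> = norm (U t) powr (2 * ((q - 2) / 2))" by (rule powr_powr)
        also have "2 * ((q - 2) / 2) = q - 2" by simp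
        finally show ?thesis by (rule sym)
      qed
      also have "\<dots> * (norm (U t))\<^sup>2 \<le> (L * e) powr ((q - 2) / 2) * (norm (U t))\<^sup>2"
        using q by (intro mult_right_mono powr_mono2 sup) auto
      finally show ?thesis .
    qed simp
    then show "ennreal (norm (U t) powr q) \<le> ennreal ((L * e) powr ((q - 2) / 2)) * ennreal ((norm (U t))\<^sup>2)"
      by (simp flip: ennreal_mult)
  qed
  also have "\<dots> = ennreal ((L * e) powr ((q - 2) / 2)) * (\<integral>\<^sup>+t. ennreal ((norm (U t))\<^sup>2) \<partial>lborel)"
    unfolding U_def by (rule nn_integral_cmult) measurable
  also have "\<dots> \<le> ennreal ((L * e) powr ((q - 2) / 2)) * (ennreal (pi / L) * ennreal e)"
    by (intro mult_left_mono tm) simp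
  also have "\<dots> = ennreal ((L * e) powr ((q - 2) / 2) * (pi / L * e))"
    using L e by (simp flip: ennreal_mult)
  also have "(L * e) powr ((q - 2) / 2) * (pi / L * e) = pi * L powr (q / 2 - 2) * e powr (q / 2)"
  proof (cases "e = 0")
    case False
    then have e0: "e > 0" using e by simp
    have "(L * e) powr ((q - 2) / 2) = L powr ((q - 2) / 2) * e powr ((q - 2) / 2)" using L e by (simp add: powr_mult)
    moreover have "L powr (q / 2 - 2) = L powr ((q - 2) / 2) / L"
    proof -
      have "L powr (q / 2 - 2) = L powr ((q - 2) / 2 - 1)" by (simp add: field_simps)
      then show ?thesis using L by (simp add: powr_diff)
    qed
    moreover have "e powr (q / 2) = e powr ((q - 2) / 2) * e"
    proof -
      have "e powr (q / 2) = e powr ((q - 2) / 2 + 1)" by (simp add: field_simps)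
      then show ?thesis using e0 by (simp add: powr_add)
    qed
    ultimately show ?thesis by simp
  qed simp
  finally show "(\<integral>\<^sup>+t. ennreal (norm (\<integral>\<rho>. cis (- (t * \<rho>\<^sup>2)) * H \<rho> \<partial>lborel) powr q) \<partial>lborel)
      \<le> ennreal (pi * L powr (q / 2 - 2) * enn2real (energy H) powr (q / 2))"
    unfolding U_def e_def .
qed

text \<open>
  The dyadic scales \<open>2\<^sup>j\<close> for all integers \<open>j\<close>, enumerated by natural numbers so that sums over them are series.
\<close>
definition scale :: "nat \<Rightarrow> real" where
  "scale n = 2 powr real_of_int (int_decode n)"

definition band :: "nat \<Rightarrow> real set" where
  "band n = {scale n..<2 * scale n}"

lemma scale_pos [simp]: "scale n > 0"
  by (simp add: scale_def)

lemma band_borel [measurable]: "band n \<in> sets borel"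
  by (simp add: band_def)

lemma mem_band_iff: "\<rho> \<in> band n \<longleftrightarrow> \<rho> > 0 \<and> \<lfloor>log 2 \<rho>\<rfloor> = int_decode n"
proof (cases "\<rho> > 0")
  case True
  have "2 * scale n = 2 powr (real_of_int (int_decode n) + 1)"
    by (simp add: scale_def powr_add)
  with True show ?thesis
    by (simp add: band_def scale_def floor_eq_iff le_log_iff log_less_iff)
next
  case False
  then show ?thesis using scale_pos[of n] by (auto simp: band_def)
qed

lemma disjoint_family_band: "disjoint_family band"
proof -
  have "m = n" if "\<rho> \<in> band m" "\<rho> \<in> band n" for m n \<rho>
    using that by (simp add: mem_band_iff) (metis int_decode_inverse)
  then show ?thesis unfolding disjoint_family_on_def by blast
qed

lemma Union_band: "(\<Union>n. band n) = {0<..}"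
proof -
  have "\<rho> \<in> band (int_encode \<lfloor>log 2 \<rho>\<rfloor>)" if "\<rho> > 0" for \<rho>
    using that by (simp add: mem_band_iff)
  moreover have "\<rho> > 0" if "\<rho> \<in> band n" for \<rho> n using that by (simp add: mem_band_iff)
  ultimately show ?thesis by blast
qed

lemma suminf_band: "(\<Sum>n. indicator (band n) \<rho> :: ennreal) = indicator {0<..} \<rho>"
  using suminf_indicator[OF disjoint_family_band] by (simp add: Union_band)

lemma abs_int_decode_ge: "real n \<le> 2 * \<bar>real_of_int (int_decode n)\<bar> + 1"
proof (cases "even n")
  case True
  then obtain m where "n = 2 * m" by auto
  then show ?thesis by (simp add: int_decode_def sum_decode_def)
next
  case False
  then obtain m where "n = 2 * m + 1" by (auto elim: oddE)
  then show ?thesis by (simp add: int_decode_def sum_decode_def)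
qed

text \<open>
  The weight of a scale \<open>L\<close> at \<open>y = L r\<close>: it grows exponentially in the dyadic distance of \<open>L\<close> from \<open>1 / r\<close>.
\<close>
definition dist_to_scale :: "real \<Rightarrow> real \<Rightarrow> real" where
  "dist_to_scale \<epsilon> y = (max y (1 / y)) powr \<epsilon>"

lemma suminf_int_decode_shift:
  "(\<Sum>n. f (int_decode n + j)) = (\<Sum>n. f (int_decode n) :: ennreal)"
proof -
  have bij: "bij_betw int_decode UNIV UNIV" by (rule bij_int_decode)
  have "(\<Sum>n. f (int_decode n + j)) = (\<integral>\<^sup>+n. f (int_decode n + j) \<partial>count_space UNIV)"
    by (rule nn_integral_count_space_nat[symmetric])
  also have "\<dots> = (\<integral>\<^sup>+i. f (i + j) \<partial>count_space UNIV)"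
    by (rule nn_integral_bij_count_space[OF bij])
  also have "\<dots> = (\<integral>\<^sup>+i. f i \<partial>count_space UNIV)"
    by (rule nn_integral_bij_count_space[of "\<lambda>i. i + j"]) (auto intro!: bij_betw_byWitness[where f' = "\<lambda>i. i - j"])
  also have "\<dots> = (\<integral>\<^sup>+n. f (int_decode n) \<partial>count_space UNIV)"
    by (rule nn_integral_bij_count_space[OF bij, symmetric])
  also have "\<dots> = (\<Sum>n. f (int_decode n))"
    by (rule nn_integral_count_space_nat)
  finally show ?thesis .
qed

text \<open>
  Shifting the index by the dyadic size of \<open>r\<close> reduces to \<open>1 \<le> r < 2\<close>, where the terms are dominated by a
  two-sided geometric series.
\<close>
lemma suminf_dist_to_scale:
  assumes eps: "\<epsilon> > 0"
  shows "\<exists>C>0. \<forall>r>0. (\<Sum>n. ennreal (1 / dist_to_scale \<epsilon> (scale n * r))) \<le> ennreal C"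
proof -
  let ?g = "\<lambda>j::int. ennreal ((2 * 2 powr (- \<bar>real_of_int j\<bar>)) powr \<epsilon>)"
  define K where "K = (\<Sum>n. ?g (int_decode n))"
  have "K < \<infinity>"
  proof -
    let ?a = "2 powr (- \<epsilon> / 2)"
    have a: "0 < ?a" "?a < 1" using eps powr_less_mono[of "- \<epsilon> / 2" 0 2] by auto
    have le: "(2 * 2 powr (- \<bar>real_of_int (int_decode n)\<bar>)) powr \<epsilon> \<le> 4 powr \<epsilon> * ?a ^ n" for n
    proof -
      have "2 * 2 powr (- \<bar>real_of_int (int_decode n)\<bar>) = 2 powr (1 - \<bar>real_of_int (int_decode n)\<bar>)"
        by (simp add: powr_diff powr_minus_divide)
      also have "\<dots> \<le> 2 powr (2 - real n / 2)"
        using abs_int_decode_ge[of n] by (intro powr_mono) auto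
      finally have "(2 * 2 powr (- \<bar>real_of_int (int_decode n)\<bar>)) powr \<epsilon> \<le> (2 powr (2 - real n / 2)) powr \<epsilon>"
        using eps by (intro powr_mono2) auto
      also have "\<dots> = 2 powr (2 * \<epsilon> + (- \<epsilon> / 2) * real n)" by (simp add: powr_powr algebra_simps)
      also have "\<dots> = 2 powr (2 * \<epsilon>) * (?a powr real n)" by (simp only: powr_add powr_powr)
      also have "\<dots> = 4 powr \<epsilon> * ?a ^ n"
        using powr_powr[of 2 2 \<epsilon>] a by (simp add: powr_realpow)
      finally show ?thesis .
    qed
    have "K \<le> (\<Sum>n. ennreal (4 powr \<epsilon> * ?a ^ n))"
      unfolding K_def by (intro suminf_le summableI ennreal_leI le)
    also have "\<dots> = ennreal (\<Sum>n. 4 powr \<epsilon> * ?a ^ n)"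
      using a by (intro suminf_ennreal2 summable_mult summable_geometric) auto
    also have "\<dots> < \<infinity>" by simp
    finally show ?thesis .
  qed
  then obtain k where k: "k \<ge> 0" "K = ennreal k"
    unfolding infinity_ennreal_def less_top_ennreal by blast
  have "(\<Sum>n. ennreal (1 / dist_to_scale \<epsilon> (scale n * r))) \<le> K" if r: "r > 0" for r
  proof -
    define j where "j = \<lfloor>log 2 r\<rfloor>"
    define th where "th = r / 2 powr real_of_int j"
    have th: "1 \<le> th" "th < 2"
    proof -
      have "real_of_int j \<le> log 2 r" "log 2 r < real_of_int j + 1" unfolding j_def by linarith+
      then have "2 powr real_of_int j \<le> r" "r < 2 powr (real_of_int j + 1)"
        using r by (simp_all add: le_log_iff log_less_iff)
      then show "1 \<le> th" "th < 2" by (simp_all add: th_def powr_add field_simps)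
    qed
    have le: "1 / dist_to_scale \<epsilon> (scale n * r) \<le> (2 * 2 powr (- \<bar>real_of_int (int_decode n + j)\<bar>)) powr \<epsilon>" for n
    proof -
      define i where "i = real_of_int (int_decode n + j)"
      let ?y = "scale n * r"
      have y: "?y = 2 powr i * th" by (simp add: scale_def th_def powr_add i_def)
      have y0: "?y > 0" using r by simp
      have "1 / (2 * 2 powr (- \<bar>i\<bar>)) \<le> max ?y (1 / ?y)"
      proof (cases "i \<ge> 0")
        case True
        have "1 / (2 * 2 powr (- \<bar>i\<bar>)) = 2 powr i / 2" using True by (simp add: powr_minus_divide)
        also have "\<dots> \<le> ?y" unfolding y using th by (simp add: field_simps add_increasing2)
        finally show ?thesis by simp
      next
        case False
        have "1 / (2 * 2 powr (- \<bar>i\<bar>)) = 1 / (2 powr i * 2)" using False by simp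
        also have "\<dots> \<le> 1 / ?y" unfolding y using th by (intro divide_left_mono mult_left_mono) auto
        finally show ?thesis by simp
      qed
      then have "(1 / (2 * 2 powr (- \<bar>i\<bar>))) powr \<epsilon> \<le> dist_to_scale \<epsilon> ?y"
        unfolding dist_to_scale_def using eps by (intro powr_mono2) auto
      then have "1 / dist_to_scale \<epsilon> ?y \<le> 1 / (1 / (2 * 2 powr (- \<bar>i\<bar>))) powr \<epsilon>"
      proof (rule divide_left_mono)
        have "max ?y (1 / ?y) > 0" by (simp add: less_max_iff_disj y0)
        then have "dist_to_scale \<epsilon> ?y > 0" unfolding dist_to_scale_def by simp
        then show "0 < dist_to_scale \<epsilon> ?y * (1 / (2 * 2 powr (- \<bar>i\<bar>))) powr \<epsilon>" by simp
      qed simp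
      then show ?thesis unfolding i_def[symmetric] by (simp add: powr_divide)
    qed
    have "(\<Sum>n. ennreal (1 / dist_to_scale \<epsilon> (scale n * r))) \<le> (\<Sum>n. ?g (int_decode n + j))"
      by (intro suminf_le summableI ennreal_leI le)
    also have "\<dots> = K" unfolding K_def by (rule suminf_int_decode_shift)
    finally show ?thesis .
  qed
  then have le: "(\<Sum>n. ennreal (1 / dist_to_scale \<epsilon> (scale n * r))) \<le> ennreal (k + 1)" if "r > 0" for r
    unfolding k(2) by (rule order_trans[OF _ ennreal_leI]) (use that in auto)
  show ?thesis using k le by (intro exI[of _ "k + 1"]) auto
qed

text \<open>
  The majorant of the spherical mean from \<open>sphere_mean_decay\<close>, without the constant.
\<close>
definition mean_bound :: "nat \<Rightarrow> real \<Rightarrow> real" where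
  "mean_bound N y = min 1 (y powr (- (real N - 1) / 2))"

text \<open>
  The two open conditions on \<open>\<alpha>\<close> are used here: the first one at the origin, the second one at infinity.  The
  weight costs \<open>\<epsilon>\<close> in each.
\<close>
lemma weight_integral_finite:
  assumes q: "q \<ge> 2" and eps: "\<epsilon> > 0" "\<epsilon> < real DIM('a::euclidean_space) / q - \<alpha>" "\<epsilon> < \<alpha> - real DIM('a) / q + (real DIM('a) - 1) / 2"
  shows "(\<integral>\<^sup>+y. ennreal (norm y powr (- \<alpha> * q) * (dist_to_scale \<epsilon> (norm y) * mean_bound DIM('a) (norm y)) powr q) \<partial>(lborel :: 'a measure)) < \<infinity>"
proof (rule nn_integral_two_powers[where a = "- \<alpha> * q - \<epsilon> * q" and b = "- \<alpha> * q + \<epsilon> * q - (real DIM('a) - 1) / 2 * q" and C = 1])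
  let ?N = "real DIM('a)"
  have q0: "q > 0" using q by simp
  have "(\<alpha> + \<epsilon>) * q < ?N / q * q" using eps q0 by (intro mult_strict_right_mono) auto
  then show "- ?N < - \<alpha> * q - \<epsilon> * q" using q0 by (simp add: algebra_simps)
  have "?N / q * q < (\<alpha> - \<epsilon> + (?N - 1) / 2) * q" using eps q0 by (intro mult_strict_right_mono) auto
  then show "- \<alpha> * q + \<epsilon> * q - (?N - 1) / 2 * q < - ?N" using q0 by (simp add: algebra_simps)
  show "(\<lambda>y::'a. norm y powr (- \<alpha> * q) * (dist_to_scale \<epsilon> (norm y) * mean_bound DIM('a) (norm y)) powr q) \<in> borel_measurable borel"
    unfolding dist_to_scale_def mean_bound_def by measurable
  fix y :: 'a
  {
    assume y: "norm y \<le> 1" "y \<noteq> 0"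
    then have y0: "norm y > 0" by simp
    have "1 \<le> 1 / norm y" using y y0 by simp
    with y have "max (norm y) (1 / norm y) = 1 / norm y" by (intro max_absorb2) (rule order_trans)
    then have d: "dist_to_scale \<epsilon> (norm y) = norm y powr (- \<epsilon>)"
      using y0 by (simp add: dist_to_scale_def powr_divide powr_minus_divide)
    have "(dist_to_scale \<epsilon> (norm y) * mean_bound DIM('a) (norm y)) powr q \<le> (norm y powr (- \<epsilon>) * 1) powr q"
      unfolding d using q0 by (intro powr_mono2 mult_left_mono mult_nonneg_nonneg) (auto simp: mean_bound_def)
    also have "\<dots> = norm y powr (- \<epsilon> * q)" by (simp add: powr_powr)
    finally have "norm y powr (- \<alpha> * q) * (dist_to_scale \<epsilon> (norm y) * mean_bound DIM('a) (norm y)) powr q \<le> norm y powr (- \<alpha> * q) * norm y powr (- \<epsilon> * q)"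
      by (intro mult_left_mono) auto
    also have "\<dots> = norm y powr (- \<alpha> * q - \<epsilon> * q)" by (simp flip: powr_add)
    finally show "norm y powr (- \<alpha> * q) * (dist_to_scale \<epsilon> (norm y) * mean_bound DIM('a) (norm y)) powr q \<le> 1 * norm y powr (- \<alpha> * q - \<epsilon> * q)" by simp
  next
    assume y: "1 \<le> norm y"
    then have "norm y > 0" by linarith
    then have "1 / norm y \<le> 1" using y by (simp add: field_simps)
    with y have "max (norm y) (1 / norm y) = norm y" by (intro max_absorb1) (rule order_trans)
    then have d: "dist_to_scale \<epsilon> (norm y) = norm y powr \<epsilon>" by (simp add: dist_to_scale_def)
    have "(dist_to_scale \<epsilon> (norm y) * mean_bound DIM('a) (norm y)) powr q \<le> (norm y powr \<epsilon> * norm y powr (- (?N - 1) / 2)) powr q"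
      unfolding d using q0 by (intro powr_mono2 mult_left_mono mult_nonneg_nonneg) (auto simp: mean_bound_def)
    also have "\<dots> = norm y powr ((\<epsilon> + - (?N - 1) / 2) * q)" by (simp only: powr_add[symmetric] powr_powr)
    finally have "norm y powr (- \<alpha> * q) * (dist_to_scale \<epsilon> (norm y) * mean_bound DIM('a) (norm y)) powr q \<le> norm y powr (- \<alpha> * q) * norm y powr ((\<epsilon> + - (?N - 1) / 2) * q)"
      by (intro mult_left_mono) auto
    also have "\<dots> = norm y powr (- \<alpha> * q + (\<epsilon> + - (?N - 1) / 2) * q)" by (rule powr_add[symmetric])
    also have "- \<alpha> * q + (\<epsilon> + - (?N - 1) / 2) * q = - \<alpha> * q + \<epsilon> * q - (?N - 1) / 2 * q" by (simp add: field_simps)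
    finally show "norm y powr (- \<alpha> * q) * (dist_to_scale \<epsilon> (norm y) * mean_bound DIM('a) (norm y)) powr q \<le> 1 * norm y powr (- \<alpha> * q + \<epsilon> * q - (?N - 1) / 2 * q)" by simp
  }
qed simp

section \<open>The pieces of the wave\<close>

definition band_freq :: "real \<Rightarrow> (real \<Rightarrow> complex) \<Rightarrow> nat \<Rightarrow> real \<Rightarrow> real \<Rightarrow> complex" where
  "band_freq s g n t \<rho> = indicator (band n) \<rho> * complex_of_real (\<rho> powr s) * cis (- (t * \<rho>\<^sup>2)) * g \<rho>"

text \<open>
  The part of \<open>\<bar>D\<bar>\<^sup>s U(t) \<phi>\<close> with frequencies in one band, where \<open>g\<close> is the radial profile of the transform of \<open>\<phi>\<close>.
\<close>
definition wave_piece :: "real \<Rightarrow> (real \<Rightarrow> complex) \<Rightarrow> nat \<Rightarrow> real \<times> 'a::euclidean_space \<Rightarrow> complex" where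
  "wave_piece s g n z = complex_of_real ((2 * pi) powr (- real DIM('a) / 2)) * (\<integral>\<xi>. cis (snd z \<bullet> \<xi>) * band_freq s g n (fst z) (norm \<xi>) \<partial>(lborel :: 'a measure))"

definition band_energy :: "'a::euclidean_space itself \<Rightarrow> (real \<Rightarrow> complex) \<Rightarrow> nat \<Rightarrow> ennreal" where
  "band_energy _ g n = energy (\<lambda>\<xi>::'a. indicator (band n) (norm \<xi>) * g (norm \<xi>))"

lemma wave_piece_measurable [measurable]:
  assumes [measurable]: "g \<in> borel_measurable borel"
  shows "(wave_piece s g n :: real \<times> 'a::euclidean_space \<Rightarrow> complex) \<in> borel_measurable borel"
proof -
  have "(wave_piece s g n :: real \<times> 'a \<Rightarrow> complex) \<in> borel_measurable (borel \<Otimes>\<^sub>M borel)"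
    unfolding wave_piece_def[abs_def] band_freq_def by measurable
  then show ?thesis by (simp add: borel_prod)
qed

lemma suminf_band_energy_le:
  assumes [measurable]: "g \<in> borel_measurable borel"
  shows "(\<Sum>n. band_energy TYPE('a::euclidean_space) g n) \<le> energy (\<lambda>\<xi>::'a. g (norm \<xi>))"
proof -
  have "(\<Sum>n. band_energy TYPE('a) g n) = (\<integral>\<^sup>+\<xi>. (\<Sum>n. ennreal ((norm (g (norm \<xi>)))\<^sup>2) * indicator (band n) (norm \<xi>)) \<partial>(lborel::'a measure))"
    unfolding band_energy_def energy_def
    by (subst nn_integral_suminf) (auto intro!: suminf_cong nn_integral_cong split: split_indicator)
  also have "\<dots> \<le> energy (\<lambda>\<xi>::'a. g (norm \<xi>))"
    unfolding energy_def
    by (intro nn_integral_mono) (simp add: suminf_band split: split_indicator)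
  finally show ?thesis .
qed

lemma band_freq_L2_L1:
  assumes g [measurable]: "g \<in> borel_measurable borel" and E: "energy (\<lambda>\<xi>::'a::euclidean_space. g (norm \<xi>)) < \<infinity>"
  shows "(\<lambda>\<xi>::'a. band_freq s g n t (norm \<xi>)) \<in> L2" "integrable lborel (\<lambda>\<xi>::'a. band_freq s g n t (norm \<xi>))"
proof -
  let ?L = "scale n"
  let ?B = "max (?L powr s) ((2 * ?L) powr s)"
  let ?f = "\<lambda>\<xi>::'a. band_freq s g n t (norm \<xi>)"
  have B: "\<rho> powr s \<le> ?B" if "\<rho> \<in> band n" for \<rho>
  proof (cases "s \<ge> 0")
    case True
    then have "\<rho> powr s \<le> (2 * ?L) powr s" using that by (intro powr_mono2) (auto simp: band_def less_imp_le intro: order_trans[OF less_imp_le[OF scale_pos]])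
    then show ?thesis by simp
  next
    case False
    then have "\<rho> powr s \<le> ?L powr s" using that by (intro powr_mono2') (auto simp: band_def)
    then show ?thesis by simp
  qed
  have m [measurable]: "?f \<in> borel_measurable borel" unfolding band_freq_def by measurable
  have "(\<lambda>\<xi>::'a. complex_of_real ?B * g (norm \<xi>)) \<in> L2"
    using E by (simp add: L2_def energy_cmult ennreal_mult_less_top)
  then show L2: "?f \<in> L2"
  proof (rule L2_bound)
    fix \<xi> :: 'a
    show "norm (?f \<xi>) \<le> norm (complex_of_real ?B * g (norm \<xi>))"
      using B[of "norm \<xi>"] by (auto simp: band_freq_def norm_mult mult_right_mono split: split_indicator)
  qed measurable
  have "trunc (2 * ?L) ?f = ?f"
    by (auto simp: trunc_def fun_eq_iff band_freq_def band_def split: split_indicator)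
  then show "integrable lborel ?f" using trunc_integrable[OF L2, of "2 * ?L"] by simp
qed

lemma wave_piece_radial:
  fixes x :: "'a::euclidean_space"
  assumes g [measurable]: "g \<in> borel_measurable borel" and E: "energy (\<lambda>\<xi>::'a. g (norm \<xi>)) < \<infinity>"
  shows "wave_piece s g n (t, x) = (\<integral>\<rho>. cis (- (t * \<rho>\<^sup>2)) * 
     (complex_of_real ((2 * pi) powr (- real DIM('a) / 2) * sphere_area TYPE('a) * indicator (band n) \<rho> * (\<rho> powr s * \<rho> ^ (DIM('a) - 1) * sphere_mean DIM('a) (\<rho> * norm x))) * g \<rho>) \<partial>lborel)"
proof -
  let ?c = "complex_of_real ((2 * pi) powr (- real DIM('a) / 2))" and ?\<sigma> = "complex_of_real (sphere_area TYPE('a))"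
  have m [measurable]: "band_freq s g n t \<in> borel_measurable borel" unfolding band_freq_def[abs_def] by measurable
  have "wave_piece s g n (t, x) = ?c * (\<integral>\<xi>. cis (x \<bullet> \<xi>) * band_freq s g n t (norm \<xi>) \<partial>lborel)"
    by (simp add: wave_piece_def)
  also have "(\<integral>\<xi>. cis (x \<bullet> \<xi>) * band_freq s g n t (norm \<xi>) \<partial>lborel) = ?\<sigma> *
     (\<integral>\<rho>. band_freq s g n t \<rho> * complex_of_real (\<rho> ^ (DIM('a) - 1) * sphere_mean DIM('a) (\<rho> * norm x) * indicator {0..} \<rho>) \<partial>lborel)"
    by (rule fourier_radial[OF m band_freq_L2_L1(2)[OF g E], where R = "2 * scale n"])
       (auto simp: band_freq_def band_def less_imp_le)
  also have "?c * (?\<sigma> * (\<integral>\<rho>. band_freq s g n t \<rho> * complex_of_real (\<rho> ^ (DIM('a) - 1) * sphere_mean DIM('a) (\<rho> * norm x) * indicator {0..} \<rho>) \<partial>lborel))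
     = (\<integral>\<rho>. ?c * ?\<sigma> * (band_freq s g n t \<rho> * complex_of_real (\<rho> ^ (DIM('a) - 1) * sphere_mean DIM('a) (\<rho> * norm x) * indicator {0..} \<rho>)) \<partial>lborel)"
    by (subst integral_mult_right_zero) (simp only: mult.assoc)
  also have "\<dots> = (\<integral>\<rho>. cis (- (t * \<rho>\<^sup>2)) * 
     (complex_of_real ((2 * pi) powr (- real DIM('a) / 2) * sphere_area TYPE('a) * indicator (band n) \<rho> * (\<rho> powr s * \<rho> ^ (DIM('a) - 1) * sphere_mean DIM('a) (\<rho> * norm x))) * g \<rho>) \<partial>lborel)"
  proof (intro Bochner_Integration.integral_cong refl)
    fix \<rho> :: real
    show "?c * ?\<sigma> * (band_freq s g n t \<rho> * complex_of_real (\<rho> ^ (DIM('a) - 1) * sphere_mean DIM('a) (\<rho> * norm x) * indicator {0..} \<rho>)) = cis (- (t * \<rho>\<^sup>2)) * 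
     (complex_of_real ((2 * pi) powr (- real DIM('a) / 2) * sphere_area TYPE('a) * indicator (band n) \<rho> * (\<rho> powr s * \<rho> ^ (DIM('a) - 1) * sphere_mean DIM('a) (\<rho> * norm x))) * g \<rho>)"
    proof (cases "\<rho> \<in> band n")
      case True
      then have "\<rho> > 0" by (simp add: mem_band_iff)
      with True show ?thesis by (simp add: band_freq_def mult_ac)
    qed (simp add: band_freq_def)
  qed
  finally show ?thesis .
qed

lemma mean_bound_antimono: "0 < y \<Longrightarrow> y \<le> y' \<Longrightarrow> N > 0 \<Longrightarrow> mean_bound N y' \<le> mean_bound N y"
  unfolding mean_bound_def by (intro min.mono order_refl powr_mono2') auto

lemma mean_bound_nonneg: "0 \<le> mean_bound N y"
  by (simp add: mean_bound_def)

lemma band_weight_bound: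
  assumes \<rho>: "\<rho> \<in> band n" and r: "r > 0" and N: "N > 0"
    and J: "\<And>y. y > 0 \<Longrightarrow> \<bar>sphere_mean N y\<bar> \<le> C * mean_bound N y" and C: "C > 0"
  shows "(\<rho> powr s * \<rho> ^ (N - 1) * sphere_mean N (\<rho> * r))\<^sup>2
     \<le> C\<^sup>2 * 2 powr (2 * \<bar>s\<bar>) * 2 ^ (N - 1) * (scale n powr (2 * s + (real N - 1)) * (mean_bound N (scale n * r))\<^sup>2) * \<rho> ^ (N - 1)"
proof -
  let ?L = "scale n"
  have L: "?L > 0" by simp
  have p: "\<rho> > 0" "?L \<le> \<rho>" "\<rho> \<le> 2 * ?L" 
  proof -
    show "\<rho> > 0" using \<rho> by (simp add: mem_band_iff)
    show "?L \<le> \<rho>" "\<rho> \<le> 2 * ?L" using \<rho> by (auto simp: band_def)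
  qed
  have a: "(\<rho> powr s)\<^sup>2 \<le> 2 powr (2 * \<bar>s\<bar>) * ?L powr (2 * s)"
  proof -
    have sq: "(\<rho> powr s)\<^sup>2 = \<rho> powr (2 * s)" unfolding power2_eq_square mult_2 by (rule powr_add[symmetric])
    show ?thesis
    proof (cases "s \<ge> 0")
      case True
      have "\<rho> powr (2 * s) \<le> (2 * ?L) powr (2 * s)" using True p by (intro powr_mono2) auto
      also have "\<dots> = 2 powr (2 * s) * ?L powr (2 * s)" by (simp add: powr_mult)
      finally show ?thesis using True unfolding sq by simp
    next
      case False
      have "\<rho> powr (2 * s) \<le> ?L powr (2 * s)" using False p L by (intro powr_mono2') auto
      also have "\<dots> \<le> 2 powr (2 * \<bar>s\<bar>) * ?L powr (2 * s)" by (simp add: mult_le_cancel_right1 ge_one_powr_ge_zero)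
      finally show ?thesis unfolding sq .
    qed
  qed
  have b: "(\<rho> ^ (N - 1))\<^sup>2 \<le> 2 ^ (N - 1) * ?L powr (real N - 1) * \<rho> ^ (N - 1)"
  proof -
    have "\<rho> ^ (N - 1) \<le> (2 * ?L) ^ (N - 1)" using p by (intro power_mono) auto
    also have "\<dots> = 2 ^ (N - 1) * ?L powr (real N - 1)"
      using L N by (simp add: power_mult_distrib powr_realpow[symmetric] of_nat_diff)
    finally show ?thesis unfolding power2_eq_square using p by (intro mult_right_mono) auto
  qed
  have c: "(sphere_mean N (\<rho> * r))\<^sup>2 \<le> C\<^sup>2 * (mean_bound N (?L * r))\<^sup>2"
  proof -
    have "\<bar>sphere_mean N (\<rho> * r)\<bar> \<le> C * mean_bound N (\<rho> * r)" using p r by (intro J) auto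
    also have "\<dots> \<le> C * mean_bound N (?L * r)" using p r L N C by (intro mult_left_mono mean_bound_antimono) auto
    finally have "\<bar>sphere_mean N (\<rho> * r)\<bar>\<^sup>2 \<le> (C * mean_bound N (?L * r))\<^sup>2" by (intro power_mono) auto
    then show ?thesis by (simp add: power_mult_distrib)
  qed
  have "(\<rho> powr s * \<rho> ^ (N - 1) * sphere_mean N (\<rho> * r))\<^sup>2 = (\<rho> powr s)\<^sup>2 * (\<rho> ^ (N - 1))\<^sup>2 * (sphere_mean N (\<rho> * r))\<^sup>2"
    by (simp only: power_mult_distrib)
  also have "\<dots> \<le> (2 powr (2 * \<bar>s\<bar>) * ?L powr (2 * s)) * (2 ^ (N - 1) * ?L powr (real N - 1) * \<rho> ^ (N - 1)) * (C\<^sup>2 * (mean_bound N (?L * r))\<^sup>2)"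
    using p by (intro mult_mono a b c) auto
  also have "\<dots> = C\<^sup>2 * 2 powr (2 * \<bar>s\<bar>) * 2 ^ (N - 1) * (scale n powr (2 * s + (real N - 1)) * (mean_bound N (scale n * r))\<^sup>2) * \<rho> ^ (N - 1)"
    by (simp only: powr_add mult_ac)
  finally show ?thesis .
qed

text \<open>
  The constant depends neither on \<open>g\<close> nor on the band nor on \<open>x\<close>.  By \<open>wave_piece_radial\<close> the piece is an
  integral as in \<open>band_time_bound\<close>; on a band all powers of the frequency are comparable to those of its scale.
\<close>
lemma wave_piece_time_bound:
  assumes q: "q \<ge> 2"
  shows "\<exists>K>0. \<forall>g\<in>borel_measurable borel. energy (\<lambda>\<xi>::'a::euclidean_space. g (norm \<xi>)) < \<infinity> \<longrightarrow> (\<forall>n (x::'a). x \<noteq> 0 \<longrightarrow>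
    (\<integral>\<^sup>+t. ennreal (norm (wave_piece s g n (t, x)) powr q) \<partial>lborel) \<le>
     ennreal (K * scale n powr (q / 2 - 2 + (2 * s + (real DIM('a) - 1)) * (q / 2)) * mean_bound DIM('a) (scale n * norm x) powr q * enn2real (band_energy TYPE('a) g n) powr (q / 2)))"
proof -
  let ?N = "DIM('a)"
  have N: "?N > 0" by (rule DIM_positive)
  note [measurable] = sphere_mean_measurable[OF N]
  obtain C where C: "C > 0" and J: "\<And>y. y > 0 \<Longrightarrow> \<bar>sphere_mean ?N y\<bar> \<le> C * mean_bound ?N y"
    using sphere_mean_decay[OF N] unfolding mean_bound_def by blast
  define \<sigma> where "\<sigma> = sphere_area TYPE('a)"
  have \<sigma>: "\<sigma> > 0" unfolding \<sigma>_def by (rule sphere_area_pos)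
  define c where "c = (2 * pi) powr (- real ?N / 2) * \<sigma>"
  have c: "c > 0" using \<sigma> by (simp add: c_def)
  define K1 where "K1 = c\<^sup>2 * (C\<^sup>2 * 2 powr (2 * \<bar>s\<bar>) * 2 ^ (?N - 1)) / \<sigma>"
  have K1: "K1 > 0" using c C \<sigma> by (simp add: K1_def)
  define K where "K = pi * K1 powr (q / 2)"
  have K: "K > 0" using K1 by (simp add: K_def)
  have "(\<integral>\<^sup>+t. ennreal (norm (wave_piece s g n (t, x)) powr q) \<partial>lborel) \<le>
     ennreal (K * scale n powr (q / 2 - 2 + (2 * s + (real ?N - 1)) * (q / 2)) * mean_bound ?N (scale n * norm x) powr q * enn2real (band_energy TYPE('a) g n) powr (q / 2))"
    if g [measurable]: "g \<in> borel_measurable borel" and E: "energy (\<lambda>\<xi>::'a. g (norm \<xi>)) < \<infinity>" and x: "x \<noteq> 0" for g n and x :: 'a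
  proof -
    let ?L = "scale n" and ?r = "norm x"
    have r: "?r > 0" using x by simp
    define a where "a = enn2real (band_energy TYPE('a) g n)"
    have "band_energy TYPE('a) g n \<le> energy (\<lambda>\<xi>::'a. g (norm \<xi>))"
      unfolding band_energy_def by (intro energy_mono) (auto simp: norm_mult split: split_indicator)
    then have "band_energy TYPE('a) g n < \<infinity>" using E by (rule le_less_trans)
    then have a: "a \<ge> 0" "band_energy TYPE('a) g n = ennreal a" by (auto simp: a_def)
    define H where "H = (\<lambda>\<rho>. complex_of_real ((2 * pi) powr (- real DIM('a) / 2) * sphere_area TYPE('a) * indicator (band n) \<rho> * (\<rho> powr s * \<rho> ^ (DIM('a) - 1) * sphere_mean DIM('a) (\<rho> * norm x))) * g \<rho>)"
    have [measurable]: "H \<in> borel_measurable borel" unfolding H_def by measurable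
    define m where "m = ?L powr (2 * s + (real ?N - 1)) * (mean_bound ?N (?L * ?r))\<^sup>2"
    have m: "m \<ge> 0" by (simp add: m_def)
    have aint: "ennreal a = ennreal \<sigma> * (\<integral>\<^sup>+\<rho>. ennreal ((norm (g \<rho>))\<^sup>2) * indicator (band n) \<rho> * ennreal (\<rho> ^ (?N - 1)) * indicator {0..} \<rho> \<partial>lborel)"
    proof -
      have "ennreal a = (\<integral>\<^sup>+\<xi>. (ennreal ((norm (g (norm \<xi>)))\<^sup>2) * indicator (band n) (norm \<xi>)) * ennreal 1 \<partial>(lborel::'a measure))"
        unfolding a(2)[symmetric] band_energy_def energy_def by (intro nn_integral_cong) (auto split: split_indicator)
      also have "\<dots> = ennreal (sphere_const (\<lambda>_::'a. 1) 0) * (\<integral>\<^sup>+\<rho>. (ennreal ((norm (g \<rho>))\<^sup>2) * indicator (band n) \<rho>) * ennreal (\<rho> ^ (?N + 0 - 1)) * indicator {0..} \<rho> \<partial>lborel)"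
        by (rule nn_integral_radial[OF homogeneous_1]) measurable
      finally show ?thesis by (simp add: \<sigma>_def sphere_area_def)
    qed
    have EH: "energy H \<le> ennreal (K1 * m * a)"
    proof -
      have "energy H \<le> (\<integral>\<^sup>+\<rho>. ennreal (K1 * m * \<sigma>) * (ennreal ((norm (g \<rho>))\<^sup>2) * indicator (band n) \<rho> * ennreal (\<rho> ^ (?N - 1)) * indicator {0..} \<rho>) \<partial>lborel)"
        unfolding energy_def
      proof (rule nn_integral_mono)
        fix \<rho> :: real
        show "ennreal ((norm (H \<rho>))\<^sup>2) \<le> ennreal (K1 * m * \<sigma>) * (ennreal ((norm (g \<rho>))\<^sup>2) * indicator (band n) \<rho> * ennreal (\<rho> ^ (?N - 1)) * indicator {0..} \<rho>)"
        proof (cases "\<rho> \<in> band n")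
          case True
          then have p: "\<rho> > 0" by (simp add: mem_band_iff)
          have "(norm (H \<rho>))\<^sup>2 = c\<^sup>2 * (\<rho> powr s * \<rho> ^ (?N - 1) * sphere_mean ?N (\<rho> * ?r))\<^sup>2 * (norm (g \<rho>))\<^sup>2"
            using True unfolding H_def c_def \<sigma>_def by (simp only: norm_mult norm_of_real power_mult_distrib power2_abs) simp
          also have "\<dots> \<le> c\<^sup>2 * (C\<^sup>2 * 2 powr (2 * \<bar>s\<bar>) * 2 ^ (?N - 1) * m * \<rho> ^ (?N - 1)) * (norm (g \<rho>))\<^sup>2"
            unfolding m_def by (intro mult_right_mono mult_left_mono band_weight_bound[OF True r N J C]) auto
          also have "\<dots> = K1 * m * \<sigma> * ((norm (g \<rho>))\<^sup>2 * \<rho> ^ (?N - 1))"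
            unfolding K1_def using \<sigma> by simp
          finally have "ennreal ((norm (H \<rho>))\<^sup>2) \<le> ennreal (K1 * m * \<sigma> * ((norm (g \<rho>))\<^sup>2 * \<rho> ^ (?N - 1)))" by (rule ennreal_leI)
          also have "\<dots> = ennreal (K1 * m * \<sigma>) * (ennreal ((norm (g \<rho>))\<^sup>2) * indicator (band n) \<rho> * ennreal (\<rho> ^ (?N - 1)) * indicator {0..} \<rho>)"
            using True p K1 m \<sigma> by (simp add: ennreal_mult less_imp_le)
          finally show ?thesis .
        qed (simp add: H_def)
      qed
      also have "\<dots> = ennreal (K1 * m * \<sigma>) * (\<integral>\<^sup>+\<rho>. ennreal ((norm (g \<rho>))\<^sup>2) * indicator (band n) \<rho> * ennreal (\<rho> ^ (?N - 1)) * indicator {0..} \<rho> \<partial>lborel)"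
        by (rule nn_integral_cmult) measurable
      also have "\<dots> = ennreal (K1 * m) * ennreal a"
        unfolding aint using K1 m \<sigma> by (simp add: ennreal_mult less_imp_le mult.assoc)
      also have "\<dots> = ennreal (K1 * m * a)" using K1 m a by (simp add: ennreal_mult)
      finally show ?thesis .
    qed
    then have HL: "H \<in> L2" by (auto simp: L2_def intro: le_less_trans)
    have eH: "enn2real (energy H) \<le> K1 * m * a"
      using EH K1 m a by (intro enn2real_leI) auto
    have "(\<integral>\<^sup>+t. ennreal (norm (wave_piece s g n (t, x)) powr q) \<partial>lborel) = (\<integral>\<^sup>+t. ennreal (norm (\<integral>\<rho>. cis (- (t * \<rho>\<^sup>2)) * H \<rho> \<partial>lborel) powr q) \<partial>lborel)"
      by (simp only: wave_piece_radial[OF g E] H_def)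
    also have "\<dots> \<le> ennreal (pi * ?L powr (q / 2 - 2) * enn2real (energy H) powr (q / 2))"
      by (rule band_time_bound(2)[OF _ HL _ q]) (auto simp: H_def band_def split: split_indicator_asm)
    also have "\<dots> \<le> ennreal (pi * ?L powr (q / 2 - 2) * (K1 * m * a) powr (q / 2))"
      using q eH by (intro ennreal_leI mult_left_mono powr_mono2) auto
    also have "(K1 * m * a) powr (q / 2) = K1 powr (q / 2) * (?L powr ((2 * s + (real ?N - 1)) * (q / 2)) * mean_bound ?N (?L * ?r) powr q) * a powr (q / 2)"
    proof -
      have "((mean_bound ?N (?L * ?r))\<^sup>2) powr (q / 2) = (mean_bound ?N (?L * ?r) powr 2) powr (q / 2)"
        by (simp add: mean_bound_nonneg)
      also have "\<dots> = mean_bound ?N (?L * ?r) powr q" by (simp add: powr_powr)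
      finally have mm: "((mean_bound ?N (?L * ?r))\<^sup>2) powr (q / 2) = mean_bound ?N (?L * ?r) powr q" .
      have "(K1 * m * a) powr (q / 2) = K1 powr (q / 2) * m powr (q / 2) * a powr (q / 2)"
        using K1 m a by (simp add: powr_mult)
      also have "m powr (q / 2) = (?L powr (2 * s + (real ?N - 1))) powr (q / 2) * ((mean_bound ?N (?L * ?r))\<^sup>2) powr (q / 2)"
        unfolding m_def by (rule powr_mult)
      finally show ?thesis by (simp only: mm powr_powr)
    qed
    also have "pi * ?L powr (q / 2 - 2) * (K1 powr (q / 2) * (?L powr ((2 * s + (real ?N - 1)) * (q / 2)) * mean_bound ?N (?L * ?r) powr q) * a powr (q / 2))
      = K * ?L powr (q / 2 - 2 + (2 * s + (real ?N - 1)) * (q / 2)) * mean_bound ?N (?L * ?r) powr q * a powr (q / 2)"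
      by (simp only: K_def powr_add mult_ac)
    finally show ?thesis unfolding a_def .
  qed
  with K show ?thesis by blast
qed

section \<open>Summation over the bands\<close>

lemma ennreal_le_suminf: "f n \<le> (\<Sum>n. f n :: ennreal)"
  using sum_le_suminf[OF summableI, of "{n}" f] by simp

text \<open>
  Each term is at most \<open>T powr (1 / q)\<close> divided by its weight.  In the application the
  weights grow geometrically on either side of the band that dominates at the given radius.
\<close>
lemma suminf_le_weighted_sup:
  fixes u W :: "nat \<Rightarrow> real"
  assumes q: "q > 0" and u: "\<And>n. u n \<ge> 0" and W: "\<And>n. W n > 0" 
    and T: "(\<Sum>n. ennreal ((W n * u n) powr q)) = ennreal T" "T \<ge> 0"
    and C: "(\<Sum>n. ennreal (1 / W n)) \<le> ennreal C" "C \<ge> 0"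
  shows "(\<Sum>n. ennreal (u n)) \<le> ennreal (C * T powr (1 / q))"
proof -
  have le: "u n \<le> T powr (1 / q) * (1 / W n)" for n
  proof -
    have "ennreal ((W n * u n) powr q) \<le> ennreal T"
      using ennreal_le_suminf[of "\<lambda>n. ennreal ((W n * u n) powr q)" n] by (simp only: T(1))
    then have "(W n * u n) powr q \<le> T" by (rule ennreal_le_iff[THEN iffD1, OF T(2)])
    then have "((W n * u n) powr q) powr (1 / q) \<le> T powr (1 / q)" using q by (intro powr_mono2) auto
    moreover have "((W n * u n) powr q) powr (1 / q) = W n * u n"
    proof -
      have "((W n * u n) powr q) powr (1 / q) = (W n * u n) powr (q * (1 / q))" by (rule powr_powr)
      also have "q * (1 / q) = 1" using q by simp
      also have "(W n * u n) powr 1 = W n * u n"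
        using u[of n] less_imp_le[OF W[of n]] by (intro powr_one mult_nonneg_nonneg)
      finally show ?thesis .
    qed
    ultimately have "u n * W n \<le> T powr (1 / q)" by (simp only: mult.commute)
    then have "u n \<le> T powr (1 / q) / W n" unfolding pos_le_divide_eq[OF W] .
    then show ?thesis by simp
  qed
  have "(\<Sum>n. ennreal (u n)) \<le> (\<Sum>n. ennreal (T powr (1 / q)) * ennreal (1 / W n))"
  proof (intro suminf_le summableI)
    fix n
    have "ennreal (u n) \<le> ennreal (T powr (1 / q) * (1 / W n))" by (rule ennreal_leI[OF le])
    also have "\<dots> = ennreal (T powr (1 / q)) * ennreal (1 / W n)" using W[of n] by (intro ennreal_mult) auto
    finally show "ennreal (u n) \<le> ennreal (T powr (1 / q)) * ennreal (1 / W n)" .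
  qed
  also have "\<dots> = ennreal (T powr (1 / q)) * (\<Sum>n. ennreal (1 / W n))" by (rule ennreal_suminf_cmult)
  also have "\<dots> \<le> ennreal (T powr (1 / q)) * ennreal C" by (intro mult_left_mono C) simp
  also have "\<dots> = ennreal (C * T powr (1 / q))" using C by (simp add: ennreal_mult mult.commute)
  finally show ?thesis .
qed

lemma AE_snd_nonzero: "AE z in (lborel :: (real \<times> 'a::euclidean_space) measure). snd z \<noteq> 0"
proof -
  have "AE z in (lborel :: real measure) \<Otimes>\<^sub>M (lborel :: 'a measure). snd z \<noteq> 0"
  proof (rule lborel_pair.AE_pair_measure)
    show "{z \<in> space ((lborel :: real measure) \<Otimes>\<^sub>M (lborel :: 'a measure)). snd z \<noteq> 0} \<in> sets (lborel \<Otimes>\<^sub>M lborel)"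
      by measurable
    show "AE x in (lborel :: real measure). AE y in lborel. snd (x, y) \<noteq> (0 :: 'a)"
      using AE_lborel_singleton[of "0::'a"] by simp
  qed
  then show ?thesis unfolding lborel_prod .
qed

lemma nn_integral_scaled_weight:
  fixes f :: "real \<Rightarrow> real"
  assumes [measurable]: "f \<in> borel_measurable borel" and f: "\<And>y. f y \<ge> 0" and L: "L > 0"
  shows "(\<integral>\<^sup>+x. ennreal (norm x powr b * f (L * norm x)) \<partial>(lborel :: 'a::euclidean_space measure))
    = ennreal (L powr (- b - real DIM('a))) * (\<integral>\<^sup>+y. ennreal (norm y powr b * f (norm y)) \<partial>(lborel :: 'a measure))"
proof -
  have "(\<integral>\<^sup>+y. ennreal (norm y powr b * f (norm y)) \<partial>(lborel :: 'a measure))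
    = ennreal (\<bar>L\<bar> ^ DIM('a)) * (\<integral>\<^sup>+x. ennreal (norm (0 + L *\<^sub>R x) powr b * f (norm (0 + L *\<^sub>R x))) \<partial>(lborel :: 'a measure))"
    using L by (intro nn_integral_lborel_affine) auto
  also have "(\<integral>\<^sup>+x. ennreal (norm (0 + L *\<^sub>R x) powr b * f (norm (0 + L *\<^sub>R x))) \<partial>(lborel :: 'a measure))
    = (\<integral>\<^sup>+x. ennreal (L powr b) * ennreal (norm x powr b * f (L * norm x)) \<partial>(lborel :: 'a measure))"
    using L f by (intro nn_integral_cong) (simp add: powr_mult ennreal_mult[symmetric] mult.assoc)
  also have "\<dots> = ennreal (L powr b) * (\<integral>\<^sup>+x. ennreal (norm x powr b * f (L * norm x)) \<partial>(lborel :: 'a measure))"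
    by (rule nn_integral_cmult) measurable
  finally have eq: "(\<integral>\<^sup>+y. ennreal (norm y powr b * f (norm y)) \<partial>(lborel :: 'a measure))
    = ennreal (L powr (b + real DIM('a))) * (\<integral>\<^sup>+x. ennreal (norm x powr b * f (L * norm x)) \<partial>(lborel :: 'a measure))"
    using L by (simp add: powr_add powr_realpow ennreal_mult mult_ac)
  have "ennreal (L powr (- b - real DIM('a))) * ennreal (L powr (b + real DIM('a))) = 1"
  proof -
    have "L powr (- b - real DIM('a)) * L powr (b + real DIM('a)) = L powr ((- b - real DIM('a)) + (b + real DIM('a)))"
      by (rule powr_add[symmetric])
    also have "\<dots> = 1" using L by simp
    finally show ?thesis by (subst ennreal_mult[symmetric]) auto
  qed
  then show ?thesis unfolding eq by (simp add: mult.assoc[symmetric])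
qed

text \<open>
  Each term is at most \<open>E powr (p - 1) * a n\<close>.
\<close>
lemma suminf_powr_le:
  fixes a :: "nat \<Rightarrow> ennreal"
  assumes p: "p \<ge> 1" and E: "(\<Sum>n. a n) \<le> ennreal E" "E \<ge> 0"
  shows "(\<Sum>n. ennreal (enn2real (a n) powr p)) \<le> ennreal (E powr p)"
proof -
  have aE: "a n \<le> ennreal E" for n
    using ennreal_le_suminf[of a n] E(1) by (rule order_trans)
  have "(\<Sum>n. ennreal (enn2real (a n) powr p)) \<le> (\<Sum>n. ennreal (E powr (p - 1)) * a n)"
  proof (intro suminf_le summableI)
    fix n
    have "a n < top" using aE[of n] by (rule le_less_trans) simp
    then have an: "a n = ennreal (enn2real (a n))" by simp
    let ?r = "enn2real (a n)"
    have r: "0 \<le> ?r" "?r \<le> E" using aE[of n] E(2) by (auto intro: enn2real_leI)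
    have "?r powr p \<le> E powr (p - 1) * ?r"
    proof (cases "?r = 0")
      case False
      have "?r powr p = ?r powr ((p - 1) + 1)" by simp
      also have "\<dots> = ?r powr (p - 1) * ?r powr 1" by (rule powr_add)
      also have "?r powr 1 = ?r" using r by simp
      also have "?r powr (p - 1) * ?r \<le> E powr (p - 1) * ?r" using r p by (intro mult_right_mono powr_mono2) auto
      finally show ?thesis .
    qed simp
    then have "ennreal (?r powr p) \<le> ennreal (E powr (p - 1) * ?r)" by (rule ennreal_leI)
    also have "\<dots> = ennreal (E powr (p - 1)) * ennreal ?r" by (intro ennreal_mult r) simp
    finally show "ennreal (?r powr p) \<le> ennreal (E powr (p - 1)) * a n" using an by simp
  qed
  also have "\<dots> = ennreal (E powr (p - 1)) * (\<Sum>n. a n)" by (rule ennreal_suminf_cmult)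
  also have "\<dots> \<le> ennreal (E powr (p - 1)) * ennreal E" by (intro mult_left_mono E) simp
  also have "\<dots> = ennreal (E powr (p - 1) * E)" using E by (simp add: ennreal_mult)
  also have "E powr (p - 1) * E = E powr p"
  proof (cases "E = 0")
    case False
    have "E powr p = E powr ((p - 1) + 1)" by simp
    also have "\<dots> = E powr (p - 1) * E" using False E by (simp only: powr_add) simp
    finally show ?thesis by simp
  qed simp
  finally show ?thesis .
qed

lemma ennreal_mult_regroup:
  fixes a b c d e :: real
  assumes "0 \<le> a" "0 \<le> b" "0 \<le> c" "0 \<le> d" "0 \<le> e"
  shows "ennreal a * ennreal (b * c) = ennreal (a * b) * ennreal c"
    and "ennreal (a * b) * ennreal (c * d * e) = ennreal (c * e) * ennreal (a * (b * d))"
    and "ennreal (a * b * c) * (ennreal d * ennreal e) = ennreal ((b * d) * (a * e * c))"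
  using assms by (simp_all add: ennreal_mult mult_ac)

text \<open>
  The space-time estimate for the sum of the moduli of the pieces.  The function \<open>\<tau>\<close> is a constant times the power
  \<open>1 / q\<close> of the weighted sum \<open>T\<close>, set to 0 where \<open>T\<close> is infinite; finiteness of the integral of \<open>T\<close> shows that this
  happens on a null set only.
\<close>
lemma wave_majorant:
  fixes q \<alpha> s :: real
  assumes eq: "- \<alpha> - s + (real DIM('a::euclidean_space) + 2) / q = real DIM('a) / 2" and q: "2 \<le> q"
    and lo: "real DIM('a) / q - (real DIM('a) - 1) / 2 < \<alpha>" and hi: "\<alpha> < real DIM('a) / q"
  shows "\<exists>C>0. \<forall>g\<in>borel_measurable borel. energy (\<lambda>\<xi>::'a. g (norm \<xi>)) < \<infinity> \<longrightarrow>
    (\<exists>\<tau>::real \<times> 'a \<Rightarrow> real. \<tau> \<in> borel_measurable borel \<and> (\<forall>z. 0 \<le> \<tau> z) \<and>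
      (AE z in lborel. (\<Sum>n. ennreal (norm (wave_piece s g n z))) \<le> ennreal (\<tau> z)) \<and>
      (\<integral>\<^sup>+z. ennreal (norm (snd z) powr (- \<alpha> * q) * \<tau> z powr q) \<partial>lborel) \<le> ennreal (C * enn2real (energy (\<lambda>\<xi>::'a. g (norm \<xi>))) powr (q / 2)))"
proof -
  let ?N = "DIM('a)"
  have q0: "q > 0" using q by simp
  define m where "m = min (real ?N / q - \<alpha>) (\<alpha> - real ?N / q + (real ?N - 1) / 2)"
  \<comment> \<open>Half the distance of \<open>\<alpha>\<close> to the nearer end of its interval.\<close>
  define \<epsilon> where "\<epsilon> = m / 2"
  have m: "m > 0" using lo hi unfolding m_def by auto
  have eps: "\<epsilon> > 0" "\<epsilon> < real ?N / q - \<alpha>" "\<epsilon> < \<alpha> - real ?N / q + (real ?N - 1) / 2"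
  proof -
    have "\<epsilon> < m" using m unfolding \<epsilon>_def by simp
    then show "\<epsilon> < real ?N / q - \<alpha>" "\<epsilon> < \<alpha> - real ?N / q + (real  ?N - 1) / 2" unfolding m_def by auto
    show "\<epsilon> > 0" using m unfolding \<epsilon>_def by simp
  qed
  obtain C3 where C3: "C3 > 0" "\<And>r. r > 0 \<Longrightarrow> (\<Sum>n. ennreal (1 / dist_to_scale \<epsilon> (scale n * r))) \<le> ennreal C3"
    using suminf_dist_to_scale[OF eps(1)] by blast
  let ?f = "\<lambda>y. (dist_to_scale \<epsilon> y * mean_bound ?N y) powr q"
  have fm [measurable]: "?f \<in> borel_measurable borel" unfolding dist_to_scale_def mean_bound_def by measurable
  have [measurable]: "dist_to_scale \<epsilon> \<in> borel_measurable borel" unfolding dist_to_scale_def[abs_def] by measurable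
  have [measurable]: "mean_bound ?N \<in> borel_measurable borel" unfolding mean_bound_def[abs_def] by measurable
  obtain K3 where K3: "K3 \<ge> 0" "(\<integral>\<^sup>+y. ennreal (norm y powr (- \<alpha> * q) * ?f (norm y)) \<partial>(lborel :: 'a measure)) = ennreal K3"
    using weight_integral_finite[OF q eps] unfolding infinity_ennreal_def less_top_ennreal by blast
  obtain K where K: "K > 0" and time: "\<And>g n (x::'a). g \<in> borel_measurable borel \<Longrightarrow> energy (\<lambda>\<xi>::'a. g (norm \<xi>)) < \<infinity> \<Longrightarrow> x \<noteq> 0 \<Longrightarrow>
    (\<integral>\<^sup>+t. ennreal (norm (wave_piece s g n (t, x)) powr q) \<partial>lborel) \<le>
     ennreal (K * scale n powr (q / 2 - 2 + (2 * s + (real ?N - 1)) * (q / 2)) * mean_bound ?N (scale n * norm x) powr q * enn2real (band_energy TYPE('a) g n) powr (q / 2))"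
    using wave_piece_time_bound[OF q, of s, where 'a = 'a] by blast
  \<comment> \<open>The scaling relation: the power of the scale in the time bound is \<open>n - \<alpha> q\<close>.\<close>
  have ex: "q / 2 - 2 + (2 * s + (real ?N - 1)) * (q / 2) = - (- \<alpha> * q) * (-1) + real ?N"
  proof -
    have "s = (real ?N + 2) / q - real ?N / 2 - \<alpha>" using eq by linarith
    then have "s * q = real ?N + 2 - real ?N / 2 * q - \<alpha> * q" using q0 by (simp add: field_simps)
    then show ?thesis by (simp add: field_simps)
  qed
  define C where "C = C3 powr q * (K * K3) + 1"
  have Cp: "C > 0" using K K3 unfolding C_def by (simp add: add_nonneg_pos)
  have "\<exists>\<tau>::real \<times> 'a \<Rightarrow> real. \<tau> \<in> borel_measurable borel \<and> (\<forall>z. 0 \<le> \<tau> z) \<and>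
      (AE z in lborel. (\<Sum>n. ennreal (norm (wave_piece s g n z))) \<le> ennreal (\<tau> z)) \<and>
      (\<integral>\<^sup>+z. ennreal (norm (snd z) powr (- \<alpha> * q) * \<tau> z powr q) \<partial>lborel) \<le> ennreal (C * enn2real (energy (\<lambda>\<xi>::'a. g (norm \<xi>))) powr (q / 2))"
    if g [measurable]: "g \<in> borel_measurable borel" and E: "energy (\<lambda>\<xi>::'a. g (norm \<xi>)) < \<infinity>" for g
  proof -
    let ?u = "\<lambda>n z. norm (wave_piece s g n (z :: real \<times> 'a))"
    let ?W = "\<lambda>n (z :: real \<times> 'a). dist_to_scale \<epsilon> (scale n * norm (snd z))"
    have Wpos: "?W n z > 0" if "snd z \<noteq> 0" for n z
    proof -
      have "max (scale n * norm (snd z)) (1 / (scale n * norm (snd z))) > 0" using that by (simp add: less_max_iff_disj)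
      then show ?thesis unfolding dist_to_scale_def by simp
    qed
    have sndm [measurable]: "snd \<in> borel_measurable (borel :: (real \<times> 'a) measure)"
      by (intro borel_measurable_continuous_onI continuous_intros)
    define e where "e = enn2real (energy (\<lambda>\<xi>::'a. g (norm \<xi>)))"
    have e: "e \<ge> 0" "energy (\<lambda>\<xi>::'a. g (norm \<xi>)) = ennreal e" using E by (auto simp: e_def)
    define a where "a n = enn2real (band_energy TYPE('a) g n)" for n
    have asum: "(\<Sum>n. ennreal (a n powr (q / 2))) \<le> ennreal (e powr (q / 2))"
      unfolding a_def using suminf_band_energy_le[of g, where 'a = 'a] q e
      by (intro suminf_powr_le) auto
    define T where "T z = (\<Sum>n. ennreal ((?W n z * ?u n z) powr q))" for z
    have Tm [measurable]: "T \<in> borel_measurable borel" unfolding T_def[abs_def] by measurable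
    have piece: "(\<integral>\<^sup>+z. ennreal (norm (snd z) powr (- \<alpha> * q)) * ennreal ((?W n z * ?u n z) powr q) \<partial>lborel) \<le> ennreal (K * K3) * ennreal (a n powr (q / 2))" for n
    proof -
      let ?L = "scale n"
      let ?G = "\<lambda>z. ennreal (norm (snd z) powr (- \<alpha> * q)) * ennreal ((?W n z * ?u n z) powr q)"
      have Gm: "?G \<in> borel_measurable (lborel \<Otimes>\<^sub>M lborel)"
        unfolding lborel_prod by measurable
      have "(\<integral>\<^sup>+z. ?G z \<partial>lborel) = (\<integral>\<^sup>+z. ?G z \<partial>(lborel \<Otimes>\<^sub>M lborel))" by (simp only: lborel_prod)
      also have "\<dots> = (\<integral>\<^sup>+x. \<integral>\<^sup>+t. ?G (t, x) \<partial>lborel \<partial>lborel)"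
        by (rule lborel_pair.nn_integral_snd[OF Gm, symmetric])
      also have "\<dots> \<le> (\<integral>\<^sup>+x. ennreal (K * ?L powr (- (- \<alpha> * q) * (-1) + real ?N) * a n powr (q / 2)) * ennreal (norm x powr (- \<alpha> * q) * ?f (?L * norm x)) \<partial>(lborel :: 'a measure))"
      proof (rule nn_integral_mono_AE)
        have "AE x in lborel. x \<noteq> (0::'a)" by (rule AE_lborel_singleton)
        then show "AE x in lborel. (\<integral>\<^sup>+t. ?G (t, x) \<partial>lborel) \<le> ennreal (K * ?L powr (- (- \<alpha> * q) * (-1) + real ?N) * a n powr (q / 2)) * ennreal (norm x powr (- \<alpha> * q) * ?f (?L * norm (x::'a)))"
        proof eventually_elim
          case (elim x)
          let ?w = "dist_to_scale \<epsilon> (?L * norm x)"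
          have w: "?w > 0" using Wpos[of "(0, x)" n] elim by simp
          have "(\<integral>\<^sup>+t. ?G (t, x) \<partial>lborel) = (\<integral>\<^sup>+t. ennreal (norm x powr (- \<alpha> * q) * ?w powr q) * ennreal (?u n (t, x) powr q) \<partial>lborel)"
            unfolding fst_conv snd_conv powr_mult by (intro nn_integral_cong ennreal_mult_regroup(1)[OF _ _ _ order_refl order_refl]) auto
          also have "\<dots> = ennreal (norm x powr (- \<alpha> * q) * ?w powr q) * (\<integral>\<^sup>+t. ennreal (?u n (t, x) powr q) \<partial>lborel)"
          proof (rule nn_integral_cmult)
            have "(\<lambda>t::real. (t, x)) \<in> borel_measurable lborel"
              unfolding measurable_lborel2 by (intro borel_measurable_continuous_onI continuous_intros)
            from measurable_compose[OF this wave_piece_measurable[OF g]]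
            have "(\<lambda>t. wave_piece s g n (t, x)) \<in> borel_measurable lborel" .
            then show "(\<lambda>t. ennreal (?u n (t, x) powr q)) \<in> borel_measurable lborel"
              by (rule measurable_compose[where g = "\<lambda>y. ennreal (norm y powr q)"]) measurable
          qed
          also have "\<dots> \<le> ennreal (norm x powr (- \<alpha> * q) * ?w powr q) * ennreal (K * ?L powr (- (- \<alpha> * q) * (-1) + real ?N) * mean_bound ?N (?L * norm x) powr q * a n powr (q / 2))"
            unfolding a_def ex[symmetric] by (intro mult_left_mono time[OF g E elim]) simp
          also have "\<dots> = ennreal (K * ?L powr (- (- \<alpha> * q) * (-1) + real ?N) * a n powr (q / 2)) * ennreal (norm x powr (- \<alpha> * q) * ?f (?L * norm x))"
            unfolding powr_mult using K by (intro ennreal_mult_regroup(2)) auto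
          finally show ?case .
        qed
      qed
      also have "\<dots> = ennreal (K * ?L powr (- (- \<alpha> * q) * (-1) + real ?N) * a n powr (q / 2)) * (\<integral>\<^sup>+x. ennreal (norm x powr (- \<alpha> * q) * ?f (?L * norm x)) \<partial>(lborel :: 'a measure))"
        by (rule nn_integral_cmult) measurable
      also have "(\<integral>\<^sup>+x. ennreal (norm x powr (- \<alpha> * q) * ?f (?L * norm x)) \<partial>(lborel :: 'a measure)) = ennreal (?L powr (- (- \<alpha> * q) - real ?N)) * ennreal K3"
        unfolding K3(2)[symmetric] by (rule nn_integral_scaled_weight[OF fm]) auto
      also have "ennreal (K * ?L powr (- (- \<alpha> * q) * (-1) + real ?N) * a n powr (q / 2)) * (ennreal (?L powr (- (- \<alpha> * q) - real ?N)) * ennreal K3)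
        = ennreal ((?L powr (- (- \<alpha> * q) * (-1) + real ?N) * ?L powr (- (- \<alpha> * q) - real ?N)) * (K * K3 * a n powr (q / 2)))"
        using K K3 by (intro ennreal_mult_regroup(3)) auto
      also have "?L powr (- (- \<alpha> * q) * (-1) + real ?N) * ?L powr (- (- \<alpha> * q) - real ?N) = 1"
        by (subst powr_add[symmetric]) (use less_imp_neq[OF scale_pos[of n]] in simp)
      also have "ennreal (1 * (K * K3 * a n powr (q / 2))) = ennreal (K * K3) * ennreal (a n powr (q / 2))"
        using K K3 by (simp add: ennreal_mult)
      finally show ?thesis .
    qed
    have Tint: "(\<integral>\<^sup>+z. ennreal (norm (snd z) powr (- \<alpha> * q)) * T z \<partial>lborel) \<le> ennreal (K * K3 * e powr (q / 2))"
    proof -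
      have "(\<integral>\<^sup>+z. ennreal (norm (snd z) powr (- \<alpha> * q)) * T z \<partial>lborel) = (\<integral>\<^sup>+z. (\<Sum>n. ennreal (norm (snd z) powr (- \<alpha> * q)) * ennreal ((?W n z * ?u n z) powr q)) \<partial>lborel)"
        unfolding T_def by simp
      also have "\<dots> = (\<Sum>n. \<integral>\<^sup>+z. ennreal (norm (snd z) powr (- \<alpha> * q)) * ennreal ((?W n z * ?u n z) powr q) \<partial>lborel)"
        by (rule nn_integral_suminf) measurable
      also have "\<dots> \<le> (\<Sum>n. ennreal (K * K3) * ennreal (a n powr (q / 2)))"
        by (intro suminf_le summableI piece)
      also have "\<dots> = ennreal (K * K3) * (\<Sum>n. ennreal (a n powr (q / 2)))" by (rule ennreal_suminf_cmult)
      also have "\<dots> \<le> ennreal (K * K3) * ennreal (e powr (q / 2))" by (intro mult_left_mono asum) simp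
      also have "\<dots> = ennreal (K * K3 * e powr (q / 2))" using K K3 by (simp add: ennreal_mult)
      finally show ?thesis .
    qed
    have Tfin: "AE z in lborel. T z < \<infinity> \<and> snd z \<noteq> 0"
    proof -
      have "AE z in lborel. ennreal (norm (snd z) powr (- \<alpha> * q)) * T z \<noteq> \<infinity>"
        using Tint by (intro nn_integral_PInf_AE) (auto simp: top_unique)
      then show ?thesis using AE_snd_nonzero
      proof eventually_elim
        case (elim z)
        then show ?case by (auto simp: ennreal_mult_eq_top_iff less_top[symmetric])
      qed
    qed
    define \<tau> where "\<tau> z = C3 * enn2real (T z) powr (1 / q)" for z
    have "\<tau> \<in> borel_measurable borel" unfolding \<tau>_def[abs_def] by measurable
    moreover have "\<forall>z. 0 \<le> \<tau> z" using C3 by (simp add: \<tau>_def)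
    moreover have "AE z in lborel. (\<Sum>n. ennreal (?u n z)) \<le> ennreal (\<tau> z)"
      using Tfin
    proof eventually_elim
      case (elim z)
      then have T: "T z = ennreal (enn2real (T z))" and r: "norm (snd z) > 0" by auto
      have TT: "(\<Sum>n. ennreal ((?W n z * ?u n z) powr q)) = ennreal (enn2real (T z))"
        using T unfolding T_def .
      show ?case unfolding \<tau>_def
        using elim
        by (intro suminf_le_weighted_sup[OF q0 norm_ge_zero Wpos TT enn2real_nonneg C3(2)[OF r] less_imp_le[OF C3(1)]]) simp
    qed
    moreover have "(\<integral>\<^sup>+z. ennreal (norm (snd z) powr (- \<alpha> * q) * \<tau> z powr q) \<partial>lborel) \<le> ennreal (C * e powr (q / 2))"
    proof -
      have "(\<integral>\<^sup>+z. ennreal (norm (snd z) powr (- \<alpha> * q) * \<tau> z powr q) \<partial>lborel) = (\<integral>\<^sup>+z. ennreal (C3 powr q) * (ennreal (norm (snd z) powr (- \<alpha> * q)) * T z) \<partial>lborel)"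
      proof (rule nn_integral_cong_AE)
        from Tfin show "AE z in lborel. ennreal (norm (snd z) powr (- \<alpha> * q) * \<tau> z powr q) = ennreal (C3 powr q) * (ennreal (norm (snd z) powr (- \<alpha> * q)) * T z)"
        proof eventually_elim
          case (elim z)
          then obtain x where x: "x \<ge> 0" "T z = ennreal x"
            unfolding infinity_ennreal_def less_top_ennreal by blast
          have "\<tau> z powr q = C3 powr q * x"
            unfolding \<tau>_def using x C3 q0 by (simp add: powr_mult powr_powr)
          then show ?case unfolding x(2) using x(1) by (simp add: ennreal_mult[symmetric] mult_ac)
        qed
      qed
      also have "\<dots> = ennreal (C3 powr q) * (\<integral>\<^sup>+z. ennreal (norm (snd z) powr (- \<alpha> * q)) * T z \<partial>lborel)"
        by (rule nn_integral_cmult) measurable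
      also have "\<dots> \<le> ennreal (C3 powr q) * ennreal (K * K3 * e powr (q / 2))"
        by (intro mult_left_mono Tint) simp
      also have "\<dots> = ennreal (C3 powr q * (K * K3) * e powr (q / 2))"
        using K K3 by (simp add: ennreal_mult[symmetric] mult_ac)
      also have "\<dots> \<le> ennreal (C * e powr (q / 2))"
        unfolding C_def by (intro ennreal_leI mult_right_mono) auto
      finally show ?thesis .
    qed
    ultimately show ?thesis unfolding e_def by blast
  qed
  with Cp show ?thesis by blast
qed

section \<open>The sum of the pieces as a tempered distribution\<close>

text \<open>
  A crude form of Young's inequality: either \<open>b \<le> a powr (q - 1)\<close>, and the first term dominates, or the second one does.
\<close>
lemma mult_le_powr_add_powr:
  fixes a b q :: real
  assumes a: "a \<ge> 0" and b: "b \<ge> 0" and q: "q > 1"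
  shows "a * b \<le> a powr q + b powr (q / (q - 1))"
proof (cases "b \<le> a powr (q - 1)")
  case True
  have "a * b \<le> a * a powr (q - 1)" using a True by (rule mult_left_mono[rotated])
  also have "\<dots> = a powr q"
  proof (cases "a = 0")
    case False
    have "a powr q = a powr (1 + (q - 1))" by simp
    also have "\<dots> = a powr 1 * a powr (q - 1)" by (rule powr_add)
    finally show ?thesis using a by simp
  qed simp
  finally show ?thesis by (simp add: add_increasing2)
next
  case False
  then have "(a powr (q - 1)) powr (1 / (q - 1)) \<le> b powr (1 / (q - 1))" using q by (intro powr_mono2) auto
  moreover have "(a powr (q - 1)) powr (1 / (q - 1)) = a"
  proof -
    have "(a powr (q - 1)) powr (1 / (q - 1)) = a powr ((q - 1) * (1 / (q - 1)))" by (rule powr_powr)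
    also have "(q - 1) * (1 / (q - 1)) = 1" using q by simp
    finally show ?thesis using a by simp
  qed
  ultimately have "a * b \<le> b powr (1 / (q - 1)) * b powr 1" using b by (simp add: mult_right_mono)
  also have "\<dots> = b powr (1 / (q - 1) + 1)" by (rule powr_add[symmetric])
  also have "1 / (q - 1) + 1 = q / (q - 1)" using q by (simp add: field_simps)
  finally show ?thesis by (simp add: add_increasing)
qed

lemma schwartz_weighted_power_integral:
  fixes \<psi> :: "real^'n \<Rightarrow> complex"
  assumes \<psi>: "\<psi> \<in> schwartz" and p: "p > 0" and \<alpha>: "\<alpha> * p > - real DIM(real^'n)"
  shows "(\<integral>\<^sup>+x. ennreal ((norm x powr \<alpha> * norm (\<psi> x)) powr p) \<partial>lborel) < \<infinity>"
proof -
  note [measurable] = schwartz_L1_L2(1)[OF \<psi>]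
  let ?N = "real DIM(real^'n)"
  \<comment> \<open>Enough decay to beat the weight at infinity.\<close>
  obtain k :: nat where k: "real k > \<alpha> + ?N / p" using reals_Archimedean2 by blast
  obtain C0 where C0: "C0 \<ge> 0" "\<And>x. norm (\<psi> x) \<le> C0 * (1 + norm x) powr (- real 0)"
    using schwartz_decay[OF \<psi>, of "[]" 0] by auto
  obtain C1 where C1: "C1 \<ge> 0" "\<And>x. norm (\<psi> x) \<le> C1 * (1 + norm x) powr (- real k)"
    using schwartz_decay[OF \<psi>, of "[]" k] by auto
  define C where "C = max C0 C1"
  have C: "C \<ge> 0" "C0 \<le> C" "C1 \<le> C" using C0 by (auto simp: C_def)
  show ?thesis
  proof (rule nn_integral_two_powers[where a = "\<alpha> * p" and b = "(\<alpha> - real k) * p" and C = "C powr p"])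
    have "(\<alpha> + ?N / p) * p < real k * p" using k p by (rule mult_strict_right_mono)
    then show "(\<alpha> - real k) * p < - ?N" using p by (simp add: algebra_simps)
    fix x :: "real^'n"
    {
      have "(1 + norm x) powr 0 \<le> 1" by simp
      then have "norm (\<psi> x) \<le> C" using C0(2)[of x] C(2) C0(1) by (auto split: if_splits)
      then have "(norm x powr \<alpha> * norm (\<psi> x)) powr p \<le> (norm x powr \<alpha> * C) powr p"
        using p by (intro powr_mono2 mult_left_mono) auto
      also have "\<dots> = C powr p * norm x powr (\<alpha> * p)" by (simp add: powr_mult powr_powr)
      finally show "(norm x powr \<alpha> * norm (\<psi> x)) powr p \<le> C powr p * norm x powr (\<alpha> * p)" .
    next
      assume x: "1 \<le> norm x"
      have "(1 + norm x) powr (- real k) \<le> norm x powr (- real k)" using x by (intro powr_mono2') auto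
      then have "norm (\<psi> x) \<le> C * norm x powr (- real k)"
        using C1 C by (intro order_trans[OF C1(2)[of x]] mult_mono) auto
      then have "norm x powr \<alpha> * norm (\<psi> x) \<le> norm x powr \<alpha> * (C * norm x powr (- real k))" by (intro mult_left_mono) auto
      also have "\<dots> = C * norm x powr (\<alpha> + - real k)" by (simp only: powr_add mult_ac)
      finally have "(norm x powr \<alpha> * norm (\<psi> x)) powr p \<le> (C * norm x powr (\<alpha> + - real k)) powr p"
        using p by (intro powr_mono2) auto
      also have "\<dots> = C powr p * norm x powr ((\<alpha> - real k) * p)" by (simp add: powr_mult powr_powr)
      finally show "(norm x powr \<alpha> * norm (\<psi> x)) powr p \<le> C powr p * norm x powr ((\<alpha> - real k) * p)" .
    }
  qed (use \<alpha> C in auto)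
qed

lemma inverse_fourier_measurable:
  fixes f :: "real^'n \<Rightarrow> complex"
  assumes "f \<in> borel_measurable borel"
  shows "inverse_fourier f \<in> borel_measurable borel"
  unfolding inverse_fourier_def[abs_def]
  by (rule measurable_compose[OF _ fourier_measurable[OF assms]]) simp

lemma fourier_reflect:
  fixes f :: "real^'n \<Rightarrow> complex"
  assumes [measurable]: "f \<in> borel_measurable borel"
  shows "fourier (\<lambda>x. f (- x)) \<xi> = fourier f (- \<xi>)"
proof -
  have "(\<integral>x. cis (- (\<xi> \<bullet> x)) * f (- x) \<partial>lborel) = (\<integral>x. cis (- ((- \<xi>) \<bullet> (0 - x))) * f (0 - x) \<partial>lborel)" by simp
  also have "\<dots> = (\<integral>x. cis (- ((- \<xi>) \<bullet> x)) * f x \<partial>lborel)"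
    by (rule integral_lborel_reflect(1)[where f = "\<lambda>x. cis (- ((- \<xi>) \<bullet> x)) * f x"]) measurable
  finally show ?thesis unfolding fourier_eq by simp
qed

lemma wave_piece_pairing:
  fixes \<psi> :: "real^'n \<Rightarrow> complex"
  assumes g [measurable]: "g \<in> borel_measurable borel" and E: "energy (\<lambda>\<xi>::real^'n. g (norm \<xi>)) < \<infinity>"
    and \<psi>: "integrable lborel \<psi>"
  shows "(\<integral>x. wave_piece s g n (t, x) * \<psi> x \<partial>lborel) = (\<integral>\<xi>. band_freq s g n t (norm \<xi>) * inverse_fourier \<psi> \<xi> \<partial>lborel)"
proof -
  have [measurable]: "\<psi> \<in> borel_measurable borel" using \<psi> by auto
  let ?F = "\<lambda>\<xi>::real^'n. band_freq s g n t (norm \<xi>)"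
  have [measurable]: "?F \<in> borel_measurable borel" unfolding band_freq_def by measurable
  have wp: "wave_piece s g n (t, x) = fourier ?F (- x)" for x
    by (simp add: wave_piece_def fourier_eq)
  have i: "integrable lborel (\<lambda>x. \<psi> (0 - x))" by (subst integral_lborel_reflect(2)) (use \<psi> in auto)
  have "(\<integral>x. wave_piece s g n (t, x) * \<psi> x \<partial>lborel) = (\<integral>x. fourier ?F (0 - x) * \<psi> (0 - (0 - x)) \<partial>lborel)"
    by (simp add: wp)
  also have "\<dots> = (\<integral>x. fourier ?F x * \<psi> (0 - x) \<partial>lborel)"
    by (rule integral_lborel_reflect(1)[where f = "\<lambda>x. fourier ?F x * \<psi> (0 - x)"]) measurable
  also have "\<dots> = (\<integral>\<xi>. ?F \<xi> * fourier (\<lambda>x. \<psi> (0 - x)) \<xi> \<partial>lborel)"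
    by (rule fourier_multiplication_L1[OF band_freq_L2_L1(2)[OF g E] i])
  also have "\<dots> = (\<integral>\<xi>. ?F \<xi> * inverse_fourier \<psi> \<xi> \<partial>lborel)"
    by (simp add: fourier_reflect inverse_fourier_def)
  finally show ?thesis .
qed

lemma sums_band: 
  assumes "\<rho> > 0"
  shows "(\<lambda>n. band_freq s g n t \<rho>) sums (complex_of_real (\<rho> powr s) * cis (- (t * \<rho>\<^sup>2)) * g \<rho>)"
proof -
  let ?n = "int_encode \<lfloor>log 2 \<rho>\<rfloor>"
  have mem: "\<rho> \<in> band n \<longleftrightarrow> n = ?n" for n
    unfolding mem_band_iff using assms by (metis int_decode_inverse int_encode_inverse)
  have "band_freq s g n t \<rho> = (if n = ?n then complex_of_real (\<rho> powr s) * cis (- (t * \<rho>\<^sup>2)) * g \<rho> else 0)" for n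
    unfolding band_freq_def indicator_def mem by simp
  then have "(\<lambda>n. band_freq s g n t \<rho>) = (\<lambda>n. if n = ?n then complex_of_real (\<rho> powr s) * cis (- (t * \<rho>\<^sup>2)) * g \<rho> else 0)"
    by (rule ext)
  then show ?thesis using sums_single[of ?n "\<lambda>_. complex_of_real (\<rho> powr s) * cis (- (t * \<rho>\<^sup>2)) * g \<rho>"] by simp
qed

lemma sums_integral_dominated:
  fixes f :: "nat \<Rightarrow> 'a::euclidean_space \<Rightarrow> complex"
  assumes [measurable]: "\<And>n. f n \<in> borel_measurable borel"
    and le: "AE x in lborel. (\<Sum>n. ennreal (norm (f n x))) \<le> ennreal (h x)"
    and h: "(\<integral>\<^sup>+x. ennreal (h x) \<partial>lborel) < \<infinity>"
  shows "integrable lborel (\<lambda>x. \<Sum>n. f n x)" "(\<lambda>n. \<integral>x. f n x \<partial>lborel) sums (\<integral>x. (\<Sum>n. f n x) \<partial>lborel)"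
proof -
  have tot: "(\<integral>\<^sup>+x. (\<Sum>n. ennreal (norm (f n x))) \<partial>lborel) < \<infinity>"
    using nn_integral_mono_AE[OF le] h by (rule le_less_trans)
  have sum: "(\<Sum>n. \<integral>\<^sup>+x. ennreal (norm (f n x)) \<partial>lborel) < \<infinity>"
    using tot by (subst (asm) nn_integral_suminf) auto
  have fi: "integrable lborel (f n)" for n
  proof (rule integrableI_bounded)
    show "(\<integral>\<^sup>+x. ennreal (norm (f n x)) \<partial>lborel) < \<infinity>"
      using ennreal_le_suminf[of "\<lambda>n. \<integral>\<^sup>+x. ennreal (norm (f n x)) \<partial>lborel" n] sum by (rule le_less_trans)
  qed simp
  have S1: "AE x in lborel. summable (\<lambda>n. norm (f n x))"
    using le
  proof eventually_elim
    case (elim x)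
    then have "(\<Sum>n. ennreal (norm (f n x))) \<noteq> top" using neq_top_trans[OF ennreal_neq_top] by blast
    then show ?case by (intro summable_suminf_not_top) auto
  qed
  have S2: "summable (\<lambda>n. \<integral>x. norm (f n x) \<partial>lborel)"
  proof (rule summable_suminf_not_top)
    have "(\<integral>\<^sup>+x. ennreal (norm (f n x)) \<partial>lborel) = ennreal (\<integral>x. norm (f n x) \<partial>lborel)" for n
      using fi[of n] by (intro nn_integral_eq_integral) auto
    then show "(\<Sum>n. ennreal (\<integral>x. norm (f n x) \<partial>lborel)) \<noteq> top" using sum by auto
  qed (auto intro: integral_nonneg_AE)
  show "integrable lborel (\<lambda>x. \<Sum>n. f n x)" by (rule integrable_suminf[OF fi S1 S2])
  show "(\<lambda>n. \<integral>x. f n x \<partial>lborel) sums (\<integral>x. (\<Sum>n. f n x) \<partial>lborel)" by (rule sums_integral[OF fi S1 S2])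
qed

text \<open>
  Inversion cancels the inner transform of the wave against the outer one in \<open>abs_D\<close>, which leaves the pairing
  in frequency space.
\<close>
lemma abs_D_schroedinger:
  fixes \<phi> \<psi> :: "real^'n \<Rightarrow> complex"
  assumes \<phi>: "\<phi> \<in> L2" and \<psi>: "\<psi> \<in> schwartz" and g [measurable]: "g \<in> borel_measurable borel" 
    and eq: "AE \<xi> in lborel. fourier_L2 \<phi> \<xi> = g (norm \<xi>)"
  shows "abs_D s (schroedinger t \<phi>) \<psi> = (\<integral>\<xi>. complex_of_real (norm \<xi> powr s) * cis (- (t * (norm \<xi>)\<^sup>2)) * g (norm \<xi>) * inverse_fourier \<psi> \<xi> \<partial>lborel)"
proof -
  note [measurable] = L2_D[OF fourier_L2_L2[OF \<phi>]] schwartz_L1_L2(1)[OF \<psi>]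
  define w where "w = (\<lambda>\<xi>. exp (- \<i> * complex_of_real (t * (norm \<xi>)\<^sup>2)) * fourier_L2 \<phi> \<xi>)"
  have w_cis: "w \<xi> = cis (- (t * (norm \<xi>)\<^sup>2)) * fourier_L2 \<phi> \<xi>" for \<xi> by (simp add: w_def cis_conv_exp)
  have [measurable]: "w \<in> borel_measurable borel" unfolding w_cis[abs_def] by measurable
  have w: "w \<in> L2" by (rule L2_bound[OF fourier_L2_L2[OF \<phi>]]) (auto simp: w_cis norm_mult)
  have S: "schroedinger t \<phi> = inverse_fourier_L2 w" by (simp add: schroedinger_def w_def)
  have SL: "inverse_fourier_L2 w \<in> L2" unfolding inverse_fourier_L2_def[abs_def] by (intro L2_reflect fourier_L2_L2 w)
  note [measurable] = L2_D[OF fourier_L2_L2[OF SL]]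
  note [measurable] = inverse_fourier_measurable[OF schwartz_L1_L2(1)[OF \<psi>]]
  show ?thesis
    unfolding abs_D_def S
  proof (rule integral_cong_AE)
    show "AE \<xi> in lborel. complex_of_real (norm \<xi> powr s) * fourier_L2 (inverse_fourier_L2 w) \<xi> * inverse_fourier \<psi> \<xi>
      = complex_of_real (norm \<xi> powr s) * cis (- (t * (norm \<xi>)\<^sup>2)) * g (norm \<xi>) * inverse_fourier \<psi> \<xi>"
      using fourier_L2_inversion[OF w] eq by eventually_elim (simp add: w_cis)
  qed measurable
qed

text \<open>
  The majorant times \<open>\<bar>\<psi>\<bar>\<close> is integrable by Young's inequality, with the weight \<open>\<bar>x\<bar> powr \<alpha>\<close> moved onto \<open>\<psi>\<close>; so the
  sum over the bands may be exchanged with the integral in \<open>x\<close>.  In frequency the exchange is dominated by the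
  integrand itself, since the bands are disjoint.
\<close>
lemma wave_pairing:
  fixes \<psi> :: "real^'n \<Rightarrow> complex"
  assumes \<psi>: "\<psi> \<in> schwartz" and g [measurable]: "g \<in> borel_measurable borel" 
    and E: "energy (\<lambda>\<xi>::real^'n. g (norm \<xi>)) < \<infinity>"
    and s: "- real CARD('n) / 2 < s" "s \<le> 1"
    and q: "q \<ge> 2" and \<alpha>: "real DIM(real^'n) / q - real DIM(real^'n) < \<alpha>"
    and \<tau> [measurable]: "\<tau> \<in> borel_measurable borel" and \<tau>0: "\<And>x. 0 \<le> \<tau> x"
    and le: "AE x in lborel. (\<Sum>n. ennreal (norm (wave_piece s g n (t, x :: real^'n)))) \<le> ennreal (\<tau> x)"
    and fin: "(\<integral>\<^sup>+x. ennreal (norm x powr (- \<alpha> * q) * \<tau> x powr q) \<partial>(lborel :: (real^'n) measure)) < \<infinity>"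
  shows "integrable lborel (\<lambda>x. (\<Sum>n. wave_piece s g n (t, x)) * \<psi> x)"
    and "(\<integral>x. (\<Sum>n. wave_piece s g n (t, x)) * \<psi> x \<partial>lborel) = (\<integral>\<xi>. complex_of_real (norm \<xi> powr s) * cis (- (t * (norm \<xi>)\<^sup>2)) * g (norm \<xi>) * inverse_fourier \<psi> \<xi> \<partial>lborel)"
proof -
  note [measurable] = schwartz_L1_L2(1)[OF \<psi>]
  let ?p = "q / (q - 1)"
  have q1: "q > 1" using q by simp
  have p: "?p > 0" using q1 by simp
  have ap: "\<alpha> * ?p > - real DIM(real^'n)"
  proof -
    let ?N = "real DIM(real^'n)"
    have "(?N / q - ?N) * ?p < \<alpha> * ?p" using \<alpha> p by (rule mult_strict_right_mono)
    moreover have "(?N / q - ?N) * ?p = - ?N"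
    proof -
      have "(?N / q - ?N) * ?p = ((?N / q - ?N) * q) / (q - 1)" by simp
      also have "(?N / q - ?N) * q = - ?N * (q - 1)" using q1 by (simp add: left_diff_distrib right_diff_distrib)
      also have "\<dots> / (q - 1) = - ?N" using q1 by simp
      finally show ?thesis .
    qed
    ultimately show ?thesis by simp
  qed
  have pm [measurable]: "(\<lambda>x::real^'n. wave_piece s g n (t, x)) \<in> borel_measurable borel" for n
  proof -
    have "(\<lambda>x::real^'n. (t, x)) \<in> borel_measurable borel" by (intro borel_measurable_continuous_onI continuous_intros)
    from measurable_compose[OF this wave_piece_measurable[OF g]] show ?thesis .
  qed
  have h: "(\<integral>\<^sup>+x. ennreal (\<tau> x * norm (\<psi> x)) \<partial>lborel) < \<infinity>"
  proof -
    have "(\<integral>\<^sup>+x. ennreal (\<tau> x * norm (\<psi> x)) \<partial>lborel) \<le> (\<integral>\<^sup>+x. ennreal (norm x powr (- \<alpha> * q) * \<tau> x powr q) + ennreal ((norm x powr \<alpha> * norm (\<psi> x)) powr ?p) \<partial>lborel)"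
    proof (rule nn_integral_mono_AE)
      have "AE x in lborel. x \<noteq> (0::real^'n)" by (rule AE_lborel_singleton)
      then show "AE x in lborel. ennreal (\<tau> x * norm (\<psi> x)) \<le> ennreal (norm x powr (- \<alpha> * q) * \<tau> x powr q) + ennreal ((norm (x::real^'n) powr \<alpha> * norm (\<psi> x)) powr ?p)"
      proof eventually_elim
        case (elim x)
        have "norm x powr (- \<alpha>) * norm x powr \<alpha> = norm x powr (- \<alpha> + \<alpha>)" by (rule powr_add[symmetric])
        then have one: "norm x powr (- \<alpha>) * norm x powr \<alpha> = 1" using elim by simp
        have "\<tau> x * norm (\<psi> x) = (norm x powr (- \<alpha>) * norm x powr \<alpha>) * (\<tau> x * norm (\<psi> x))" unfolding one by simp
        also have "\<dots> = (norm x powr (- \<alpha>) * \<tau> x) * (norm x powr \<alpha> * norm (\<psi> x))" by (simp only: mult_ac)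
        also have "\<dots> \<le> (norm x powr (- \<alpha>) * \<tau> x) powr q + (norm x powr \<alpha> * norm (\<psi> x)) powr ?p"
          using q1 \<tau>0 by (intro mult_le_powr_add_powr) auto
        also have "(norm x powr (- \<alpha>) * \<tau> x) powr q = norm x powr (- \<alpha> * q) * \<tau> x powr q" by (simp only: powr_mult powr_powr)
        finally have "ennreal (\<tau> x * norm (\<psi> x)) \<le> ennreal (norm x powr (- \<alpha> * q) * \<tau> x powr q + (norm x powr \<alpha> * norm (\<psi> x)) powr ?p)" by (rule ennreal_leI)
        then show ?case by (subst (asm) ennreal_plus) auto
      qed
    qed
    also have "\<dots> = (\<integral>\<^sup>+x. ennreal (norm x powr (- \<alpha> * q) * \<tau> x powr q) \<partial>lborel) + (\<integral>\<^sup>+x. ennreal ((norm x powr \<alpha> * norm (\<psi> x)) powr ?p) \<partial>lborel)"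
      by (rule nn_integral_add) measurable
    also have "\<dots> < \<infinity>" using fin schwartz_weighted_power_integral[OF \<psi> p ap] by simp
    finally show ?thesis .
  qed
  have le1: "AE x in lborel. (\<Sum>n. ennreal (norm (wave_piece s g n (t, x) * \<psi> x))) \<le> ennreal (\<tau> x * norm (\<psi> x))"
    using le
  proof eventually_elim
    case (elim x)
    have "(\<Sum>n. ennreal (norm (wave_piece s g n (t, x) * \<psi> x))) = (\<Sum>n. ennreal (norm (wave_piece s g n (t, x)))) * ennreal (norm (\<psi> x))"
      by (simp add: norm_mult ennreal_mult)
    also have "\<dots> \<le> ennreal (\<tau> x) * ennreal (norm (\<psi> x))" by (intro mult_right_mono elim) simp
    also have "\<dots> = ennreal (\<tau> x * norm (\<psi> x))" using \<tau>0 by (simp add: ennreal_mult)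
    finally show ?case .
  qed
  have m1: "(\<lambda>x. wave_piece s g n (t, x) * \<psi> x) \<in> borel_measurable borel" for n
    by (rule borel_measurable_times[OF pm schwartz_L1_L2(1)[OF \<psi>]])
  note A = sums_integral_dominated[OF m1 le1 h]
  have sm: "AE x in lborel. (\<Sum>n. wave_piece s g n (t, x) * \<psi> x) = (\<Sum>n. wave_piece s g n (t, x)) * \<psi> x"
    using le
  proof eventually_elim
    case (elim x)
    then have "(\<Sum>n. ennreal (norm (wave_piece s g n (t, x)))) \<noteq> top" using neq_top_trans[OF ennreal_neq_top] by blast
    then have "summable (\<lambda>n. norm (wave_piece s g n (t, x)))" by (intro summable_suminf_not_top) auto
    then show ?case by (rule suminf_mult2[symmetric, OF summable_norm_cancel])
  qed
  have mS: "(\<lambda>x. (\<Sum>n. wave_piece s g n (t, x)) * \<psi> x) \<in> borel_measurable lborel"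
    unfolding measurable_lborel2
    by (rule borel_measurable_times[OF borel_measurable_suminf[OF pm] schwartz_L1_L2(1)[OF \<psi>]])
  show "integrable lborel (\<lambda>x. (\<Sum>n. wave_piece s g n (t, x)) * \<psi> x)"
    by (rule integrable_cong_AE_imp[OF A(1) mS sm])
  have B1: "(\<lambda>n. \<integral>x. wave_piece s g n (t, x) * \<psi> x \<partial>lborel) sums (\<integral>x. (\<Sum>n. wave_piece s g n (t, x)) * \<psi> x \<partial>lborel)"
  proof -
    have "(\<integral>x. (\<Sum>n. wave_piece s g n (t, x) * \<psi> x) \<partial>lborel) = (\<integral>x. (\<Sum>n. wave_piece s g n (t, x)) * \<psi> x \<partial>lborel)"
      by (rule integral_cong_AE[OF borel_measurable_integrable[OF A(1)] mS sm])
    then show ?thesis using A(2) by simp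
  qed
  let ?F = "\<lambda>\<xi>::real^'n. complex_of_real (norm \<xi> powr s) * cis (- (t * (norm \<xi>)\<^sup>2)) * g (norm \<xi>) * inverse_fourier \<psi> \<xi>"
  note [measurable] = inverse_fourier_measurable[OF schwartz_L1_L2(1)[OF \<psi>]]
  have Fi: "integrable lborel ?F"
  proof -
    have "(\<lambda>\<xi>::real^'n. cis (- (t * (norm \<xi>)\<^sup>2)) * g (norm \<xi>)) \<in> L2"
      by (rule L2_bound[of "\<lambda>\<xi>. g (norm \<xi>)"]) (use E in \<open>auto simp: L2_def norm_mult\<close>)
    moreover have "(\<lambda>\<xi>. complex_of_real (norm \<xi> powr s) * inverse_fourier \<psi> \<xi>) \<in> L2"
      using L2_reflect[OF schwartz_fourier_powr_L2[OF \<psi> s]] by (simp add: inverse_fourier_def)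
    ultimately have "integrable lborel (\<lambda>\<xi>. (cis (- (t * (norm \<xi>)\<^sup>2)) * g (norm \<xi>)) * (complex_of_real (norm \<xi> powr s) * inverse_fourier \<psi> \<xi>))"
      by (rule L2_mult_integrable)
    then show ?thesis by (simp only: mult_ac)
  qed
  have m2: "(\<lambda>\<xi>::real^'n. band_freq s g n t (norm \<xi>) * inverse_fourier \<psi> \<xi>) \<in> borel_measurable borel" for n
    unfolding band_freq_def by measurable
  have bn: "norm (band_freq s g n t (norm \<xi>) * inverse_fourier \<psi> \<xi>) = indicator (band n) (norm \<xi>) * norm (?F \<xi>)" for n and \<xi> :: "real^'n"
    by (simp add: band_freq_def norm_mult split: split_indicator)
  have le2: "AE \<xi> in lborel. (\<Sum>n. ennreal (norm (band_freq s g n t (norm \<xi>) * inverse_fourier \<psi> \<xi>))) \<le> ennreal (norm (?F \<xi>))"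
  proof (rule AE_I2)
    fix \<xi> :: "real^'n"
    have "(\<Sum>n. ennreal (norm (band_freq s g n t (norm \<xi>) * inverse_fourier \<psi> \<xi>))) = (\<Sum>n. indicator (band n) (norm \<xi>) * ennreal (norm (?F \<xi>)))"
      unfolding bn by (intro suminf_cong) (simp split: split_indicator)
    also have "\<dots> = indicator {0<..} (norm \<xi>) * ennreal (norm (?F \<xi>))" by (simp add: suminf_band)
    also have "\<dots> \<le> ennreal (norm (?F \<xi>))" by (simp split: split_indicator)
    finally show "(\<Sum>n. ennreal (norm (band_freq s g n t (norm \<xi>) * inverse_fourier \<psi> \<xi>))) \<le> ennreal (norm (?F \<xi>))" .
  qed
  have h2: "(\<integral>\<^sup>+\<xi>. ennreal (norm (?F \<xi>)) \<partial>lborel) < \<infinity>" using Fi by (simp add: integrable_iff_bounded)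
  have B2: "(\<lambda>n. \<integral>\<xi>. band_freq s g n t (norm \<xi>) * inverse_fourier \<psi> \<xi> \<partial>lborel) sums (\<integral>\<xi>. ?F \<xi> \<partial>lborel)"
  proof -
    have "(\<integral>\<xi>. (\<Sum>n. band_freq s g n t (norm \<xi>) * inverse_fourier \<psi> \<xi>) \<partial>lborel) = (\<integral>\<xi>. ?F \<xi> \<partial>lborel)"
    proof (rule integral_cong_AE)
      have "AE \<xi> in lborel. \<xi> \<noteq> (0::real^'n)" by (rule AE_lborel_singleton)
      then show "AE \<xi> in lborel. (\<Sum>n. band_freq s g n t (norm \<xi>) * inverse_fourier \<psi> \<xi>) = ?F \<xi>"
      proof eventually_elim
        case (elim \<xi>)
        then have "norm \<xi> > 0" by simp
        from sums_mult2[OF sums_band[OF this, of s g t], of "inverse_fourier \<psi> \<xi>"] show ?case by (rule sums_unique[symmetric])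
      qed
      show "(\<lambda>\<xi>. \<Sum>n. band_freq s g n t (norm \<xi>) * inverse_fourier \<psi> \<xi>) \<in> borel_measurable lborel"
        unfolding measurable_lborel2 by (rule borel_measurable_suminf[OF m2])
      show "?F \<in> borel_measurable lborel" by (rule borel_measurable_integrable[OF Fi])
    qed
    then show ?thesis using sums_integral_dominated(2)[OF m2 le2 h2] by simp
  qed
  show "(\<integral>x. (\<Sum>n. wave_piece s g n (t, x)) * \<psi> x \<partial>lborel) = (\<integral>\<xi>. ?F \<xi> \<partial>lborel)"
    using B1 B2 unfolding wave_piece_pairing[OF g E schwartz_L1_L2(2)[OF \<psi>]] by (rule sums_unique2)
qed

section \<open>The space-time estimate\<close>

theorem theorem2p1:
  fixes q \<alpha> s :: real
  assumes "CARD('n::finite) \<ge> 2"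
    and "- \<alpha> - s + (real CARD('n) + 2) / q = real CARD('n) / 2"
    and "2 \<le> q"
    and "real CARD('n) / q - (real CARD('n) - 1) / 2 < \<alpha>"
    and "\<alpha> < real CARD('n) / q"
  shows "\<exists>C::real. C > 0 \<and> (\<forall>\<phi> :: real^'n \<Rightarrow> complex. \<phi> \<in> Lp_space 2 \<and> radially_symmetric \<phi> \<longrightarrow>
    (\<exists>u. represents u (\<lambda>t. abs_D s (schroedinger t \<phi>)) \<and>
      (\<lambda>(t, x). complex_of_real (norm x powr (- \<alpha>)) * u (t, x)) \<in> Lp_space q \<and>
      Lp_norm q (\<lambda>(t, x). complex_of_real (norm x powr (- \<alpha>)) * u (t, x)) \<le> C * Lp_norm 2 \<phi>))"
proof -
  let ?N = "real CARD('n)"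
  have N: "real DIM(real^'n) = ?N" by simp
  have q: "q \<ge> 2" and q0: "q > 0" using assms(3) by auto
  have N1: "?N \<ge> 1" using assms(1) by simp
  have s_eq: "s = (?N / q - \<alpha>) + 2 / q - ?N / 2"
    using assms(2) unfolding add_divide_distrib by linarith
  have s: "- ?N / 2 < s" "s \<le> 1"
  proof -
    have "2 / q > 0" "2 / q \<le> 1" using q by auto
    moreover have "?N / q - \<alpha> < ?N / 2 - 1 / 2" "0 < ?N / q - \<alpha>"
      using assms(4,5) unfolding diff_divide_distrib by linarith+
    ultimately show "- ?N / 2 < s" "s \<le> 1" unfolding s_eq by linarith+
  qed
  have \<alpha>: "real DIM(real^'n) / q - real DIM(real^'n) < \<alpha>"
    using assms(4) N1 unfolding N diff_divide_distrib by linarith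
  obtain C where C: "C > 0" and maj: "\<And>g. g \<in> borel_measurable borel \<Longrightarrow> energy (\<lambda>\<xi>::real^'n. g (norm \<xi>)) < \<infinity> \<Longrightarrow>
    (\<exists>\<tau>::real \<times> (real^'n) \<Rightarrow> real. \<tau> \<in> borel_measurable borel \<and> (\<forall>z. 0 \<le> \<tau> z) \<and>
      (AE z in lborel. (\<Sum>n. ennreal (norm (wave_piece s g n z))) \<le> ennreal (\<tau> z)) \<and>
      (\<integral>\<^sup>+z. ennreal (norm (snd z) powr (- \<alpha> * q) * \<tau> z powr q) \<partial>lborel) \<le> ennreal (C * enn2real (energy (\<lambda>\<xi>::real^'n. g (norm \<xi>))) powr (q / 2)))"
    using wave_majorant[where 'a = "real^'n", unfolded N, OF assms(2-5)] by blast
  define K where "K = C powr (1 / q) * sqrt 2"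
  have K: "K > 0" using C by (simp add: K_def)
  have "\<exists>u. represents u (\<lambda>t. abs_D s (schroedinger t \<phi>)) \<and>
      (\<lambda>(t, x). complex_of_real (norm x powr (- \<alpha>)) * u (t, x)) \<in> Lp_space q \<and>
      Lp_norm q (\<lambda>(t, x). complex_of_real (norm x powr (- \<alpha>)) * u (t, x)) \<le> K * Lp_norm 2 \<phi>"
    if \<phi>: "\<phi> \<in> Lp_space 2" and rad: "radially_symmetric \<phi>" for \<phi> :: "real^'n \<Rightarrow> complex"
  proof -
    have \<phi>2: "\<phi> \<in> L2" using \<phi> unfolding Lp_space_2_eq .
    obtain g where g: "g \<in> borel_measurable borel" and eqg: "AE \<xi> in lborel. fourier_L2 \<phi> \<xi> = g (norm \<xi>)"
      using fourier_L2_radial[OF \<phi>2 rad] by blast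
    define A where "A = Lp_norm 2 \<phi>"
    have A: "A \<ge> 0" by (simp add: A_def Lp_norm_def)
    have "energy (\<lambda>\<xi>::real^'n. g (norm \<xi>)) = energy (fourier_L2 \<phi>)"
      by (rule energy_cong_AE) (use eqg in eventually_elim, simp)
    also have "\<dots> \<le> 2 * energy \<phi>" by (rule energy_fourier_L2_le[OF \<phi>2])
    also have "\<dots> = ennreal (2 * A\<^sup>2)" unfolding A_def by (simp add: energy_Lp_norm[OF \<phi>2] ennreal_mult)
    finally have Ele: "energy (\<lambda>\<xi>::real^'n. g (norm \<xi>)) \<le> ennreal (2 * A\<^sup>2)" .
    have E: "energy (\<lambda>\<xi>::real^'n. g (norm \<xi>)) < \<infinity>" using Ele by (rule le_less_trans) simp
    define e where "e = enn2real (energy (\<lambda>\<xi>::real^'n. g (norm \<xi>)))"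
    have e: "0 \<le> e" "e \<le> 2 * A\<^sup>2" unfolding e_def using Ele by (auto intro: enn2real_leI)
    obtain \<tau> :: "real \<times> (real^'n) \<Rightarrow> real" where \<tau>m [measurable]: "\<tau> \<in> borel_measurable borel" and \<tau>0: "\<And>z. 0 \<le> \<tau> z"
      and \<tau>1: "AE z in lborel. (\<Sum>n. ennreal (norm (wave_piece s g n z))) \<le> ennreal (\<tau> z)"
      and \<tau>2: "(\<integral>\<^sup>+z. ennreal (norm (snd z) powr (- \<alpha> * q) * \<tau> z powr q) \<partial>lborel) \<le> ennreal (C * e powr (q / 2))"
      using maj[OF g E] unfolding e_def by blast
    have sndm [measurable]: "snd \<in> borel_measurable (borel :: (real \<times> (real^'n)) measure)"
      by (intro borel_measurable_continuous_onI continuous_intros)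
    define u where "u z = (\<Sum>n. wave_piece s g n z)" for z :: "real \<times> (real^'n)"
    have um [measurable]: "u \<in> borel_measurable borel"
      unfolding u_def[abs_def] by (rule borel_measurable_suminf[OF wave_piece_measurable[OF g]])
    have ule: "AE z in lborel. norm (u z) \<le> \<tau> z"
      using \<tau>1
    proof eventually_elim
      case (elim z)
      then have "(\<Sum>n. ennreal (norm (wave_piece s g n z))) \<noteq> top" using neq_top_trans[OF ennreal_neq_top] by blast
      then have sm: "summable (\<lambda>n. norm (wave_piece s g n z))" by (intro summable_suminf_not_top) auto
      have "norm (u z) \<le> (\<Sum>n. norm (wave_piece s g n z))" unfolding u_def by (rule summable_norm[OF sm])
      also have "\<dots> \<le> \<tau> z"
      proof -
        have "ennreal (\<Sum>n. norm (wave_piece s g n z)) \<le> ennreal (\<tau> z)"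
          using elim suminf_ennreal2[OF norm_ge_zero sm] by simp
        then show ?thesis by (rule ennreal_le_iff[THEN iffD1, OF \<tau>0])
      qed
      finally show ?case .
    qed
    define v where "v = (\<lambda>(t, x). complex_of_real (norm x powr (- \<alpha>)) * u (t, x))"
    have v_eq: "v z = complex_of_real (norm (snd z) powr (- \<alpha>)) * u z" for z by (cases z) (simp add: v_def)
    have vm [measurable]: "v \<in> borel_measurable borel" unfolding v_eq[abs_def] by measurable
    have vint: "(\<integral>\<^sup>+z. ennreal (norm (v z) powr q) \<partial>lborel) \<le> ennreal (C * e powr (q / 2))"
    proof -
      have "(\<integral>\<^sup>+z. ennreal (norm (v z) powr q) \<partial>lborel) \<le> (\<integral>\<^sup>+z. ennreal (norm (snd z) powr (- \<alpha> * q) * \<tau> z powr q) \<partial>lborel)"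
      proof (rule nn_integral_mono_AE)
        from ule show "AE z in lborel. ennreal (norm (v z) powr q) \<le> ennreal (norm (snd z) powr (- \<alpha> * q) * \<tau> z powr q)"
        proof eventually_elim
          case (elim z)
          have "norm (v z) = norm (snd z) powr (- \<alpha>) * norm (u z)" by (simp add: v_eq norm_mult)
          then have "norm (v z) powr q = norm (snd z) powr (- \<alpha> * q) * norm (u z) powr q" by (simp only: powr_mult powr_powr)
          also have "\<dots> \<le> norm (snd z) powr (- \<alpha> * q) * \<tau> z powr q"
            using q0 elim by (intro mult_left_mono powr_mono2) auto
          finally show ?case by (rule ennreal_leI)
        qed
      qed
      then show ?thesis using \<tau>2 by (rule order_trans)
    qed
    have vi: "integrable lborel (\<lambda>z. norm (v z) powr q)"
      by (rule integrableI_bounded) (use le_less_trans[OF vint] in auto)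
    have vLp: "v \<in> Lp_space q" unfolding Lp_space_def using vi vm by simp
    have "Lp_norm q v \<le> K * A"
    proof -
      have "ennreal (\<integral>z. norm (v z) powr q \<partial>lborel) \<le> ennreal (C * e powr (q / 2))"
        using vint nn_integral_eq_integral[OF vi] by simp
      then have "(\<integral>z. norm (v z) powr q \<partial>lborel) \<le> C * e powr (q / 2)"
        by (rule ennreal_le_iff[THEN iffD1, rotated]) (use C in simp)
      also have "\<dots> \<le> C * (2 * A\<^sup>2) powr (q / 2)"
        using C e q0 by (intro mult_left_mono powr_mono2) auto
      finally have "Lp_norm q v \<le> (C * (2 * A\<^sup>2) powr (q / 2)) powr (1 / q)"
        unfolding Lp_norm_def using q0 by (intro powr_mono2 integral_nonneg_AE) auto
      also have "\<dots> = C powr (1 / q) * (2 * A\<^sup>2) powr (q / 2 * (1 / q))" by (simp only: powr_mult[of C] powr_powr)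
      also have "q / 2 * (1 / q) = 1 / 2" using q0 by simp
      also have "(2 * A\<^sup>2) powr (1 / 2) = sqrt 2 * A"
        using A by (simp add: powr_half_sqrt real_sqrt_mult)
      finally show ?thesis by (simp add: K_def)
    qed
    moreover have "represents u (\<lambda>t. abs_D s (schroedinger t \<phi>))"
    proof -
      have "AE z in lborel \<Otimes>\<^sub>M lborel. (\<Sum>n. ennreal (norm (wave_piece s g n z))) \<le> ennreal (\<tau> z)"
        using \<tau>1 unfolding lborel_prod .
      then have AE1: "AE t in lborel. AE x in lborel. (\<Sum>n. ennreal (norm (wave_piece s g n (t, x)))) \<le> ennreal (\<tau> (t, x))"
        by (rule lborel_pair.AE_pair)
      let ?h = "\<lambda>z. ennreal (norm (snd z) powr (- \<alpha> * q) * \<tau> z powr q)"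
      have hm: "?h \<in> borel_measurable (lborel \<Otimes>\<^sub>M lborel)" unfolding lborel_prod by measurable
      have "(\<integral>\<^sup>+t. \<integral>\<^sup>+x. ?h (t, x) \<partial>lborel \<partial>lborel) = (\<integral>\<^sup>+z. ?h z \<partial>lborel)"
        using lborel.nn_integral_fst[OF hm] unfolding lborel_prod .
      then have "(\<integral>\<^sup>+t. \<integral>\<^sup>+x. ?h (t, x) \<partial>lborel \<partial>lborel) \<le> ennreal (C * e powr (q / 2))"
        using \<tau>2 by (simp only:)
      then have "(\<integral>\<^sup>+t. \<integral>\<^sup>+x. ?h (t, x) \<partial>lborel \<partial>lborel) \<noteq> \<infinity>"
        unfolding infinity_ennreal_def by (rule neq_top_trans[OF ennreal_neq_top])
      then have AE2: "AE t in lborel. (\<integral>\<^sup>+x. ?h (t, x) \<partial>lborel) \<noteq> \<infinity>"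
        by (intro nn_integral_PInf_AE lborel.borel_measurable_nn_integral_fst[OF hm])
      from AE1 AE2 have "AE t in lborel. \<forall>\<psi>\<in>schwartz. integrable lborel (\<lambda>x. u (t, x) * \<psi> x) \<and>
        abs_D s (schroedinger t \<phi>) \<psi> = (\<integral>x. u (t, x) * \<psi> x \<partial>lborel)"
      proof eventually_elim
        case (elim t)
        have \<tau>t: "(\<lambda>x. \<tau> (t, x)) \<in> borel_measurable borel"
        proof -
          have "(\<lambda>x::real^'n. (t, x)) \<in> borel_measurable borel" by (intro borel_measurable_continuous_onI continuous_intros)
          from measurable_compose[OF this \<tau>m] show ?thesis .
        qed
        have fin: "(\<integral>\<^sup>+x. ennreal (norm x powr (- \<alpha> * q) * \<tau> (t, x) powr q) \<partial>lborel) < \<infinity>"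
          using elim(2) by (simp add: top.not_eq_extremum)
        show ?case
        proof
          fix \<psi> :: "real^'n \<Rightarrow> complex" assume \<psi>: "\<psi> \<in> schwartz"
          from wave_pairing[OF \<psi> g E s q \<alpha> \<tau>t \<tau>0 elim(1) fin] abs_D_schroedinger[OF \<phi>2 \<psi> g eqg, of s t]
          show "integrable lborel (\<lambda>x. u (t, x) * \<psi> x) \<and> abs_D s (schroedinger t \<phi>) \<psi> = (\<integral>x. u (t, x) * \<psi> x \<partial>lborel)"
            unfolding u_def by simp
        qed
      qed
      then show ?thesis unfolding represents_def using um by blast
    qed
    ultimately show ?thesis using vLp unfolding v_def A_def by blast
  qed
  with K show ?thesis by blast
qed

end
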